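(* The orbit space $G_{5,2}/T^5$ is a quotient space of the space $\mathcal{E}=\bigcup_{\sigma\in\mathcal{A}}\mathring{P}_\sigma\times\tilde F_{\sigma,ij}$ by the equivalence relation defined by the map $H:\mathcal{E}\to G_{5,2}/T^5$, $H(x,c)=h_\sigma^{-1}(x,g_{\sigma,ij}(c))$ for $(x,c)\in\mathring{P}_\sigma\times\tilde F_{\sigma,ij}$. That is, $H$ induces a homeomorphism from the quotient space $\mathcal{E}/\!\simeq$, where $e\simeq e'$ if and only if $H(e)=H(e')$, onto $G_{5,2}/T^5$.
   Context: Grassmannian and strata. $G_{5,2}$ is the manifold of $2$-dimensional subspaces $L\subset\mathbb{C}^5$ with the action of $(\mathbb{C}^* )^5\supset T^5$ induced by the coordinatewise action. For $I=\{i,j\}\subset\{1,\dots,5\}$, $P^I(L)$ is the Pl\"ucker coordinate (the $2\times2$ minor on rows $I$ of a $5\times 2$ matrix whose columns span $L$), and $M_{ij}=\{L:P^{ij}(L)\ne0\}$. For a set $\sigma$ of $2$-subsets, $W_\sigma=\{L: P^I(L)\neq0\iff I\in\sigma\}$; $\sigma$ is admissible if $W_\sigma\ne\emptyset$, and $\mathcal{A}$ is the set of admissible $\sigma$. The main stratum $W$ is the one where all $P^I\ne0$. The moment map is $\mu(L)=\sum_I|P^I(L)|^2\Lambda_I/\sum_I|P^I(L)|^2$, where $\Lambda_I\in\mathbb{R}^5$ is the $0/1$ indicator vector of $I$; its image is $\Delta_{5,2}=\{x\in[0,1]^5:\sum x_i=2\}$, and $\hat\mu:G_{5,2}/T^5\to\Delta_{5,2}$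 is the induced map. $P_\sigma$ is the convex hull of $\{\Lambda_I: I\in\sigma\}$, with relative interior $\mathring{P}_\sigma=\mu(W_\sigma)$. $F_\sigma=W_\sigma/(\mathbb{C}^* )^5$, $p_\sigma:W_\sigma/T^5\to F_\sigma$ is the projection, and $h_\sigma=(\hat\mu,p_\sigma):W_\sigma/T^5\to\mathring{P}_\sigma\times F_\sigma$ is a homeomorphism. For the main stratum write $F$ and $h$. Chart coordinates on $F$. On $M_{ij}$, $i<j$, represent $L$ by the matrix whose rows $i,j$ form the identity matrix and whose remaining three rows, in increasing order of index, are $(z_1,z_4),(z_2,z_5),(z_3,z_6)$. On $W$ put $(c_1:c_1')=(z_1z_5:z_2z_4)$, $(c_2:c_2')=(z_1z_6:z_3z_4)$, $(c_3:c_3')=(z_2z_6:z_3z_5)$. This identifies $F$ with $F_{ij}=\{((c_1:c_1'),(c_2:c_2'),(c_3:c_3'))\in(\mathbb{C}P^1)^3: c_1c_2'c_3=c_1'c_2c_3',\ c_m,c_m'\ne0,\ c_m\ne c_m'\}$; $f_{ij}:F_{ij}\to F$ denotes the resulting homeomorphism. Universal and virtual spaces of parameters. Let $\mathcal{F}=\{((c_1:c_1'),(c_2:c_2'),(c_3:c_3'))\in(\mathbb{C}P^1)^3: c_1c_2'c_3=c_1'c_2c_3'\}$ (a smooth surface), and let $\tilde{\mathcal{F}}$ be its blowup at the point $((1:1),(1:1),(1:1))$, so $F_{ij}\subset\tilde{\mathcal{F}}$. For $\sigma\in\mathcal{A}$, $\tilde F_{\sigma,ij}\subset\tilde{\mathcal{F}}$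 is the set of all $c$ for which there is a sequence $(x_n,c_n)\in\mathring{\Delta}_{5,2}\times F_{ij}$ such that $c_n\to c$ in $\tilde{\mathcal{F}}$ and $h^{-1}(x_n,f_{ij}(c_n))$ converges in $G_{5,2}/T^5$ to a point $y\in W_\sigma/T^5$. The canonical projection $g_{\sigma,ij}:\tilde F_{\sigma,ij}\to F_\sigma$ is $g_{\sigma,ij}(c)=p_\sigma(y)$, which does not depend on the choices. A chart $M_{ij}$ is fixed. Topology on $\mathcal{E}$. $\mathcal{P}$ is the formal (disjoint) union of all $P_\sigma$, $\sigma\in\mathcal{A}$; $\tilde\mu:G_{5,2}/T^5\to\mathcal{P}$ sends $X\in W_\sigma/T^5$ to the point $\hat\mu(X)$ of the copy $P_\sigma$; $U\subset\mathcal{P}$ is open iff $\tilde\mu^{-1}(U)$ is open. $\mathcal{E}$ is the (disjoint) union over $\sigma\in\mathcal{A}$ of the sets $\mathring{P}_\sigma\times\tilde F_{\sigma,ij}$, with the topology induced from the canonical embedding $\mathcal{E}\hookrightarrow\mathcal{P}\times\tilde{\mathcal{F}}$ given by the inclusions $\mathring{P}_\sigma\subset\mathcal{P}$, $\tilde F_{\sigma,ij}\subset\tilde{\mathcal{F}}$. *)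

theory Defs
  imports "HOL-Analysis.Analysis"
begin

section \<open>Final topologies\<close>

text \<open>The finest topology on the set \<open>S\<close> making \<open>f\<close>, a map from the space \<open>X\<close> to \<open>S\<close>,
  continuous. All quotient topologies below are of this form. The map need not be onto: this is
  used for the formal union of the polytopes.\<close>

definition final_topology :: "'a topology \<Rightarrow> 'b set \<Rightarrow> ('a \<Rightarrow> 'b) \<Rightarrow> 'b topology" where
  "final_topology X S f = topology (\<lambda>U. U \<subseteq> S \<and> openin X {x \<in> topspace X. f x \<in> U})"

lemma istopology_final:
  "istopology (\<lambda>U. U \<subseteq> S \<and> openin X {x \<in> topspace X. f x \<in> U})"
proof -
  have "openin X {x \<in> topspace X. f x \<in> U \<inter> V}"
    if "openin X {x \<in> topspace X. f x \<in> U}" "openin X {x \<in> topspace X. f x \<in> V}" for U V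
  proof -
    have "{x \<in> topspace X. f x \<in> U \<inter> V}
        = {x \<in> topspace X. f x \<in> U} \<inter> {x \<in> topspace X. f x \<in> V}"
      by auto
    then show ?thesis using that by (simp add: openin_Int)
  qed
  moreover have "openin X {x \<in> topspace X. f x \<in> \<Union>\<K>}"
    if "\<forall>K\<in>\<K>. openin X {x \<in> topspace X. f x \<in> K}" for \<K>
  proof -
    have "{x \<in> topspace X. f x \<in> \<Union>\<K>} = \<Union>((\<lambda>K. {x \<in> topspace X. f x \<in> K}) ` \<K>)"
      by auto
    then show ?thesis using that by (simp only:) (rule openin_Union, auto)
  qed
  ultimately show ?thesis
    unfolding istopology_def by (safe; blast)
qed

lemma openin_final_topology:
  "openin (final_topology X S f) U \<longleftrightarrow> U \<subseteq> S \<and> openin X {x \<in> topspace X. f x \<in> U}"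
  unfolding final_topology_def using istopology_final[of S X f] by (simp add: topology_inverse')

lemma topspace_final_topology:
  assumes "f \<in> topspace X \<rightarrow> S"
  shows "topspace (final_topology X S f) = S"
proof
  show "topspace (final_topology X S f) \<subseteq> S"
    using iffD1[OF openin_final_topology openin_topspace] by (rule conjunct1)
  have "{x \<in> topspace X. f x \<in> S} = topspace X"
    using assms by auto
  then have "openin (final_topology X S f) S"
    by (simp add: openin_final_topology)
  then show "S \<subseteq> topspace (final_topology X S f)"
    by (rule openin_subset)
qed


section \<open>The Grassmannian and the torus actions\<close>

text \<open>Row labels \<open>1, \<dots>, 5\<close> are represented, in the same order, by the elements
  \<open>0 < 1 < 2 < 3 < 4\<close> of the numeral type \<open>5\<close>. A matrix of type \<open>complex^2^5\<close> has 5 rows and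
  2 columns, and \<open>A $ k\<close> is its row \<open>k\<close>. In the type \<open>2\<close> the column labels are \<open>1\<close> and \<open>2\<close>.\<close>

definition G52 :: "(complex^5) set set" where
  "G52 = {L. vec.subspace L \<and> vec.dim L = 2}"

definition colspan :: "complex^2^5 \<Rightarrow> (complex^5) set" where
  "colspan A = vec.span (columns A)"

definition frames :: "(complex^2^5) set" where
  "frames = {A. colspan A \<in> G52}"

definition G52_top :: "(complex^5) set topology" where
  "G52_top = final_topology (top_of_set frames) G52 colspan"

definition T5 :: "(complex^5) set" where
  "T5 = {t. \<forall>k. norm (t $ k) = 1}"

definition CT5 :: "(complex^5) set" where
  "CT5 = {t. \<forall>k. t $ k \<noteq> 0}"

definition act :: "complex^5 \<Rightarrow> (complex^5) set \<Rightarrow> (complex^5) set" where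
  "act t L = (\<lambda>v. \<chi> k. t $ k * v $ k) ` L"

definition T_orbit :: "(complex^5) set \<Rightarrow> (complex^5) set set" where
  "T_orbit L = (\<lambda>t. act t L) ` T5"

definition CT_orbit :: "(complex^5) set \<Rightarrow> (complex^5) set set" where
  "CT_orbit L = (\<lambda>t. act t L) ` CT5"

definition GT :: "(complex^5) set set set" where
  "GT = T_orbit ` G52"

definition GT_top :: "(complex^5) set set topology" where
  "GT_top = final_topology G52_top GT T_orbit"


section \<open>Pluecker coordinates, strata and the moment map\<close>

definition pairs :: "5 set set" where
  "pairs = {I. card I = 2}"

definition minor :: "complex^2^5 \<Rightarrow> 5 set \<Rightarrow> complex" where
  "minor A I = A $ Min I $ 1 * A $ Max I $ 2 - A $ Min I $ 2 * A $ Max I $ 1"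

text \<open>The Pluecker coordinates of \<open>L\<close> are determined only up to a common nonzero factor. They are
  fixed here by an arbitrary choice of a basis; everything below is independent of it.\<close>

definition pluecker :: "5 set \<Rightarrow> (complex^5) set \<Rightarrow> complex" where
  "pluecker I L = minor (SOME A. colspan A = L) I"

definition stratum :: "5 set set \<Rightarrow> (complex^5) set set" where
  "stratum \<sigma> = {L \<in> G52. \<forall>I \<in> pairs. pluecker I L \<noteq> 0 \<longleftrightarrow> I \<in> \<sigma>}"

definition admissible :: "5 set set set" where
  "admissible = {\<sigma>. \<sigma> \<subseteq> pairs \<and> stratum \<sigma> \<noteq> {}}"

definition Lam :: "5 set \<Rightarrow> real^5" where
  "Lam I = (\<chi> k. if k \<in> I then 1 else 0)"

definition moment :: "(complex^5) set \<Rightarrow> real^5" where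
  "moment L = (\<Sum>I\<in>pairs. (norm (pluecker I L))\<^sup>2 *\<^sub>R Lam I) /\<^sub>R (\<Sum>I\<in>pairs. (norm (pluecker I L))\<^sup>2)"

definition moment_hat :: "(complex^5) set set \<Rightarrow> real^5" where
  "moment_hat X = the_elem (moment ` X)"

definition Delta52 :: "(real^5) set" where
  "Delta52 = {x. (\<forall>k. 0 \<le> x $ k \<and> x $ k \<le> 1) \<and> (\<Sum>k\<in>UNIV. x $ k) = 2}"

definition poly_of :: "5 set set \<Rightarrow> (real^5) set" where
  "poly_of \<sigma> = convex hull (Lam ` \<sigma>)"

definition stratum_T :: "5 set set \<Rightarrow> (complex^5) set set set" where
  "stratum_T \<sigma> = T_orbit ` stratum \<sigma>"

definition F_space :: "5 set set \<Rightarrow> (complex^5) set set set" where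
  "F_space \<sigma> = CT_orbit ` stratum \<sigma>"

text \<open>The \<open>(\<complex>\<^sup>*)\<^sup>5\<close>-orbit containing the \<open>T\<^sup>5\<close>-orbit \<open>X\<close>. The formulas for \<open>p\<^sub>\<sigma>\<close> and \<open>h\<^sub>\<sigma>\<close> do not
  involve \<open>\<sigma>\<close>, which only specifies the domain.\<close>

definition p_map :: "(complex^5) set set \<Rightarrow> (complex^5) set set" where
  "p_map X = \<Union> (CT_orbit ` X)"

definition h_map :: "(complex^5) set set \<Rightarrow> (real^5) \<times> (complex^5) set set" where
  "h_map X = (moment_hat X, p_map X)"

definition h_inv :: "5 set set \<Rightarrow> (real^5) \<times> (complex^5) set set \<Rightarrow> (complex^5) set set" where
  "h_inv \<sigma> = the_inv_into (stratum_T \<sigma>) h_map"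


section \<open>Projective spaces and the universal space of parameters\<close>

text \<open>Points of a projective space are lines through the origin.\<close>

definition line :: "complex^'n \<Rightarrow> (complex^'n) set" where
  "line v = vec.span {v}"

definition proj_top :: "(complex^'n) set topology" where
  "proj_top = final_topology (top_of_set (- {0})) (line ` (- {0})) line"

definition hom2 :: "complex \<Rightarrow> complex \<Rightarrow> (complex^2) set" where
  "hom2 a b = line (vector [a, b])"

type_synonym p1_cubed = "(complex^2) set \<times> (complex^2) set \<times> (complex^2) set"

definition p1_cubed_top :: "p1_cubed topology" where
  "p1_cubed_top = prod_topology proj_top (prod_topology proj_top proj_top)"

definition calF :: "p1_cubed set" where
  "calF = {(hom2 c1 c1', hom2 c2 c2', hom2 c3 c3') | c1 c1' c2 c2' c3 c3'.
     (c1, c1') \<noteq> (0, 0) \<and> (c2, c2') \<noteq> (0, 0) \<and> (c3, c3') \<noteq> (0, 0)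
     \<and> c1 * c2' * c3 = c1' * c2 * c3'}"

definition F_coord :: "p1_cubed set" where
  "F_coord = {(hom2 c1 c1', hom2 c2 c2', hom2 c3 c3') | c1 c1' c2 c2' c3 c3'.
     c1 \<noteq> 0 \<and> c1' \<noteq> 0 \<and> c2 \<noteq> 0 \<and> c2' \<noteq> 0 \<and> c3 \<noteq> 0 \<and> c3' \<noteq> 0
     \<and> c1 \<noteq> c1' \<and> c2 \<noteq> c2' \<and> c3 \<noteq> c3'
     \<and> c1 * c2' * c3 = c1' * c2 * c3'}"

definition pt_one :: p1_cubed where
  "pt_one = (hom2 1 1, hom2 1 1, hom2 1 1)"

text \<open>The blowup of a projective variety at a point is the closure of the graph of the linear
  projection from that point. Here \<open>(\<complex>P\<^sup>1)\<^sup>3\<close> is Segre-embedded in \<open>\<complex>P\<^sup>7\<close>, where the point \<open>pt_one\<close>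
  has all homogeneous coordinates equal. The projection from it goes onto the hyperplane in which
  the coordinate \<open>(2,2,2)\<close> vanishes. Scaling \<open>u, v, w\<close> only scales the image vector, so for
  \<open>q \<noteq> pt_one\<close> the span in \<open>proj_from_one q\<close> is a line.\<close>

definition segre :: "complex^2 \<Rightarrow> complex^2 \<Rightarrow> complex^2 \<Rightarrow> complex^(2 \<times> 2 \<times> 2)" where
  "segre u v w = (\<chi> k. case k of (a, b, d) \<Rightarrow> u $ a * v $ b * w $ d)"

definition drop_one :: "complex^(2 \<times> 2 \<times> 2) \<Rightarrow> complex^(2 \<times> 2 \<times> 2)" where
  "drop_one t = (\<chi> k. t $ k - t $ (2, 2, 2))"

definition proj_from_one :: "p1_cubed \<Rightarrow> (complex^(2 \<times> 2 \<times> 2)) set" where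
  "proj_from_one q = (case q of (l1, l2, l3) \<Rightarrow>
     vec.span {drop_one (segre u v w) | u v w. u \<in> l1 \<and> v \<in> l2 \<and> w \<in> l3})"

type_synonym bl_point = "p1_cubed \<times> (complex^(2 \<times> 2 \<times> 2)) set"

definition bl_incl :: "p1_cubed \<Rightarrow> bl_point" where
  "bl_incl q = (q, proj_from_one q)"

definition Ftilde :: "bl_point set" where
  "Ftilde = prod_topology p1_cubed_top proj_top closure_of (bl_incl ` (calF - {pt_one}))"

definition Ftilde_top :: "bl_point topology" where
  "Ftilde_top = subtopology (prod_topology p1_cubed_top proj_top) Ftilde"


section \<open>Chart coordinates on the main stratum\<close>

definition chart_matrix :: "5 \<Rightarrow> 5 \<Rightarrow> (complex^5) set \<Rightarrow> complex^2^5" where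
  "chart_matrix i j L =
     (THE A. colspan A = L \<and> A $ i = vector [1, 0] \<and> A $ j = vector [0, 1])"

definition chart_coords :: "5 \<Rightarrow> 5 \<Rightarrow> (complex^5) set \<Rightarrow> p1_cubed" where
  "chart_coords i j L =
     (let A = chart_matrix i j L;
          ks = sorted_list_of_set (UNIV - {i, j});
          z1 = A $ (ks ! 0) $ 1; z4 = A $ (ks ! 0) $ 2;
          z2 = A $ (ks ! 1) $ 1; z5 = A $ (ks ! 1) $ 2;
          z3 = A $ (ks ! 2) $ 1; z6 = A $ (ks ! 2) $ 2
      in (hom2 (z1 * z5) (z2 * z4), hom2 (z1 * z6) (z3 * z4), hom2 (z2 * z6) (z3 * z5)))"

text \<open>\<open>f\<^sub>i\<^sub>j : F_coord \<rightarrow> F\<close> is inverse to the map induced on \<open>(\<complex>\<^sup>*)\<^sup>5\<close>-orbits by the coordinates. The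
  main stratum is the stratum of \<open>\<sigma> = pairs\<close>.\<close>

definition f_chart :: "5 \<Rightarrow> 5 \<Rightarrow> p1_cubed \<Rightarrow> (complex^5) set set" where
  "f_chart i j = the_inv_into (F_space pairs) (\<lambda>Y. the_elem (chart_coords i j ` Y))"


section \<open>Virtual spaces of parameters\<close>

definition approximates ::
  "5 set set \<Rightarrow> 5 \<Rightarrow> 5 \<Rightarrow> bl_point \<Rightarrow> (complex^5) set set \<Rightarrow> bool" where
  "approximates \<sigma> i j c y \<longleftrightarrow> y \<in> stratum_T \<sigma> \<and>
     (\<exists>(x :: nat \<Rightarrow> real^5) (q :: nat \<Rightarrow> p1_cubed).
        (\<forall>n. x n \<in> rel_interior Delta52 \<and> q n \<in> F_coord)
        \<and> limitin Ftilde_top (\<lambda>n. bl_incl (q n)) c sequentially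
        \<and> limitin GT_top (\<lambda>n. h_inv pairs (x n, f_chart i j (q n))) y sequentially)"

definition Ftilde_virt :: "5 set set \<Rightarrow> 5 \<Rightarrow> 5 \<Rightarrow> bl_point set" where
  "Ftilde_virt \<sigma> i j = {c \<in> Ftilde. \<exists>y. approximates \<sigma> i j c y}"

definition g_proj :: "5 set set \<Rightarrow> 5 \<Rightarrow> 5 \<Rightarrow> bl_point \<Rightarrow> (complex^5) set set" where
  "g_proj \<sigma> i j c = (THE f. \<exists>y. approximates \<sigma> i j c y \<and> f = p_map y)"


section \<open>The spaces \<open>\<P>\<close> and \<open>\<E>\<close> and the map \<open>H\<close>\<close>

text \<open>A point of the copy of \<open>P\<^sub>\<sigma>\<close> in the disjoint union is tagged with \<open>\<sigma>\<close>.\<close>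

type_synonym calP_point = "5 set set \<times> (real^5)"

definition calP :: "calP_point set" where
  "calP = Sigma admissible poly_of"

definition moment_tilde :: "(complex^5) set set \<Rightarrow> calP_point" where
  "moment_tilde X = (THE \<sigma>. \<sigma> \<in> admissible \<and> X \<in> stratum_T \<sigma>, moment_hat X)"

definition calP_top :: "calP_point topology" where
  "calP_top = final_topology GT_top calP moment_tilde"

text \<open>\<open>\<E>\<close> is identified with its image in \<open>\<P> \<times> Ftilde\<close>; disjointness comes from the tag \<open>\<sigma>\<close>.\<close>

definition calE :: "5 \<Rightarrow> 5 \<Rightarrow> (calP_point \<times> bl_point) set" where
  "calE i j = {((\<sigma>, x), c) | \<sigma> x c.
     \<sigma> \<in> admissible \<and> x \<in> rel_interior (poly_of \<sigma>) \<and> c \<in> Ftilde_virt \<sigma> i j}"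

definition calE_top :: "5 \<Rightarrow> 5 \<Rightarrow> (calP_point \<times> bl_point) topology" where
  "calE_top i j = subtopology (prod_topology calP_top Ftilde_top) (calE i j)"

definition H_map :: "5 \<Rightarrow> 5 \<Rightarrow> calP_point \<times> bl_point \<Rightarrow> (complex^5) set set" where
  "H_map i j e = (case e of ((\<sigma>, x), c) \<Rightarrow> h_inv \<sigma> (x, g_proj \<sigma> i j c))"

definition H_rel :: "5 \<Rightarrow> 5 \<Rightarrow> ((calP_point \<times> bl_point) \<times> (calP_point \<times> bl_point)) set" where
  "H_rel i j = {(e, e'). e \<in> calE i j \<and> e' \<in> calE i j \<and> H_map i j e = H_map i j e'}"

definition calE_quot_top :: "5 \<Rightarrow> 5 \<Rightarrow> (calP_point \<times> bl_point) set topology" where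
  "calE_quot_top i j =
     final_topology (calE_top i j) (calE i j // H_rel i j) (\<lambda>e. H_rel i j `` {e})"

definition H_induced :: "5 \<Rightarrow> 5 \<Rightarrow> (calP_point \<times> bl_point) set \<Rightarrow> (complex^5) set set" where
  "H_induced i j C = the_elem (H_map i j ` C)"

end

theory Submission
  imports Defs
begin

text \<open>Let \<open>\<Gamma>\<close> be the closure of the set of pairs (parameter, torus orbit) coming from the main
  stratum, in the product of \<open>Ftilde\<close> and the orbit space. It is compact, and a point of the virtual
  space of parameters of \<open>\<sigma>\<close> is a parameter \<open>c\<close> with \<open>(c, y) \<in> \<Gamma>\<close> for some \<open>y\<close> in the stratum of
  \<open>\<sigma>\<close>. The parameter \<open>c\<close> fixes, for every four rows, a line containing the vector of the three
  products of complementary Pluecker coordinates of \<open>y\<close>; for the two quadruples of rows that omit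
  \<open>i\<close> or \<open>j\<close> this needs the blowup coordinates. Two subspaces that satisfy the same such conditions
  and have the same moment \<open>x\<close> lie in the same stratum, by a matroid argument, hence in the same
  orbit of the complex torus, and then in the same orbit of the compact torus by the injectivity of
  the mean of an exponential family. Thus \<open>(c, x)\<close> determines \<open>y\<close>, so \<open>\<Gamma>\<close> maps bijectively onto
  \<open>\<E>\<close>, and \<open>\<E>\<close> is Hausdorff. Since \<open>\<Gamma>\<close> is compact, this bijection is a homeomorphism that turns
  \<open>H\<close> into the projection of \<open>\<Gamma>\<close> to the orbit space, a continuous surjection of a compact space onto
  a Hausdorff space.\<close>

section \<open>Topological preliminaries\<close>

text \<open>Virtual parameters are defined by convergent sequences, compactness arguments by
  closures. The two meet in a Euclidean space of unit vectors and normalized frames: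
  \<open>Gamma\<close> is the image of a closure taken there, so every point of it is a limit of a
  sequence from the main stratum. The blowup has one purpose. If row \<open>i\<close> or
  \<open>j\<close> is left out, the cross ratio of the other four rows is a rational function of the
  three coordinates, indeterminate only at \<open>((1:1),(1:1),(1:1))\<close>; over that point a
  coordinate on the exceptional curve supplies its value. The projections \<open>g_proj\<close> are
  shown to be well defined along the way. The complex torus preserves the fibres of
  \<open>Gamma\<close> over the parameter space, so any two candidates in a stratum can be moved to
  the same moment, where the fibre has a single point. One statement carries both halves of the
  argument: compatible frames with equal moments have equal orbits. It gives that uniqueness, and it
  shows that the continuous orbit invariants separate orbits, hence that the orbit space is
  Hausdorff.\<close>

lemma continuous_map_into_final_topology:
  assumes "f \<in> topspace X \<rightarrow> S"
  shows "continuous_map X (final_topology X S f) f"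
  using assms by (auto simp: continuous_map_def topspace_final_topology openin_final_topology)

lemma continuous_map_from_final_topology:
  assumes "f \<in> topspace X \<rightarrow> S" "continuous_map X Y (g \<circ> f)" "g \<in> S \<rightarrow> topspace Y"
  shows "continuous_map (final_topology X S f) Y g"
  unfolding continuous_map_def
proof (intro conjI allI impI)
  show "g \<in> topspace (final_topology X S f) \<rightarrow> topspace Y"
    using assms by (simp add: topspace_final_topology)
  fix U assume "openin Y U"
  then have "openin X {x \<in> topspace X. (g \<circ> f) x \<in> U}"
    using assms(2) by (rule openin_continuous_map_preimage[rotated])
  moreover have "{x \<in> topspace X. (g \<circ> f) x \<in> U}
      = {x \<in> topspace X. f x \<in> {s \<in> S. g s \<in> U}}"
    using assms(1) by auto
  ultimately show "openin (final_topology X S f) {x \<in> topspace (final_topology X S f). g x \<in> U}"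
    using assms(1) by (simp add: openin_final_topology topspace_final_topology)
qed

section \<open>Brackets\<close>

definition br :: "complex^2^5 \<Rightarrow> 5 \<Rightarrow> 5 \<Rightarrow> complex" where
  "br A a b = A $ a $ 1 * A $ b $ 2 - A $ a $ 2 * A $ b $ 1"

lemma br_self [simp]: "br A a a = 0"
  by (simp add: br_def)

lemma br_swap: "br A b a = - br A a b"
  by (simp add: br_def)

lemma br_pluecker: "br A a b * br A c d - br A a c * br A b d + br A a d * br A b c = 0"
  unfolding br_def by algebra

lemma columns_eq: "columns (A :: complex^2^5) = {column 1 A, column 2 A}"
  unfolding columns_def by (auto simp: UNIV_2)

lemma mem_colspan: "v \<in> colspan A \<longleftrightarrow> (\<exists>p r. \<forall>k. v $ k = p * A $ k $ 1 + r * A $ k $ 2)"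
proof -
  have "v \<in> colspan A \<longleftrightarrow> (\<exists>p r. v - p *s column 1 A = r *s column 2 A)"
    by (auto simp: colspan_def columns_eq vec.span_breakdown_eq)
  also have "\<dots> \<longleftrightarrow> (\<exists>p r. \<forall>k. v $ k = p * A $ k $ 1 + r * A $ k $ 2)"
    by (simp add: vec_eq_iff column_def algebra_simps diff_eq_eq)
  finally show ?thesis .
qed

lemma colspan_subspace: "vec.subspace (colspan A)"
  unfolding colspan_def by (rule vec.subspace_span)

text \<open>Cramer's rule for the rows \<open>a\<close> and \<open>b\<close>. The condition is
  homogeneous in the brackets, so proportional brackets give the same span.\<close>

lemma mem_colspan_br:
  assumes ab: "br A a b \<noteq> 0"
  shows "v \<in> colspan A \<longleftrightarrow> (\<forall>k. v $ k * br A a b = v $ a * br A k b + v $ b * br A a k)"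
proof
  assume "v \<in> colspan A"
  then obtain p r where "\<forall>k. v $ k = p * A $ k $ 1 + r * A $ k $ 2"
    using mem_colspan by blast
  then show "\<forall>k. v $ k * br A a b = v $ a * br A k b + v $ b * br A a k"
    unfolding br_def by (simp add: algebra_simps)
next
  assume v: "\<forall>k. v $ k * br A a b = v $ a * br A k b + v $ b * br A a k"
  let ?p = "(v $ a * A $ b $ 2 - v $ b * A $ a $ 2) / br A a b"
  let ?r = "(v $ b * A $ a $ 1 - v $ a * A $ b $ 1) / br A a b"
  have "v $ k = ?p * A $ k $ 1 + ?r * A $ k $ 2" for k
  proof -
    have "v $ k * br A a b = (?p * A $ k $ 1 + ?r * A $ k $ 2) * br A a b"
      using ab v[rule_format, of k] by (simp add: field_simps) (simp add: br_def algebra_simps)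
    then show ?thesis using ab by simp
  qed
  then show "v \<in> colspan A" unfolding mem_colspan by blast
qed

lemma colspan_in_G52_iff: "colspan A \<in> G52 \<longleftrightarrow> (\<exists>a b. br A a b \<noteq> 0)"
proof
  assume "colspan A \<in> G52"
  then have d: "vec.dim {column 1 A, column 2 A} = 2"
    by (simp add: G52_def colspan_def columns_eq)
  show "\<exists>a b. br A a b \<noteq> 0"
  proof (rule ccontr)
    assume "\<not> ?thesis"
    then have z: "br A a b = 0" for a b by blast
    have "\<exists>x. {column 1 A, column 2 A} \<subseteq> vec.span {x}"
    proof (cases "column 1 A = 0")
      case True
      then show ?thesis
        by (intro exI[of _ "column 2 A"]) (simp add: vec.span_zero vec.span_base)
    next
      case False
      then obtain a where a: "A $ a $ 1 \<noteq> 0" by (auto simp: vec_eq_iff column_def)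
      have "column 2 A = (A $ a $ 2 / A $ a $ 1) *s column 1 A"
        using z[of a] a by (simp add: vec_eq_iff column_def br_def field_simps)
      then have "column 2 A \<in> vec.span {column 1 A}"
        by (metis vec.span_base vec.span_scale singletonI)
      then show ?thesis
        by (intro exI[of _ "column 1 A"]) (simp add: vec.span_base)
    qed
    then obtain x where "{column 1 A, column 2 A} \<subseteq> vec.span {x}" by blast
    then have "vec.dim {column 1 A, column 2 A} \<le> card {x}"
      by (rule vec.dim_le_card) simp
    with d show False by simp
  qed
next
  assume "\<exists>a b. br A a b \<noteq> 0"
  then obtain a b where ab: "br A a b \<noteq> 0" by blast
  have n: "p = 0 \<and> r = 0" if "p *s column 1 A + r *s column 2 A = 0" for p r
  proof -
    have "p * A $ k $ 1 + r * A $ k $ 2 = 0" for k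
      using arg_cong[OF that, of "\<lambda>v. v $ k"] by (simp add: column_def)
    from this[of a] this[of b] have k: "p * A $ a $ 1 + r * A $ a $ 2 = 0" "p * A $ b $ 1 + r * A $ b $ 2 = 0"
      by auto
    have "p * br A a b = (p * A $ a $ 1 + r * A $ a $ 2) * A $ b $ 2
        - A $ a $ 2 * (p * A $ b $ 1 + r * A $ b $ 2)"
      "r * br A a b = A $ a $ 1 * (p * A $ b $ 1 + r * A $ b $ 2)
        - (p * A $ a $ 1 + r * A $ a $ 2) * A $ b $ 1"
      by (simp_all add: br_def algebra_simps)
    then have "p * br A a b = 0" "r * br A a b = 0"
      unfolding k by simp_all
    then show ?thesis using ab by simp
  qed
  have 2: "column 2 A \<noteq> 0" using n[of 0 1] by auto
  have 1: "column 1 A \<notin> vec.span {column 2 A}"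
  proof
    assume "column 1 A \<in> vec.span {column 2 A}"
    then obtain r where "column 1 A = r *s column 2 A" by (auto simp: vec.span_breakdown_eq)
    then show False using n[of 1 "-r"] by simp
  qed
  have ne: "column 1 A \<noteq> column 2 A" using 1 vec.span_base[of "column 2 A" "{column 2 A}"] by auto
  have "vec.independent {column 1 A, column 2 A}"
    using 1 2 by (auto simp: vec.independent_insert ne)
  then have "vec.dim (colspan A) = 2"
    using ne by (simp add: colspan_def columns_eq vec.dim_eq_card_independent)
  then show "colspan A \<in> G52" by (simp add: G52_def colspan_subspace)
qed

lemma frames_iff: "A \<in> frames \<longleftrightarrow> (\<exists>a b. br A a b \<noteq> 0)"
  by (simp add: frames_def colspan_in_G52_iff)

lemma G52_obtain_frame:
  assumes "L \<in> G52"
  obtains A where "A \<in> frames" "colspan A = L"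
proof -
  from assms have L: "vec.subspace L" "vec.dim L = 2" by (auto simp: G52_def)
  obtain B where B: "B \<subseteq> L" "vec.independent B" "L \<subseteq> vec.span B" "card B = vec.dim L"
    by (rule vec.basis_exists)
  with L obtain x y where xy: "B = {x, y}" by (auto simp: card_2_iff)
  have LB: "L = vec.span B"
    by (intro subset_antisym B(3) vec.span_minimal B(1) L(1))
  define A :: "complex^2^5" where "A = (\<chi> k. vector [x $ k, y $ k])"
  have "column 1 A = x" "column 2 A = y" by (auto simp: A_def column_def vec_eq_iff)
  then have "colspan A = L" by (simp add: colspan_def columns_eq LB xy)
  with assms show thesis by (intro that[of A]) (auto simp: frames_def)
qed

text \<open>The columns of \<open>B\<close> are combinations of those of \<open>A\<close>;
  \<open>d\<close> is the determinant of this base change.\<close>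

lemma br_colspan_eq:
  assumes "colspan A = colspan B" "A \<in> frames"
  obtains d where "d \<noteq> 0" "\<And>a b. br B a b = d * br A a b"
proof -
  have "column c B \<in> colspan A" for c
    unfolding assms(1) unfolding colspan_def columns_def by (rule vec.span_base) auto
  then have "\<forall>c. \<exists>pr. \<forall>k. B $ k $ c = fst pr * A $ k $ 1 + snd pr * A $ k $ 2"
    by (simp add: mem_colspan column_def)
  then obtain f where f: "\<And>c k. B $ k $ c = fst (f c) * A $ k $ 1 + snd (f c) * A $ k $ 2"
    using choice[of "\<lambda>c pr. \<forall>k. B $ k $ c = fst pr * A $ k $ 1 + snd pr * A $ k $ 2"] by blast
  define p where "p c = fst (f c)" for c
  define r where "r c = snd (f c)" for c
  have pr: "B $ k $ c = p c * A $ k $ 1 + r c * A $ k $ 2" for c k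
    by (simp add: p_def r_def f)
  let ?d = "p 1 * r 2 - r 1 * p 2"
  have d: "br B a b = ?d * br A a b" for a b
    unfolding br_def pr by (simp add: algebra_simps)
  have "B \<in> frames" using assms by (simp add: frames_def)
  then have "?d \<noteq> 0" using d by (auto simp: frames_iff)
  with d show thesis using that by blast
qed

lemma colspan_eqI:
  assumes "A \<in> frames" "d \<noteq> 0" "\<And>a b. br B a b = d * br A a b"
  shows "colspan B = colspan A"
proof -
  obtain a b where ab: "br A a b \<noteq> 0" using assms(1) by (auto simp: frames_iff)
  then have ab': "br B a b \<noteq> 0" using assms by simp
  have "v \<in> colspan B \<longleftrightarrow> v \<in> colspan A" for v
  proof -
    have "(v $ k * br B a b = v $ a * br B k b + v $ b * br B a k) \<longleftrightarrow>
        d * (v $ k * br A a b) = d * (v $ a * br A k b + v $ b * br A a k)" for k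
      by (simp add: assms(3) algebra_simps)
    then show ?thesis
      using assms(2) by (simp add: mem_colspan_br[OF ab] mem_colspan_br[OF ab'])
  qed
  then show ?thesis by blast
qed

section \<open>Torus actions on frames, subspaces and orbits\<close>

definition scale :: "complex^5 \<Rightarrow> complex^2^5 \<Rightarrow> complex^2^5" where
  "scale t A = (\<chi> k. t $ k *s A $ k)"

lemma br_scale: "br (scale t A) a b = t $ a * t $ b * br A a b"
  by (simp add: br_def scale_def algebra_simps)

lemma act_colspan: "act t (colspan A) = colspan (scale t A)"
proof -
  have "v \<in> act t (colspan A) \<longleftrightarrow> v \<in> colspan (scale t A)" for v
  proof
    assume "v \<in> act t (colspan A)"
    then obtain u where "u \<in> colspan A" "v = (\<chi> k. t $ k * u $ k)" by (auto simp: act_def)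
    then show "v \<in> colspan (scale t A)"
      unfolding mem_colspan scale_def by (force simp: algebra_simps)
  next
    assume "v \<in> colspan (scale t A)"
    then obtain p r where pr: "\<forall>k. v $ k = p * scale t A $ k $ 1 + r * scale t A $ k $ 2"
      unfolding mem_colspan by blast
    have "(\<chi> k. p * A $ k $ 1 + r * A $ k $ 2) \<in> colspan A"
      unfolding mem_colspan by auto
    moreover have "v = (\<chi> k. t $ k * (\<chi> k. p * A $ k $ 1 + r * A $ k $ 2) $ k)"
      using pr by (simp add: vec_eq_iff scale_def algebra_simps)
    ultimately show "v \<in> act t (colspan A)" unfolding act_def by blast
  qed
  then show ?thesis by blast
qed

lemma scale_frames: "A \<in> frames \<Longrightarrow> t \<in> CT5 \<Longrightarrow> scale t A \<in> frames"
  by (auto simp: frames_iff br_scale CT5_def) 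

lemma T5_subset_CT5: "T5 \<subseteq> CT5"
  unfolding T5_def CT5_def by clarsimp (metis norm_zero zero_neq_one)

definition tmul :: "complex^5 \<Rightarrow> complex^5 \<Rightarrow> complex^5" where
  "tmul s t = (\<chi> k. s $ k * t $ k)"

definition tinv :: "complex^5 \<Rightarrow> complex^5" where
  "tinv t = (\<chi> k. inverse (t $ k))"

lemma act_act: "act s (act t L) = act (tmul s t) L"
  unfolding act_def tmul_def by (simp add: image_image mult.assoc)

lemma act_one: "act (\<chi> k. 1) L = L"
  unfolding act_def by simp

lemma tmul_closed:
  "s \<in> CT5 \<Longrightarrow> t \<in> CT5 \<Longrightarrow> tmul s t \<in> CT5" "s \<in> T5 \<Longrightarrow> t \<in> T5 \<Longrightarrow> tmul s t \<in> T5"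
  "t \<in> CT5 \<Longrightarrow> tinv t \<in> CT5" "t \<in> T5 \<Longrightarrow> tinv t \<in> T5"
  "(\<chi> k. 1) \<in> CT5" "(\<chi> k. 1) \<in> T5"
  by (simp_all add: CT5_def T5_def tmul_def tinv_def norm_mult norm_inverse)

lemma tmul_tinv: "t \<in> CT5 \<Longrightarrow> tmul (tinv t) t = (\<chi> k. 1)"
  by (simp add: CT5_def tmul_def tinv_def)

lemma tmul_commute: "tmul s t = tmul t s"
  by (simp add: tmul_def mult.commute)

lemma tmul_assoc: "tmul (tmul r s) t = tmul r (tmul s t)"
  by (simp add: tmul_def mult.assoc)

lemma tmul_one: "tmul t (\<chi> k. 1) = t"
  by (simp add: tmul_def vec_eq_iff)

lemma T_orbit_self: "L \<in> T_orbit L" and CT_orbit_self: "L \<in> CT_orbit L"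
  unfolding T_orbit_def CT_orbit_def
  by (rule image_eqI[where x="\<chi> k. 1"], simp add: act_one, simp add: tmul_closed)+

lemma T_orbit_act:
  assumes s: "s \<in> T5"
  shows "T_orbit (act s L) = T_orbit L"
proof -
  have "(\<lambda>t. tmul t s) ` T5 = T5"
  proof
    show "T5 \<subseteq> (\<lambda>t. tmul t s) ` T5"
    proof
      fix t assume t: "t \<in> T5"
      have "t = tmul (tmul t (tinv s)) s"
        using s T5_subset_CT5 by (auto simp: tmul_assoc tmul_tinv tmul_one)
      then show "t \<in> (\<lambda>t. tmul t s) ` T5" using tmul_closed s t by blast
    qed
  qed (use s tmul_closed in auto)
  from arg_cong[OF this, of "image (\<lambda>t. act t L)"] show ?thesis
    by (simp only: T_orbit_def act_act image_image)
qed

lemma CT_orbit_act: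
  assumes s: "s \<in> CT5"
  shows "CT_orbit (act s L) = CT_orbit L"
proof -
  have "(\<lambda>t. tmul t s) ` CT5 = CT5"
  proof
    show "CT5 \<subseteq> (\<lambda>t. tmul t s) ` CT5"
    proof
      fix t assume t: "t \<in> CT5"
      have "t = tmul (tmul t (tinv s)) s"
        using s by (auto simp: tmul_assoc tmul_tinv tmul_one)
      then show "t \<in> (\<lambda>t. tmul t s) ` CT5" using tmul_closed s t by blast
    qed
  qed (use s tmul_closed in auto)
  from arg_cong[OF this, of "image (\<lambda>t. act t L)"] show ?thesis
    by (simp only: CT_orbit_def act_act image_image)
qed

lemma T_orbit_eqD: "T_orbit L = T_orbit L' \<Longrightarrow> \<exists>t\<in>T5. L' = act t L"
  using T_orbit_self[of L'] unfolding T_orbit_def by blast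

lemma CT_orbit_eqD: "CT_orbit L = CT_orbit L' \<Longrightarrow> \<exists>t\<in>CT5. L' = act t L"
  using CT_orbit_self[of L'] unfolding CT_orbit_def by blast

lemma p_map_T_orbit: "p_map (T_orbit L) = CT_orbit L"
proof -
  have "CT_orbit M = CT_orbit L" if "M \<in> T_orbit L" for M
    using that T5_subset_CT5 by (auto simp: T_orbit_def CT_orbit_act)
  then show ?thesis unfolding p_map_def using T_orbit_self by blast
qed

section \<open>Exponential families on finite point sets\<close>

text \<open>Equality of the means makes the symmetrized Kullback-Leibler divergence of the two
  probability vectors, the sum of \<open>(p' - p) * ln (p' / p)\<close>, equal to zero. Its terms
  are nonnegative, so each of them vanishes.\<close>

lemma exp_family_mean_eqD:
  fixes v :: "'i \<Rightarrow> 'a::real_inner"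
  assumes fin: "finite S" and ne: "S \<noteq> {}" and w: "\<And>i. i \<in> S \<Longrightarrow> w i > 0"
    and mean: "(\<Sum>i\<in>S. (w i * exp (s \<bullet> v i)) *\<^sub>R v i) /\<^sub>R (\<Sum>i\<in>S. w i * exp (s \<bullet> v i))
             = (\<Sum>i\<in>S. w i *\<^sub>R v i) /\<^sub>R (\<Sum>i\<in>S. w i)"
  shows "\<exists>c>0. \<forall>i\<in>S. exp (s \<bullet> v i) = c"
proof -
  define W where "W = (\<Sum>i\<in>S. w i)"
  define W' where "W' = (\<Sum>i\<in>S. w i * exp (s \<bullet> v i))"
  have W: "W > 0" "W' > 0" unfolding W_def W'_def using fin ne w by (auto intro!: sum_pos)
  \<comment> \<open>\<open>h i\<close> is the logarithm of the likelihood ratio of the two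
    distributions at \<open>i\<close>.\<close>
  define h where "h i = s \<bullet> v i - ln (W' / W)" for i
  have eh: "exp (s \<bullet> v i) = exp (h i) * (W' / W)" for i
    using W by (simp add: h_def exp_diff)
  have "(\<Sum>i\<in>S. w i / W * ((exp (h i) - 1) * h i)) =
      (\<Sum>i\<in>S. (w i * exp (s \<bullet> v i) / W' - w i / W) * h i)"
    using W by (intro sum.cong) (auto simp: eh field_simps)
  also have "\<dots> = (\<Sum>i\<in>S. (w i * exp (s \<bullet> v i) / W') * (s \<bullet> v i)) - (\<Sum>i\<in>S. w i / W * (s \<bullet> v i))
      - ln (W' / W) * ((\<Sum>i\<in>S. w i * exp (s \<bullet> v i) / W') - (\<Sum>i\<in>S. w i / W))"
    unfolding sum_distrib_left sum_subtractf[symmetric] right_diff_distrib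
    by (intro sum.cong refl) (simp add: h_def algebra_simps diff_divide_distrib)
  also have "(\<Sum>i\<in>S. (w i * exp (s \<bullet> v i) / W') * (s \<bullet> v i)) =
      s \<bullet> ((\<Sum>i\<in>S. (w i * exp (s \<bullet> v i)) *\<^sub>R v i) /\<^sub>R W')"
    by (simp add: inner_sum_right sum_distrib_left field_simps)
  also have "(\<Sum>i\<in>S. w i / W * (s \<bullet> v i)) = s \<bullet> ((\<Sum>i\<in>S. w i *\<^sub>R v i) /\<^sub>R W)"
    by (simp add: inner_sum_right sum_distrib_left field_simps)
  also have "(\<Sum>i\<in>S. w i * exp (s \<bullet> v i) / W') - (\<Sum>i\<in>S. w i / W) = 0"
    using W by (simp add: W_def W'_def flip: sum_divide_distrib)
  finally have z: "(\<Sum>i\<in>S. w i / W * ((exp (h i) - 1) * h i)) = 0"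
    using mean by (simp add: W_def W'_def)
  have nn: "(exp y - 1) * y \<ge> 0" for y :: real
    by (cases "y \<ge> 0") (auto intro: mult_nonneg_nonneg mult_nonpos_nonpos)
  have "\<forall>i\<in>S. w i / W * ((exp (h i) - 1) * h i) = 0"
    using z w W nn fin by (subst (asm) sum_nonneg_eq_0_iff) (auto simp: less_imp_le)
  then have "\<forall>i\<in>S. h i = 0" using w W by fastforce
  then have "\<forall>i\<in>S. exp (s \<bullet> v i) = W' / W" using eh by simp
  then show ?thesis using W by (intro exI[of _ "W' / W"]) simp
qed

text \<open>The weights are indexed by \<open>S\<close> itself, so that coinciding points
  \<open>v i\<close> keep separate weights.\<close>

lemma convex_hull_image_explicit:
  fixes v :: "'i \<Rightarrow> 'a::real_vector"
  assumes "finite S" "y \<in> convex hull (v ` S)"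
  obtains a where "\<And>i. i \<in> S \<Longrightarrow> 0 \<le> a i" "sum a S = 1" "y = (\<Sum>i\<in>S. a i *\<^sub>R v i)"
proof -
  let ?C = "{y. \<exists>a. (\<forall>i\<in>S. 0 \<le> a i) \<and> sum a S = 1 \<and> y = (\<Sum>i\<in>S. a i *\<^sub>R v i)}"
  have "convex ?C"
  proof (rule convexI, clarify)
    fix u t :: real and a b :: "'i \<Rightarrow> real"
    assume h: "0 \<le> u" "0 \<le> t" "u + t = 1" "\<forall>i\<in>S. 0 \<le> a i" "\<forall>i\<in>S. 0 \<le> b i" "sum a S = 1" "sum b S = 1"
    show "\<exists>c. (\<forall>i\<in>S. 0 \<le> c i) \<and> sum c S = 1 \<and>
      u *\<^sub>R (\<Sum>i\<in>S. a i *\<^sub>R v i) + t *\<^sub>R (\<Sum>i\<in>S. b i *\<^sub>R v i) = (\<Sum>i\<in>S. c i *\<^sub>R v i)"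
      using h by (intro exI[of _ "\<lambda>i. u * a i + t * b i"])
        (simp add: sum.distrib scaleR_sum_right scaleR_add_left flip: sum_distrib_left)
  qed
  moreover have "v ` S \<subseteq> ?C"
  proof (rule image_subsetI)
    fix j assume "j \<in> S"
    then show "v j \<in> ?C"
      using assms(1) by (intro CollectI exI[of _ "\<lambda>i. if i = j then 1 else 0"])
        (simp add: if_distrib[of "\<lambda>c. c *\<^sub>R _"] cong: if_cong)
  qed
  ultimately have "y \<in> ?C" using assms(2) by (metis (no_types, lifting) hull_minimal subsetD)
  then show thesis using that by blast
qed

text \<open>With all weights positive, the segment from any point \<open>y\<close> of the hull can
  be prolonged beyond the combination, which characterizes the relative interior.\<close>

lemma positive_combination_in_rel_interior:
  fixes v :: "'i \<Rightarrow> 'a::euclidean_space"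
  assumes fin: "finite S" and ne: "S \<noteq> {}" and p: "\<And>i. i \<in> S \<Longrightarrow> p i > 0" "sum p S = 1"
  shows "(\<Sum>i\<in>S. p i *\<^sub>R v i) \<in> rel_interior (convex hull (v ` S))"
proof -
  have "\<exists>e>1. (1 - e) *\<^sub>R y + e *\<^sub>R (\<Sum>i\<in>S. p i *\<^sub>R v i) \<in> convex hull (v ` S)"
    if yh: "y \<in> convex hull (v ` S)" for y
  proof -
    obtain a where a: "\<And>i. i \<in> S \<Longrightarrow> 0 \<le> a i" "sum a S = 1" "y = (\<Sum>i\<in>S. a i *\<^sub>R v i)"
      using convex_hull_image_explicit[OF fin yh] by blast
    have a1: "a i \<le> 1" if "i \<in> S" for i
      using member_le_sum[of i S a] a that fin by auto
    \<comment> \<open>An overshoot by \<open>m\<close> is safe: \<open>a i \<le> 1\<close> and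
      \<open>m \<le> p i\<close> keep the new weight \<open>(1 + m) * p i - m * a i\<close>
      nonnegative.\<close>
    define m where "m = Min (p ` S)"
    have m: "m > 0" "\<And>i. i \<in> S \<Longrightarrow> m \<le> p i"
      unfolding m_def using fin ne p by (auto simp: Min_gr_iff)
    let ?c = "\<lambda>i. - m * a i + (1 + m) * p i"
    have "(1 - (1 + m)) *\<^sub>R y + (1 + m) *\<^sub>R (\<Sum>i\<in>S. p i *\<^sub>R v i) = (\<Sum>i\<in>S. ?c i *\<^sub>R v i)"
      unfolding a(3) scaleR_sum_right sum.distrib[symmetric]
      by (intro sum.cong) (simp_all add: scaleR_add_left scaleR_diff_left)
    also have "\<dots> \<in> convex hull (v ` S)"
    proof (rule convex_sum[OF fin convex_convex_hull])
      show "sum ?c S = 1"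
        unfolding sum.distrib by (simp add: a p sum_negf flip: sum_distrib_left)
      fix i assume i: "i \<in> S"
      have "m * a i \<le> m * 1" using a1[OF i] m by (intro mult_left_mono) auto
      moreover have "p i \<ge> m" "m * p i \<ge> 0" using m p i by (auto simp: less_imp_le)
      ultimately show "0 \<le> ?c i" by (simp add: algebra_simps)
      show "v i \<in> convex hull (v ` S)" using i by (simp add: hull_inc)
    qed
    finally show ?thesis using m by (intro exI[of _ "1 + m"]) simp
  qed
  then show ?thesis
    using ne by (subst convex_rel_interior_iff) (auto simp: convex_convex_hull)
qed

text \<open>The partition function \<open>g\<close>, centred at \<open>x\<close>, attains a minimum,
  and its vanishing gradient there says that the tilted mean is \<open>x\<close>. Orthogonally to
  the span \<open>V\<close> of the \<open>u i\<close> the function is constant, so the minimum is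
  sought in \<open>V\<close>, where it is coercive.\<close>

lemma exp_family_mean_onto:
  fixes v :: "'i \<Rightarrow> 'a::euclidean_space"
  assumes fin: "finite S" and ne: "S \<noteq> {}" and w: "\<And>i. i \<in> S \<Longrightarrow> w i > 0"
    and x: "x \<in> rel_interior (convex hull (v ` S))"
  shows "\<exists>s. (\<Sum>i\<in>S. (w i * exp (s \<bullet> v i)) *\<^sub>R v i) /\<^sub>R (\<Sum>i\<in>S. w i * exp (s \<bullet> v i)) = x"
proof -
  define u where "u i = v i - x" for i
  \<comment> \<open>A functional that is maximal at \<open>x\<close> over the hull is constant on
    the hull, because the segment from \<open>v i\<close> through \<open>x\<close> continues in the
    hull beyond \<open>x\<close>.\<close>
  have flat: "\<forall>i\<in>S. s \<bullet> u i = 0" if s: "\<forall>i\<in>S. s \<bullet> u i \<le> 0" for s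
  proof
    fix i assume i: "i \<in> S"
    have "v i \<in> convex hull (v ` S)" using i by (simp add: hull_inc)
    then obtain e where e: "e > 1" "(1 - e) *\<^sub>R v i + e *\<^sub>R x \<in> convex hull (v ` S)"
      using x ne by (subst (asm) convex_rel_interior_iff) (auto simp: convex_convex_hull)
    have "convex hull (v ` S) \<subseteq> {y. s \<bullet> y \<le> s \<bullet> x}"
      using s by (intro hull_minimal) (auto simp: u_def inner_diff_right convex_halfspace_le)
    with e(2) have "s \<bullet> ((1 - e) *\<^sub>R v i + e *\<^sub>R x) \<le> s \<bullet> x" by blast
    then have "(1 - e) * (s \<bullet> u i) \<le> 0" by (simp add: u_def inner_diff_right inner_add_right algebra_simps)
    then have "s \<bullet> u i \<ge> 0" using e(1) by (simp add: mult_le_0_iff)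
    then show "s \<bullet> u i = 0" using s i by force
  qed
  define V where "V = span (u ` S)"
  define g where "g s = (\<Sum>i\<in>S. w i * exp (s \<bullet> u i))" for s
  \<comment> \<open>A positively homogeneous lower bound for \<open>g\<close>, up to a factor. By
    \<open>flat\<close> it is positive on the unit sphere of \<open>V\<close>, so on
    \<open>V\<close> it dominates a multiple of the norm.\<close>
  define f where "f s = (\<Sum>i\<in>S. max 0 (s \<bullet> u i))" for s
  have V0: "0 \<in> V" unfolding V_def by (rule span_zero)
  obtain d where d: "d > 0" "\<And>s. s \<in> V \<Longrightarrow> d * norm s \<le> f s"
  proof (cases "V = {0}")
    case True
    then show thesis by (intro that[of 1]) (auto simp: f_def)
  next
    case False
    let ?K = "V \<inter> sphere 0 1"
    obtain y where y: "y \<in> V" "y \<noteq> 0" using False V0 by auto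
    have "y /\<^sub>R norm y \<in> ?K" using y by (auto simp: V_def span_mul)
    then have "?K \<noteq> {}" by blast
    moreover have "compact ?K"
      unfolding V_def by (simp add: closed_span compact_Int closed_Int_compact)
    moreover have "continuous_on ?K f" unfolding f_def by (intro continuous_intros)
    ultimately obtain z where z: "z \<in> ?K" "\<And>s. s \<in> ?K \<Longrightarrow> f z \<le> f s"
      using continuous_attains_inf by metis
    have "f z \<noteq> 0"
    proof
      assume "f z = 0"
      then have "\<forall>i\<in>S. max 0 (z \<bullet> u i) = 0"
        unfolding f_def using fin by (subst (asm) sum_nonneg_eq_0_iff) auto
      then have "\<forall>i\<in>S. z \<bullet> u i \<le> 0" by (metis max.cobounded2)
      then have "\<forall>i\<in>S. z \<bullet> u i = 0" by (rule flat)
      then have "V \<subseteq> {y. z \<bullet> y = 0}"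
        unfolding V_def by (intro span_minimal) (auto simp: subspace_hyperplane)
      with z(1) have "z \<bullet> z = 0" by blast
      with z(1) show False by simp
    qed
    moreover have "f z \<ge> 0" unfolding f_def by (intro sum_nonneg) auto
    moreover have "f z * norm s \<le> f s" if s: "s \<in> V" for s
    proof (cases "s = 0")
      case False
      then have "s /\<^sub>R norm s \<in> ?K" using s by (auto simp: V_def span_mul)
      then have "f z \<le> f (s /\<^sub>R norm s)" by (rule z)
      also have "\<dots> = f s / norm s"
        using False unfolding f_def sum_divide_distrib
        by (intro sum.cong) (auto simp: max_def divide_simps)
      finally show ?thesis using False by (simp add: field_simps)
    qed (auto simp: f_def)
    ultimately show thesis by (intro that[of "f z"]) auto
  qed
  define m where "m = Min (w ` S)"
  have m: "m > 0" "\<And>i. i \<in> S \<Longrightarrow> m \<le> w i"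
    unfolding m_def using fin ne w by (auto simp: Min_gr_iff)
  have gf: "m * f s \<le> g s" for s
    unfolding g_def f_def sum_distrib_left
  proof (rule sum_mono)
    fix i assume i: "i \<in> S"
    have "max 0 (s \<bullet> u i) \<le> exp (s \<bullet> u i)"
      using exp_ge_add_one_self[of "s \<bullet> u i"] by (simp del: exp_ge_add_one_self)
    then show "m * max 0 (s \<bullet> u i) \<le> w i * exp (s \<bullet> u i)"
      using m(1) m(2)[OF i] by (intro mult_mono) auto
  qed
  \<comment> \<open>Outside this ball \<open>m * d * norm s\<close> exceeds \<open>g 0\<close>, so a
    minimum over the ball is one over \<open>V\<close>.\<close>
  let ?B = "V \<inter> cball 0 (g 0 / (m * d))"
  have g0: "g 0 \<ge> 0" unfolding g_def using w by (intro sum_nonneg) (auto simp: less_imp_le)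
  have "compact ?B" unfolding V_def by (simp add: closed_span closed_Int_compact)
  moreover have "0 \<in> ?B" using V0 g0 m d by simp
  moreover have "continuous_on ?B g" unfolding g_def by (intro continuous_intros)
  ultimately obtain s where s: "s \<in> ?B" "\<And>y. y \<in> ?B \<Longrightarrow> g s \<le> g y"
    using continuous_attains_inf[of ?B g] by blast
  have min: "g s \<le> g y" if y: "y \<in> V" for y
  proof (cases "norm y \<le> g 0 / (m * d)")
    case False
    then have "g 0 \<le> m * (d * norm y)" using m d by (simp add: field_simps)
    also have "\<dots> \<le> m * f y" using d(2)[OF y] m by simp
    also have "\<dots> \<le> g y" by (rule gf)
    finally show ?thesis using s(2)[OF \<open>0 \<in> ?B\<close>] by simp
  qed (use s y in auto)
  \<comment> \<open>\<open>z\<close> is the gradient of \<open>g\<close> at \<open>s\<close>. It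
    lies in \<open>V\<close>, and the derivative of \<open>g\<close> in the direction
    \<open>z\<close> is \<open>z \<bullet> z\<close>.\<close>
  define z where "z = (\<Sum>i\<in>S. (w i * exp (s \<bullet> u i)) *\<^sub>R u i)"
  have zV: "z \<in> V" unfolding z_def V_def by (intro span_sum span_mul span_base imageI)
  have "((\<lambda>r. g (s + r *\<^sub>R z)) has_real_derivative (\<Sum>i\<in>S. w i * exp (s \<bullet> u i) * (z \<bullet> u i))) (at 0)"
    unfolding g_def inner_add_left inner_scaleR_left
    by (auto intro!: derivative_eq_intros sum.cong)
  moreover have "g (s + 0 *\<^sub>R z) \<le> g (s + r *\<^sub>R z)" for r
    using min[of "s + r *\<^sub>R z"] s(1) zV by (simp add: V_def span_add span_mul)
  ultimately have "(\<Sum>i\<in>S. w i * exp (s \<bullet> u i) * (z \<bullet> u i)) = 0"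
    by (intro DERIV_local_min[where d = 1 and x = 0]) auto
  also have "(\<Sum>i\<in>S. w i * exp (s \<bullet> u i) * (z \<bullet> u i)) = z \<bullet> (\<Sum>i\<in>S. (w i * exp (s \<bullet> u i)) *\<^sub>R u i)"
    by (simp add: inner_sum_right)
  also have "\<dots> = z \<bullet> z" by (simp add: z_def)
  finally have "z = 0" by simp
  then have "0 = exp (s \<bullet> x) *\<^sub>R z" by simp
  also have "\<dots> = (\<Sum>i\<in>S. (w i * exp (s \<bullet> v i)) *\<^sub>R u i)"
    unfolding z_def scaleR_sum_right
    by (intro sum.cong) (simp_all add: u_def inner_diff_right exp_diff)
  also have "\<dots> = (\<Sum>i\<in>S. (w i * exp (s \<bullet> v i)) *\<^sub>R v i) - (\<Sum>i\<in>S. w i * exp (s \<bullet> v i)) *\<^sub>R x"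
    by (simp add: u_def scaleR_diff_right sum_subtractf scaleR_sum_left)
  finally have "(\<Sum>i\<in>S. (w i * exp (s \<bullet> v i)) *\<^sub>R v i) = (\<Sum>i\<in>S. w i * exp (s \<bullet> v i)) *\<^sub>R x" by simp
  moreover have "(\<Sum>i\<in>S. w i * exp (s \<bullet> v i)) > 0" using fin ne w by (intro sum_pos) auto
  ultimately show ?thesis by (intro exI[of _ s]) simp
qed

section \<open>The moment map on a stratum\<close>

definition wt :: "complex^2^5 \<Rightarrow> 5 set \<Rightarrow> real" where
  "wt A I = (norm (minor A I))\<^sup>2"

definition tot :: "complex^2^5 \<Rightarrow> real" where
  "tot A = (\<Sum>I\<in>pairs. wt A I)"

definition supp :: "complex^2^5 \<Rightarrow> 5 set set" where
  "supp A = {I \<in> pairs. minor A I \<noteq> 0}"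

lemma pairs_cases:
  assumes "I \<in> pairs"
  obtains a b where "a \<noteq> b" "I = {a, b}"
  using assms by (auto simp: pairs_def card_2_iff)

lemma pair_in_pairs [simp]: "{a, b} \<in> pairs \<longleftrightarrow> a \<noteq> b"
  by (auto simp: pairs_def card_insert_if)

lemma minor_cases: "minor A {a, b} = br A a b \<or> minor A {a, b} = - br A a b"
  by (auto simp: minor_def br_def min_def max_def)

lemma minor_eq_0_iff: "minor A {a, b} = 0 \<longleftrightarrow> br A a b = 0"
  using minor_cases[of A a b] by auto

lemma wt_pair: "wt A {a, b} = (norm (br A a b))\<^sup>2"
  using minor_cases[of A a b] by (auto simp: wt_def)

lemma pair_in_supp [simp]: "{a, b} \<in> supp A \<longleftrightarrow> br A a b \<noteq> 0"
  by (auto simp: supp_def minor_eq_0_iff)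

lemma supp_subset: "supp A \<subseteq> pairs"
  by (auto simp: supp_def)

lemma wt_pos: "I \<in> supp A \<Longrightarrow> wt A I > 0"
  by (auto simp: supp_def wt_def)

lemma wt_nonneg: "wt A I \<ge> 0"
  by (simp add: wt_def)

lemma supp_ne: "A \<in> frames \<Longrightarrow> supp A \<noteq> {}"
  unfolding frames_iff using pair_in_supp by blast

lemma sum_pairs_supp: "(\<Sum>I\<in>pairs. wt A I *\<^sub>R (f I :: 'a::real_vector)) = (\<Sum>I\<in>supp A. wt A I *\<^sub>R f I)"
  by (intro sum.mono_neutral_right) (auto simp: supp_def wt_def)

lemma tot_supp: "tot A = (\<Sum>I\<in>supp A. wt A I)"
  unfolding tot_def by (intro sum.mono_neutral_right) (auto simp: supp_def wt_def)

lemma tot_pos: "A \<in> frames \<Longrightarrow> tot A > 0"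
  unfolding tot_supp using supp_ne wt_pos by (auto intro: sum_pos)

lemma minor_scaled: "(\<And>a b. br B a b = d * br A a b) \<Longrightarrow> minor B I = d * minor A I"
  unfolding minor_def by (simp add: br_def)

lemma pluecker_colspan:
  assumes "A \<in> frames"
  obtains d where "d \<noteq> 0" "\<And>I. pluecker I (colspan A) = d * minor A I"
proof -
  have "colspan A = colspan (SOME B. colspan B = colspan A)"
    by (metis (mono_tags) someI)
  then obtain d where d: "d \<noteq> 0" "\<And>a b. br (SOME B. colspan B = colspan A) a b = d * br A a b"
    using assms br_colspan_eq by blast
  then show thesis using that[of d] minor_scaled unfolding pluecker_def by blast
qed

lemma moment_colspan:
  assumes A: "A \<in> frames"
  shows "moment (colspan A) = (\<Sum>I\<in>pairs. wt A I *\<^sub>R Lam I) /\<^sub>R tot A"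
proof -
  obtain d where d: "d \<noteq> 0" "\<And>I. pluecker I (colspan A) = d * minor A I"
    using pluecker_colspan[OF A] by blast
  have "(\<Sum>I\<in>pairs. (norm (pluecker I (colspan A)))\<^sup>2 *\<^sub>R Lam I)
      = (norm d)\<^sup>2 *\<^sub>R (\<Sum>I\<in>pairs. wt A I *\<^sub>R Lam I)"
    "(\<Sum>I\<in>pairs. (norm (pluecker I (colspan A)))\<^sup>2) = (norm d)\<^sup>2 * tot A"
    by (simp_all add: d wt_def tot_def norm_mult power_mult_distrib scaleR_sum_right sum_distrib_left)
  then show ?thesis
    using d(1) by (simp add: moment_def)
qed

lemma moment_supp:
  assumes A: "A \<in> frames"
  shows "moment (colspan A) = (\<Sum>I\<in>supp A. wt A I *\<^sub>R Lam I) /\<^sub>R (\<Sum>I\<in>supp A. wt A I)"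
  by (simp add: moment_colspan[OF A] tot_supp sum_pairs_supp)

lemma stratum_iff:
  assumes A: "A \<in> frames"
  shows "colspan A \<in> stratum \<sigma> \<longleftrightarrow> \<sigma> \<inter> pairs = supp A"
proof -
  obtain d where d: "d \<noteq> 0" "\<And>I. pluecker I (colspan A) = d * minor A I"
    using pluecker_colspan[OF A] by blast
  then show ?thesis using A by (auto simp: stratum_def supp_def frames_def)
qed

lemma stratum_obtain_frame:
  assumes "L \<in> stratum \<sigma>"
  obtains A where "A \<in> frames" "colspan A = L" "supp A = \<sigma> \<inter> pairs"
proof -
  have "L \<in> G52" using assms by (simp add: stratum_def)
  then obtain A where A: "A \<in> frames" "colspan A = L" by (rule G52_obtain_frame)
  then show thesis using that assms stratum_iff by blast
qed

lemma supp_scale: "t \<in> CT5 \<Longrightarrow> supp (scale t A) = supp A"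
proof -
  assume t: "t \<in> CT5"
  have "minor (scale t A) I = 0 \<longleftrightarrow> minor A I = 0" if I: "I \<in> pairs" for I
  proof -
    obtain a b where "I = {a, b}" using I by (rule pairs_cases)
    then show ?thesis using t by (simp add: minor_eq_0_iff br_scale CT5_def)
  qed
  then show ?thesis by (auto simp: supp_def)
qed

text \<open>The weights are squared moduli, hence the half in the exponent. Scaling a frame thus
  tilts its weights as in an exponential family with points \<open>Lam I\<close>, and the two mean
  theorems apply to the moment map.\<close>

lemma wt_scale:
  assumes "I \<in> pairs" and "\<And>k. norm (t $ k) = exp (s $ k / 2)"
  shows "wt (scale t A) I = wt A I * exp (s \<bullet> Lam I)"
proof -
  obtain a b where ab: "a \<noteq> b" "I = {a, b}" using assms(1) by (rule pairs_cases)
  have "s \<bullet> Lam I = (\<Sum>k\<in>{a,b}. s $ k)"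
    unfolding inner_vec_def ab Lam_def
    by (subst sum.mono_neutral_right[of UNIV "{a,b}"]) (auto intro: sum.cong)
  then have "s \<bullet> Lam I = s $ a + s $ b" using ab by simp
  then have "(norm (t $ a) * norm (t $ b))\<^sup>2 = exp (s \<bullet> Lam I)"
    by (simp add: assms(2) power_mult_distrib power2_eq_square flip: exp_add)
  then show ?thesis
    by (simp add: ab wt_pair br_scale norm_mult power_mult_distrib mult.commute)
qed

lemma moment_in_rel_interior:
  assumes A: "A \<in> frames"
  shows "moment (colspan A) \<in> rel_interior (poly_of (supp A))"
proof -
  have "moment (colspan A) = (\<Sum>I\<in>supp A. (wt A I / tot A) *\<^sub>R Lam I)"
    by (simp add: moment_supp[OF A] tot_supp scaleR_sum_right divide_inverse mult.commute)
  also have "\<dots> \<in> rel_interior (poly_of (supp A))"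
    unfolding poly_of_def
  proof (rule positive_combination_in_rel_interior)
    show "(\<Sum>I\<in>supp A. wt A I / tot A) = 1"
      using tot_pos[OF A] by (simp add: tot_supp flip: sum_divide_distrib)
    show "wt A I / tot A > 0" if "I \<in> supp A" for I
      using wt_pos[OF that] tot_pos[OF A] by simp
  qed (use supp_ne[OF A] in auto)
  finally show ?thesis .
qed

lemma moment_onto_rel_interior:
  assumes A: "A \<in> frames" and x: "x \<in> rel_interior (poly_of (supp A))"
  obtains t where "t \<in> CT5" "moment (act t (colspan A)) = x"
proof -
  obtain s where s: "(\<Sum>I\<in>supp A. (wt A I * exp (s \<bullet> Lam I)) *\<^sub>R Lam I) /\<^sub>R
      (\<Sum>I\<in>supp A. wt A I * exp (s \<bullet> Lam I)) = x"
    using exp_family_mean_onto[OF _ supp_ne[OF A] _ x[unfolded poly_of_def], of "wt A"] wt_pos[of _ A] by auto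
  define t :: "complex^5" where "t = (\<chi> k. of_real (exp (s $ k / 2)))"
  have t: "t \<in> CT5" by (simp add: t_def CT5_def)
  have "wt (scale t A) I = wt A I * exp (s \<bullet> Lam I)" if "I \<in> supp A" for I
    using that by (intro wt_scale) (auto simp: supp_def t_def)
  then have "moment (colspan (scale t A)) = x"
    unfolding moment_supp[OF scale_frames[OF A t]] supp_scale[OF t] using s by simp
  then show thesis using t that by (simp add: act_colspan)
qed

text \<open>Polar decomposition \<open>t = e r\<close>: equal means force the positive part
  \<open>r\<close> to multiply all nonzero brackets by one common factor, so \<open>r\<close> fixes
  the subspace and only the compact part \<open>e\<close> moves it.\<close>

lemma moment_eq_imp_same_T_orbit:
  assumes A: "A \<in> frames" and t: "t \<in> CT5" and m: "moment (act t (colspan A)) = moment (colspan A)"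
  shows "T_orbit (act t (colspan A)) = T_orbit (colspan A)"
proof -
  define s :: "real^5" where "s = (\<chi> k. 2 * ln (norm (t $ k)))"
  have tk: "norm (t $ k) = exp (s $ k / 2)" for k
    using t by (simp add: s_def CT5_def)
  have "wt (scale t A) I = wt A I * exp (s \<bullet> Lam I)" if "I \<in> supp A" for I
    using that tk by (intro wt_scale) (auto simp: supp_def)
  then have "\<exists>c>0. \<forall>I\<in>supp A. exp (s \<bullet> Lam I) = c"
    using m supp_ne[OF A]
    unfolding act_colspan moment_supp[OF scale_frames[OF A t]] moment_supp[OF A] supp_scale[OF t]
    by (intro exp_family_mean_eqD[where w = "wt A"]) (auto simp: wt_pos)
  then obtain c where c: "c > 0" "\<And>I. I \<in> supp A \<Longrightarrow> exp (s \<bullet> Lam I) = c" by blast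
  define r :: "complex^5" where "r = (\<chi> k. of_real (norm (t $ k)))"
  define e :: "complex^5" where "e = (\<chi> k. t $ k / of_real (norm (t $ k)))"
  have te: "tmul e r = t" "e \<in> T5" "r \<in> CT5"
    using t by (auto simp: tmul_def e_def r_def vec_eq_iff T5_def CT5_def norm_divide)
  have "br (scale r A) a b = of_real (sqrt c) * br A a b" for a b
  proof (cases "br A a b = 0")
    case False
    then have I: "{a, b} \<in> supp A" by simp
    then have "wt (scale r A) {a, b} = wt A {a, b} * exp (s \<bullet> Lam {a, b})"
      using tk by (intro wt_scale) (auto simp: supp_def r_def)
    then have "(norm (r $ a * r $ b))\<^sup>2 = c"
      using False by (simp add: c(2)[OF I] wt_pair br_scale norm_mult power_mult_distrib)
    then have "norm (t $ a) * norm (t $ b) = sqrt c"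
      by (intro real_sqrt_unique[symmetric]) (auto simp: norm_mult r_def)
    then show ?thesis
      by (simp add: br_scale r_def flip: of_real_mult)
  qed (simp add: br_scale)
  then have "act r (colspan A) = colspan A"
    unfolding act_colspan using c by (intro colspan_eqI[OF A, of "of_real (sqrt c)"]) auto
  then have "act t (colspan A) = act e (colspan A)"
    by (metis te(1) act_act)
  then show ?thesis by (simp add: T_orbit_act[OF te(2)])
qed

section \<open>The hypersimplex as the polytope of the main stratum\<close>

lemma Lam_nth: "Lam I $ k = (if k \<in> I then 1 else 0)"
  by (simp add: Lam_def)

lemma sum_Lam: "(\<Sum>k\<in>C. Lam I $ k) = real (card (I \<inter> C))"
proof -
  have "(\<Sum>k\<in>C. Lam I $ k) = (\<Sum>k\<in>I \<inter> C. 1)"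
    unfolding Lam_nth by (subst sum.inter_filter[symmetric]) (auto simp: Int_def conj_commute)
  then show ?thesis by simp
qed

lemma card_pairs: "I \<in> pairs \<Longrightarrow> card I = 2"
  by (simp add: pairs_def)

lemma Lam_in_Delta52: "I \<in> pairs \<Longrightarrow> Lam I \<in> Delta52"
  using sum_Lam[of I UNIV] card_pairs[of I] by (simp add: Delta52_def Lam_nth)

lemma convex_Delta52: "convex Delta52"
proof (rule convexI)
  fix x y and u v :: real
  assume h: "x \<in> Delta52" "y \<in> Delta52" "0 \<le> u" "0 \<le> v" "u + v = 1"
  have "u * x $ k + v * y $ k \<le> u * 1 + v * 1" for k
    using h by (intro add_mono mult_left_mono) (auto simp: Delta52_def)
  moreover have "(\<Sum>k\<in>UNIV. u * x $ k + v * y $ k) = u * 2 + v * 2"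
    using h by (simp add: Delta52_def sum.distrib flip: sum_distrib_left)
  ultimately show "u *\<^sub>R x + v *\<^sub>R y \<in> Delta52"
    using h by (simp add: Delta52_def)
qed

lemma compact_Delta52: "compact Delta52"
proof -
  have "norm x \<le> 5" if "x \<in> Delta52" for x
  proof -
    have "norm x \<le> (\<Sum>k\<in>UNIV. \<bar>x $ k\<bar>)" by (rule norm_le_l1_cart)
    also have "\<dots> \<le> (\<Sum>k\<in>(UNIV :: 5 set). 1)"
      using that by (intro sum_mono) (auto simp: Delta52_def abs_le_iff)
    finally show ?thesis by simp
  qed
  then have "bounded Delta52" by (auto simp: bounded_iff)
  moreover have D: "Delta52 = (\<Inter>k. {x. 0 \<le> x $ k} \<inter> {x. x $ k \<le> 1}) \<inter> {x. (\<Sum>k\<in>UNIV. x $ k) = 2}"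
    by (auto simp: Delta52_def)
  have "closed Delta52"
    unfolding D by (auto intro!: closed_Int closed_INT closed_Collect_le closed_Collect_eq continuous_intros)
  ultimately show ?thesis by (simp add: compact_eq_bounded_closed)
qed

text \<open>Two fractional coordinates could be moved in opposite directions; a single one is
  excluded because the coordinates sum to an integer.\<close>

lemma extreme_point_Delta52:
  assumes x: "x extreme_point_of Delta52"
  shows "x \<in> Lam ` pairs"
proof -
  have xD: "x \<in> Delta52" using x by (simp add: extreme_point_of_def)
  have no2: "\<not> (0 < x $ a \<and> x $ a < 1 \<and> 0 < x $ b \<and> x $ b < 1)" if ab: "a \<noteq> b" for a b
  proof
    assume h: "0 < x $ a \<and> x $ a < 1 \<and> 0 < x $ b \<and> x $ b < 1"
    \<comment> \<open>The largest step that keeps both coordinates in the unit interval in either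
      direction.\<close>
    define e where "e = min (min (x $ a) (1 - x $ a)) (min (x $ b) (1 - x $ b))"
    have e: "e > 0" "e \<le> x $ a" "e \<le> 1 - x $ a" "e \<le> x $ b" "e \<le> 1 - x $ b"
      using h by (auto simp: e_def)
    define d :: "real^5" where "d = axis a e - axis b e"
    have dk: "d $ k = (if k = a then e else if k = b then - e else 0)" for k
      using ab by (auto simp: d_def axis_def)
    have s: "(\<Sum>k\<in>UNIV. d $ k) = 0"
      by (simp add: d_def sum_subtractf axis_def)
    have "x + d \<in> Delta52" "x - d \<in> Delta52"
      using xD e s by (auto simp: Delta52_def dk sum.distrib sum_subtractf add_increasing2 add_decreasing2)
    moreover have "x \<in> open_segment (x + d) (x - d)"
    proof -
      have "(x + d) $ a \<noteq> (x - d) $ a" using dk[of a] e by simp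
      then have "x + d \<noteq> x - d" by metis
      moreover have "x = midpoint (x + d) (x - d)"
        by (simp add: midpoint_def flip: scaleR_2)
      ultimately show ?thesis by (metis midpoint_in_open_segment)
    qed
    ultimately show False using x by (auto simp: extreme_point_of_def)
  qed
  have int: "x $ a = 0 \<or> x $ a = 1" for a
  proof (rule ccontr)
    assume n: "\<not> ?thesis"
    then have a: "0 < x $ a" "x $ a < 1" using xD by (auto simp: Delta52_def less_le)
    have "x $ b \<in> \<int>" if "b \<noteq> a" for b
    proof -
      have "x $ b = 0 \<or> x $ b = 1"
        using no2[of a b] a that xD by (auto simp: Delta52_def less_le)
      then show ?thesis by auto
    qed
    then have "(\<Sum>k\<in>UNIV - {a}. x $ k) \<in> \<int>" by (intro Ints_sum) auto
    moreover have "x $ a = 2 - (\<Sum>k\<in>UNIV - {a}. x $ k)"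
      using xD by (simp add: Delta52_def sum_diff1)
    ultimately have "x $ a \<in> \<int>" by (metis Ints_diff Ints_numeral)
    with a show False by (auto elim!: Ints_cases)
  qed
  have xL: "x = Lam {k. x $ k = 1}"
    using int by (auto simp: vec_eq_iff Lam_nth)
  have "real (card {k. x $ k = 1}) = 2"
    using xD xL sum_Lam[of "{k. x $ k = 1}" UNIV] by (simp add: Delta52_def)
  then show ?thesis by (subst xL) (auto simp: pairs_def)
qed

text \<open>Approximating sequences take their moments in \<open>rel_interior Delta52\<close>; this
  identifies that set with the open polytope of the main stratum.\<close>

lemma Delta52_eq: "Delta52 = poly_of pairs"
proof
  have "Delta52 = convex hull {x. x extreme_point_of Delta52}"
    by (rule Krein_Milman_Minkowski[OF compact_Delta52 convex_Delta52])
  also have "\<dots> \<subseteq> poly_of pairs"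
    unfolding poly_of_def using extreme_point_Delta52 by (intro hull_mono) auto
  finally show "Delta52 \<subseteq> poly_of pairs" .
  show "poly_of pairs \<subseteq> Delta52"
    unfolding poly_of_def using Lam_in_Delta52 convex_Delta52 by (intro hull_minimal) auto
qed

section \<open>Compatible frames\<close>

text \<open>For each quadruple of rows, the vectors of the three products of complementary brackets
  of \<open>A\<close> and of \<open>B\<close> are linearly dependent. This is equality of cross
  ratios in a cross-multiplied form that stays meaningful when brackets vanish.\<close>

definition compat :: "complex^2^5 \<Rightarrow> complex^2^5 \<Rightarrow> bool" where
  "compat A B \<longleftrightarrow> (\<forall>a b c d. br A a b * br A c d * (br B a c * br B b d) =
     br A a c * br A b d * (br B a b * br B c d))"

lemma compat_sym: "compat A B \<Longrightarrow> compat B A"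
  by (simp add: compat_def mult.commute)

text \<open>A partial coordinate sum of the moment is the weighted mean of the counts
  \<open>card (I \<inter> C)\<close>, so bounds on it reduce to the combinatorics of the
  support.\<close>

lemma sum_moment:
  assumes "A \<in> frames"
  shows "(\<Sum>k\<in>C. moment (colspan A) $ k) * tot A = (\<Sum>I\<in>supp A. wt A I * real (card (I \<inter> C)))"
proof -
  have "(\<Sum>k\<in>C. moment (colspan A) $ k) * tot A = (\<Sum>k\<in>C. \<Sum>I\<in>supp A. wt A I * Lam I $ k)"
    using tot_pos[OF assms] unfolding sum_distrib_right
    by (intro sum.cong) (simp_all add: moment_supp[OF assms] tot_supp)
  also have "\<dots> = (\<Sum>I\<in>supp A. wt A I * real (card (I \<inter> C)))"
    by (subst sum.swap) (simp add: sum_Lam flip: sum_distrib_left)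
  finally show ?thesis .
qed

lemma moment_pos_iff:
  assumes "A \<in> frames"
  shows "moment (colspan A) $ k \<noteq> 0 \<longleftrightarrow> (\<exists>b. br A k b \<noteq> 0)"
proof -
  have "moment (colspan A) $ k = 0 \<longleftrightarrow> (\<Sum>I\<in>supp A. wt A I * real (card (I \<inter> {k}))) = 0"
    using sum_moment[OF assms, of "{k}"] tot_pos[OF assms] by auto
  also have "\<dots> \<longleftrightarrow> (\<forall>I\<in>supp A. k \<notin> I)"
    using wt_pos[of _ A] by (subst sum_nonneg_eq_0_iff) (force simp: wt_nonneg less_le)+
  also have "\<dots> \<longleftrightarrow> (\<forall>b. br A k b = 0)"
  proof safe
    fix I assume h: "\<forall>b. br A k b = 0" "I \<in> supp A" "k \<in> I"
    then obtain b where "I = {k, b}" using supp_subset by (metis doubleton_eq_iff insertE pairs_cases singletonD subsetD)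
    then show False using h by simp
  qed (metis insertI1 pair_in_supp)
  finally show ?thesis by auto
qed

text \<open>The row \<open>z\<close> witnesses that row \<open>a\<close> is nonzero; two rows
  parallel to a nonzero row are parallel to each other.\<close>

lemma br_zero_trans:
  assumes "br A a z \<noteq> 0" "br A a x = 0" "br A a y = 0"
  shows "br A x y = 0"
  using br_pluecker[of A a z x y] assms by simp

lemma card_Int_pair_le1:
  assumes "I \<in> supp A" "\<And>x y. x \<in> C \<Longrightarrow> y \<in> C \<Longrightarrow> br A x y = 0"
  shows "card (I \<inter> C) \<le> 1"
proof -
  obtain x y where "I = {x, y}" using assms(1) supp_subset by (meson pairs_cases subsetD)
  then have "x \<notin> C \<or> y \<notin> C" using assms by auto
  then have "I \<inter> C \<subseteq> {x} \<or> I \<inter> C \<subseteq> {y}" using \<open>I = {x, y}\<close> by auto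
  then show ?thesis by (metis card.empty card_mono card_insert_disjoint empty_iff finite.emptyI finite_insert One_nat_def)
qed

text \<open>If rows \<open>a, b\<close> are parallel in \<open>A\<close> but not in \<open>B\<close>, then compatibility makes the rows outside
  the parallelism class \<open>C\<close> of \<open>a\<close> pairwise parallel in \<open>B\<close>. Then the moment coordinates sum to at
  most 1 over \<open>C\<close>, as seen in \<open>A\<close>, and to less than 1 outside of \<open>C\<close>, as seen in \<open>B\<close>; but their
  total is 2.\<close>

lemma compat_zero:
  assumes A: "A \<in> frames" and B: "B \<in> frames" and c: "compat A B"
    and m: "moment (colspan A) = moment (colspan B)" and ab: "br A a b = 0"
  shows "br B a b = 0"
proof (rule ccontr)
  assume nB: "br B a b \<noteq> 0"
  then have nB': "br B b a \<noteq> 0" using br_swap[of B a b] by simp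
  obtain y where y: "br A a y \<noteq> 0" using nB moment_pos_iff[OF A] moment_pos_iff[OF B] m by metis
  obtain z where z: "br A b z \<noteq> 0" using nB' moment_pos_iff[OF A] moment_pos_iff[OF B] m by metis
  have ba: "br A b a = 0" using ab br_swap[of A a b] by simp
  define C where "C = {k. br A a k = 0}"
  have CA: "br A x y = 0" if "x \<in> C" "y \<in> C" for x y
    using that y br_zero_trans unfolding C_def by blast
  have DB: "br B p q = 0" if pq: "p \<in> - C" "q \<in> - C" for p q
  proof -
    have "br A b q \<noteq> 0" using br_zero_trans[OF z ba, of q] pq by (auto simp: C_def)
    moreover have "br A a p \<noteq> 0" using pq by (simp add: C_def)
    moreover have "br A a p * br A b q * (br B a b * br B p q) = 0"
      using c[unfolded compat_def, rule_format, of a b p q] ab by simp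
    ultimately show ?thesis using nB by simp
  qed
  have "(\<Sum>k\<in>C. moment (colspan A) $ k) * tot A \<le> tot A"
    unfolding sum_moment[OF A] unfolding tot_supp
    using card_Int_pair_le1[OF _ CA] wt_nonneg
    by (intro sum_mono) (auto intro: mult_left_le)
  then have 1: "(\<Sum>k\<in>C. moment (colspan A) $ k) \<le> 1" using tot_pos[OF A] by simp
  have "(\<Sum>k\<in>-C. moment (colspan B) $ k) * tot B < tot B"
    unfolding sum_moment[OF B] unfolding tot_supp
  proof (rule sum_strict_mono_strong[where a = "{a, b}"])
    show "{a, b} \<in> supp B" using nB by simp
    have "{a, b} \<inter> - C = {}" using ab by (auto simp: C_def)
    then show "wt B {a, b} * real (card ({a, b} \<inter> - C)) < wt B {a, b}"
      using wt_pos[of "{a, b}" B] nB by simp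
    show "wt B I * real (card (I \<inter> - C)) \<le> wt B I" if "I \<in> supp B" for I
      using card_Int_pair_le1[OF that, of "- C"] DB wt_nonneg by (simp add: mult_left_le)
  qed simp
  then have 2: "(\<Sum>k\<in>-C. moment (colspan B) $ k) < 1" using tot_pos[OF B] by simp
  have "(\<Sum>I\<in>supp A. wt A I * real (card (I \<inter> UNIV))) = tot A * 2"
    unfolding tot_supp sum_distrib_right
    by (intro sum.cong) (use supp_subset card_pairs in auto)
  then have "(\<Sum>k\<in>UNIV. moment (colspan A) $ k) = 2"
    using sum_moment[OF A, of UNIV] tot_pos[OF A] by simp
  moreover have "(\<Sum>k\<in>UNIV. moment (colspan A) $ k) =
      (\<Sum>k\<in>C. moment (colspan A) $ k) + (\<Sum>k\<in>-C. moment (colspan A) $ k)"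
    by (simp add: Compl_eq_Diff_UNIV sum.subset_diff[of C UNIV])
  ultimately show False using 1 2 m by simp
qed

text \<open>In the chart of the rows \<open>a\<close>, \<open>b\<close> a subspace has coordinates
  \<open>p k\<close>, \<open>q k\<close>. By the last hypothesis the ratio of
  \<open>p B k / p A k\<close> to \<open>q B k / q A k\<close> is the same for all rows
  \<open>k\<close> with both coordinates nonzero. Two column factors \<open>l\<close>,
  \<open>r\<close> absorb this ratio, and scaling the rows does the rest.\<close>

lemma same_CT_orbit:
  assumes abA: "br A a b \<noteq> 0" and abB: "br B a b \<noteq> 0"
    and zb: "\<And>k. br A k b = 0 \<longleftrightarrow> br B k b = 0" and za: "\<And>k. br A a k = 0 \<longleftrightarrow> br B a k = 0"
    and cr: "\<And>c d. br A c b * br A a d * (br B d b * br B a c) = br A d b * br A a c * (br B c b * br B a d)"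
  obtains t where "t \<in> CT5" "colspan B = act t (colspan A)"
proof -
  define p where "p M k = br M k b / br M a b" for M k
  define q where "q M k = br M a k / br M a b" for M k
  have pz: "p A k = 0 \<longleftrightarrow> p B k = 0" and qz: "q A k = 0 \<longleftrightarrow> q B k = 0" for k
    using zb za abA abB by (auto simp: p_def q_def)
  have cr': "p A c * q A d * (p B d * q B c) = p A d * q A c * (p B c * q B d)" for c d
    using cr[of c d] abA abB by (simp add: p_def q_def field_simps)
  obtain l r where lr: "l \<noteq> 0" "r \<noteq> 0"
    "\<And>k. p A k \<noteq> 0 \<Longrightarrow> q A k \<noteq> 0 \<Longrightarrow> p B k * (r * q A k) = q B k * (l * p A k)"
  proof (cases "\<exists>c. p A c \<noteq> 0 \<and> q A c \<noteq> 0")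
    case True
    then obtain c where c: "p A c \<noteq> 0" "q A c \<noteq> 0" by blast
    show thesis
    proof (rule that)
      show "p B c / p A c \<noteq> 0" "q B c / q A c \<noteq> 0" using c pz qz by auto
      show "p B k * (q B c / q A c * q A k) = q B k * (p B c / p A c * p A k)" for k
        using cr'[of c k] c by (simp add: field_simps)
    qed
  next
    case False
    then show thesis by (intro that[of 1 1]) auto
  qed
  \<comment> \<open>Where both coordinates are nonzero, the choice of \<open>l\<close> and
    \<open>r\<close> makes the two quotients agree. A row with both coordinates zero imposes no
    condition, and the factor 1 keeps \<open>t\<close> in the torus.\<close>
  define t :: "complex^5" where "t = (\<chi> k. if p A k \<noteq> 0 then p B k / (l * p A k)
    else if q A k \<noteq> 0 then q B k / (r * q A k) else 1)"
  have tC: "t \<in> CT5" using lr pz qz by (simp add: CT5_def t_def)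
  have tp: "p B k = t $ k * l * p A k" for k
    using lr pz[of k] by (simp add: t_def)
  have tq: "q B k = t $ k * r * q A k" for k
    using lr pz[of k] qz[of k] by (simp add: t_def field_simps)
  have brpq: "br M k j = br M a b * (p M k * q M j - q M k * p M j)" if "br M a b \<noteq> 0" for M k j
  proof -
    have "br M a b * br M k j = br M k b * br M a j - br M a k * br M j b"
      unfolding br_def by (simp add: algebra_simps)
    moreover have "br M a b * (p M k * q M j - q M k * p M j) * br M a b =
        br M k b * br M a j - br M a k * br M j b"
      using that by (simp add: p_def q_def left_diff_distrib right_diff_distrib)
    ultimately show ?thesis using that by (metis mult.commute mult_cancel_right)
  qed
  have kj: "br B k j = (l * r * br B a b / br A a b) * br (scale t A) k j" for k j
    unfolding brpq[OF abB, of k j] br_scale brpq[OF abA, of k j] tp tq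
    using abA by (simp add: algebra_simps)
  have "scale t A \<in> frames"
    using abA tC by (intro scale_frames) (auto simp: frames_iff)
  then have "colspan B = colspan (scale t A)"
    using lr abA abB by (intro colspan_eqI[OF _ _ kj]) simp_all
  then show thesis using that tC by (simp add: act_colspan)
qed

theorem compat_moment_eq_imp_same_T_orbit:
  assumes A: "A \<in> frames" and B: "B \<in> frames" and c: "compat A B"
    and m: "moment (colspan A) = moment (colspan B)"
  shows "T_orbit (colspan A) = T_orbit (colspan B)"
proof -
  have z: "br A a b = 0 \<longleftrightarrow> br B a b = 0" for a b
    using compat_zero[OF A B c m] compat_zero[OF B A compat_sym[OF c] m[symmetric]] by blast
  obtain a b where ab: "br A a b \<noteq> 0" using A by (auto simp: frames_iff)
  have "br A c b * br A a d * (br B d b * br B a c) = br A d b * br A a c * (br B c b * br B a d)" for c d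
    using c[unfolded compat_def, rule_format, of b c d a]
      br_swap[of _ c b] br_swap[of _ d b] br_swap[of _ d a] br_swap[of _ c a]
    by (simp add: algebra_simps)
  then obtain t where "t \<in> CT5" "colspan B = act t (colspan A)"
    using same_CT_orbit[of A a b B] ab z by blast
  then show ?thesis using moment_eq_imp_same_T_orbit[OF A, of t] m by simp
qed

section \<open>The orbit space is Hausdorff\<close>

definition orb :: "complex^2^5 \<Rightarrow> (complex^5) set set" where
  "orb A = T_orbit (colspan A)"

lemma colspan_image_frames: "colspan ` frames = G52"
  using G52_obtain_frame by (auto simp: frames_def)

lemma orb_image_frames: "orb ` frames = GT"
  unfolding orb_def GT_def colspan_image_frames[symmetric] by (simp add: image_image)

lemma orb_in_GT [simp]: "A \<in> frames \<Longrightarrow> orb A \<in> GT"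
  using orb_image_frames by blast

lemma GT_obtain_frame:
  assumes "X \<in> GT" obtains A where "A \<in> frames" "X = orb A"
  using assms orb_image_frames by blast

lemma topspace_G52_top [simp]: "topspace G52_top = G52"
  unfolding G52_top_def using colspan_image_frames by (intro topspace_final_topology) auto

lemma topspace_GT_top [simp]: "topspace GT_top = GT"
  unfolding GT_top_def by (intro topspace_final_topology) (auto simp: GT_def)

lemma continuous_map_orb: "continuous_map (top_of_set frames) GT_top orb"
proof -
  have "continuous_map (top_of_set frames) G52_top colspan"
    unfolding G52_top_def using colspan_image_frames
    by (intro continuous_map_into_final_topology) auto
  moreover have "continuous_map G52_top GT_top T_orbit"
    unfolding GT_top_def by (intro continuous_map_into_final_topology) (auto simp: GT_def)
  ultimately have "continuous_map (top_of_set frames) GT_top (T_orbit \<circ> colspan)"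
    by (rule continuous_map_compose)
  then show ?thesis by (simp add: orb_def[abs_def] comp_def)
qed

lemma continuous_map_from_GT:
  assumes "continuous_map (top_of_set frames) Y (g \<circ> orb)"
  shows "continuous_map GT_top Y g"
  unfolding GT_top_def
proof (rule continuous_map_from_final_topology)
  have *: "(g \<circ> T_orbit) ` G52 = (g \<circ> orb) ` frames" "g ` GT = (g \<circ> orb) ` frames"
    unfolding colspan_image_frames[symmetric] orb_image_frames[symmetric]
    by (simp_all add: image_image orb_def)
  have Y: "(g \<circ> orb) ` frames \<subseteq> topspace Y"
    using assms by (auto simp: continuous_map_def)
  show "T_orbit \<in> topspace G52_top \<rightarrow> GT" by (auto simp: GT_def)
  show "g \<in> GT \<rightarrow> topspace Y" using * Y by blast
  have "(g \<circ> T_orbit) \<in> G52 \<rightarrow> topspace Y" using * Y by blast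
  moreover have "g \<circ> T_orbit \<circ> colspan = g \<circ> orb"
    by (simp add: orb_def comp_def)
  ultimately show "continuous_map G52_top Y (g \<circ> T_orbit)"
    unfolding G52_top_def using assms colspan_image_frames
    by (intro continuous_map_from_final_topology) auto
qed

section \<open>A compact family of frames covering the Grassmannian\<close>

definition normal_frames :: "(complex^2^5) set" where
  "normal_frames = (\<Union>a. \<Union>b. {A. A $ a $ 1 = 1 \<and> A $ a $ 2 = 0 \<and> A $ b $ 1 = 0 \<and> A $ b $ 2 = 1
     \<and> (\<forall>k c. norm (A $ k $ c) \<le> 1)})"

lemma normal_frames_subset: "normal_frames \<subseteq> frames"
proof
  fix A assume "A \<in> normal_frames"
  then obtain a b where "A $ a $ 1 = 1" "A $ a $ 2 = 0" "A $ b $ 1 = 0" "A $ b $ 2 = 1"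
    by (auto simp: normal_frames_def)
  then have "br A a b = 1" by (simp add: br_def)
  then show "A \<in> frames" by (metis frames_iff zero_neq_one)
qed

lemma compact_normal_frames: "compact normal_frames"
proof -
  have "norm A \<le> 10" if "A \<in> normal_frames" for A
  proof -
    have "norm A \<le> (\<Sum>k\<in>UNIV. norm (A $ k))"
      unfolding norm_vec_def by (rule L2_set_le_sum) simp
    also have "\<dots> \<le> (\<Sum>k\<in>(UNIV :: 5 set). 2)"
    proof (rule sum_mono)
      fix k
      have "norm (A $ k) \<le> (\<Sum>c\<in>UNIV. norm (A $ k $ c))"
        unfolding norm_vec_def[of "A $ k"] by (rule L2_set_le_sum) simp
      also have "\<dots> \<le> (\<Sum>c\<in>(UNIV :: 2 set). 1)"
        using that by (intro sum_mono) (auto simp: normal_frames_def)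
      finally show "norm (A $ k) \<le> 2" by simp
    qed
    finally show ?thesis by simp
  qed
  then have "bounded normal_frames" by (auto simp: bounded_iff)
  moreover have "closed normal_frames"
    unfolding normal_frames_def
    by (intro closed_UN finite ballI closed_Collect_conj closed_Collect_eq closed_Collect_le closed_Collect_all continuous_intros)
  ultimately show ?thesis by (simp add: compact_eq_bounded_closed)
qed

text \<open>The product of \<open>A\<close> with the inverse of its rows \<open>a\<close>,
  \<open>b\<close>, written by Cramer's rule.\<close>

definition chart_frame :: "5 \<Rightarrow> 5 \<Rightarrow> complex^2^5 \<Rightarrow> complex^2^5" where
  "chart_frame a b A = (\<chi> k. vector [br A k b / br A a b, br A a k / br A a b])"

lemma chart_frame_nth [simp]:
  "chart_frame a b A $ k $ 1 = br A k b / br A a b" "chart_frame a b A $ k $ 2 = br A a k / br A a b"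
  by (simp_all add: chart_frame_def)

lemma colspan_chart_frame:
  assumes ab: "br A a b \<noteq> 0"
  shows "colspan (chart_frame a b A) = colspan A"
proof (rule colspan_eqI)
  fix k j
  have "br A a b * br A k j = br A k b * br A a j - br A a k * br A j b"
    unfolding br_def by (simp add: algebra_simps)
  moreover have "br (chart_frame a b A) k j * br A a b * br A a b = br A k b * br A a j - br A a k * br A j b"
    unfolding br_def[of "chart_frame a b A"] chart_frame_nth using ab by (simp add: left_diff_distrib)
  ultimately have "br A a b * (br (chart_frame a b A) k j * br A a b) = br A a b * br A k j"
    by (simp add: mult_ac)
  then show "br (chart_frame a b A) k j = inverse (br A a b) * br A k j"
    using ab by (simp add: field_simps)
qed (use ab frames_iff in auto)

text \<open>Take the chart of the rows \<open>a, b\<close> with the largest bracket.\<close>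

lemma normal_frame_exists:
  assumes A: "A \<in> frames"
  obtains B where "B \<in> normal_frames" "colspan B = colspan A"
proof -
  let ?f = "\<lambda>p. norm (br A (fst p) (snd p))"
  have "Max (range ?f) \<in> range ?f" by (intro Max_in) auto
  then obtain m where "Max (range ?f) = ?f m" by blast
  then have m: "norm (br A (fst p) (snd p)) \<le> norm (br A (fst m) (snd m))" for p
    using Max_ge[of "range ?f" "?f p"] by simp
  define a where "a = fst m"
  define b where "b = snd m"
  have mab: "norm (br A c d) \<le> norm (br A a b)" for c d
    using m[of "(c, d)"] by (simp add: a_def b_def)
  have ab: "br A a b \<noteq> 0" using A mab by (fastforce simp: frames_iff)
  have "norm (chart_frame a b A $ k $ c) \<le> 1" for k c
    using mab ab exhaust_2[of c] by (auto simp: norm_divide)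
  then have "chart_frame a b A \<in> normal_frames"
    unfolding normal_frames_def using ab
    by (intro UN_I[of a] UN_I[of b] UNIV_I CollectI) simp_all
  then show thesis using that colspan_chart_frame[OF ab] by blast
qed

section \<open>Continuous invariants separating torus orbits\<close>

lemma orb_eq_br:
  assumes A: "A \<in> frames" and eq: "orb A = orb B"
  obtains d t where "d \<noteq> 0" "t \<in> T5" "\<And>a b. br B a b = d * (t $ a * t $ b * br A a b)"
proof -
  obtain t where t: "t \<in> T5" "colspan B = act t (colspan A)"
    using eq T_orbit_eqD unfolding orb_def by blast
  then have s: "scale t A \<in> frames" "colspan (scale t A) = colspan B"
    using A T5_subset_CT5 by (auto simp: act_colspan intro: scale_frames)
  obtain d where "d \<noteq> 0" "\<And>a b. br B a b = d * br (scale t A) a b"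
    using br_colspan_eq[OF s(2,1)] by blast
  then show thesis using that t by (simp add: br_scale)
qed

lemma T5_norm [simp]: "t \<in> T5 \<Longrightarrow> norm (t $ k) = 1"
  by (simp add: T5_def)

lemma wt_twisted:
  assumes "t \<in> T5" "\<And>a b. br B a b = d * (t $ a * t $ b * br A a b)" "I \<in> pairs"
  shows "wt B I = (norm d)\<^sup>2 * wt A I"
proof -
  obtain a b where "I = {a, b}" using assms(3) by (rule pairs_cases)
  then show ?thesis using assms(1) by (simp add: wt_pair assms(2) norm_mult power_mult_distrib)
qed

lemma tot_twisted:
  assumes "t \<in> T5" "\<And>a b. br B a b = d * (t $ a * t $ b * br A a b)"
  shows "tot B = (norm d)\<^sup>2 * tot A"
  by (simp add: tot_def wt_twisted[OF assms] sum_distrib_left)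

lemma moment_orb:
  assumes A: "A \<in> frames" and B: "B \<in> frames" and eq: "orb A = orb B"
  shows "moment (colspan A) = moment (colspan B)"
proof -
  obtain d t where d: "d \<noteq> 0" "t \<in> T5" "\<And>a b. br B a b = d * (t $ a * t $ b * br A a b)"
    using orb_eq_br[OF A eq] by blast
  have "(\<Sum>I\<in>pairs. wt B I *\<^sub>R Lam I) = (norm d)\<^sup>2 *\<^sub>R (\<Sum>I\<in>pairs. wt A I *\<^sub>R Lam I)"
    by (simp add: wt_twisted[OF d(2,3)] scaleR_sum_right)
  then show ?thesis
    using d(1) by (simp add: moment_colspan A B tot_twisted[OF d(2,3)])
qed

lemma orb_member:
  assumes "A \<in> frames" "L \<in> orb A"
  obtains B where "B \<in> frames" "L = colspan B" "orb B = orb A"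
proof -
  obtain t where t: "t \<in> T5" "L = act t (colspan A)"
    using assms(2) by (auto simp: orb_def T_orbit_def)
  then show thesis
    using that[of "scale t A"] assms(1) T5_subset_CT5 T_orbit_act[OF t(1), of "colspan A"]
    by (auto simp: act_colspan scale_frames orb_def)
qed

lemma colspan_in_orb: "colspan A \<in> orb A"
  by (simp add: orb_def T_orbit_self)

lemma moment_hat_orb:
  assumes A: "A \<in> frames"
  shows "moment_hat (orb A) = moment (colspan A)"
proof -
  have "moment ` orb A = {moment (colspan A)}"
    using colspan_in_orb[of A] moment_orb[OF A] orb_member[OF A] by (auto; metis imageI)
  then show ?thesis by (simp add: moment_hat_def)
qed

text \<open>The entries of \<open>inv1\<close> and \<open>inv2\<close> are those of \<open>q q\<^sup>*\<close> for the vectors \<open>q\<close> of products of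
  complementary brackets, scaled to be independent of the basis; they are torus invariant and
  determine each \<open>q\<close> up to a factor of modulus 1.\<close>

definition inv1 :: "complex^2^5 \<Rightarrow> complex^(5 \<times> 5 \<times> 5 \<times> 5)" where
  "inv1 A = (\<chi> k. case k of (a, b, c, d) \<Rightarrow>
     br A a b * br A c d * cnj (br A a c * br A b d) / of_real ((tot A)\<^sup>2))"

definition inv2 :: "complex^2^5 \<Rightarrow> real^(5 \<times> 5 \<times> 5 \<times> 5)" where
  "inv2 A = (\<chi> k. case k of (a, b, c, d) \<Rightarrow> (norm (br A a b * br A c d))\<^sup>2 / (tot A)\<^sup>2)"

definition orbit_invariants :: "complex^2^5 \<Rightarrow> (real^5) \<times> (complex^(5 \<times> 5 \<times> 5 \<times> 5)) \<times> (real^(5 \<times> 5 \<times> 5 \<times> 5))" where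
  "orbit_invariants A = ((\<Sum>I\<in>pairs. wt A I *\<^sub>R Lam I) /\<^sub>R tot A, inv1 A, inv2 A)"

lemma continuous_on_br [continuous_intros]: "continuous_on S (\<lambda>A. br A a b)"
  unfolding br_def by (intro continuous_intros)

lemma continuous_on_wt [continuous_intros]: "continuous_on S (\<lambda>A. wt A I)"
  unfolding wt_def minor_def by (intro continuous_intros)

lemma continuous_on_tot [continuous_intros]: "continuous_on S tot"
  unfolding tot_def[abs_def] by (intro continuous_intros)

lemma continuous_on_orbit_invariants: "continuous_on frames orbit_invariants"
proof -
  have 0: "tot A \<noteq> 0" if "A \<in> frames" for A using tot_pos[OF that] by simp
  have "continuous_on frames inv1" unfolding inv1_def
  proof (rule continuous_on_vec_lambda)
    fix k :: "5 \<times> 5 \<times> 5 \<times> 5"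
    show "continuous_on frames (\<lambda>A. case k of (a, b, c, d) \<Rightarrow>
       br A a b * br A c d * cnj (br A a c * br A b d) / of_real ((tot A)\<^sup>2))"
      by (cases k) (auto intro!: continuous_intros simp: 0)
  qed
  moreover have "continuous_on frames inv2" unfolding inv2_def
  proof (rule continuous_on_vec_lambda)
    fix k :: "5 \<times> 5 \<times> 5 \<times> 5"
    show "continuous_on frames (\<lambda>A. case k of (a, b, c, d) \<Rightarrow> (norm (br A a b * br A c d))\<^sup>2 / (tot A)\<^sup>2)"
      by (cases k) (auto intro!: continuous_intros simp: 0)
  qed
  ultimately show ?thesis
    unfolding orbit_invariants_def[abs_def] using 0 by (intro continuous_intros) auto
qed

lemma orbit_invariants_orb:
  assumes A: "A \<in> frames" and B: "B \<in> frames" and eq: "orb A = orb B"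
  shows "orbit_invariants A = orbit_invariants B"
proof -
  obtain d t where d: "d \<noteq> 0" "t \<in> T5" "\<And>a b. br B a b = d * (t $ a * t $ b * br A a b)"
    using orb_eq_br[OF A eq] by blast
  have tot: "tot B = (norm d)\<^sup>2 * tot A" using tot_twisted[OF d(2,3)] .
  have t1: "t $ a * cnj (t $ a) = 1" for a
    using d(2) by (simp add: complex_norm_square[symmetric])
  have dd: "d * cnj d = of_real ((norm d)\<^sup>2)" by (rule complex_norm_square[symmetric])
  have n: "norm d \<noteq> 0" using d(1) by simp
  have "br B a b * br B c e * cnj (br B a c * br B b e) / of_real ((tot B)\<^sup>2) =
      br A a b * br A c e * cnj (br A a c * br A b e) / of_real ((tot A)\<^sup>2)" for a b c e
  proof -
    have "br B a b * br B c e * cnj (br B a c * br B b e) =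
      (d * cnj d) * (d * cnj d) * (t $ a * cnj (t $ a)) * (t $ b * cnj (t $ b))
        * (t $ c * cnj (t $ c)) * (t $ e * cnj (t $ e))
        * (br A a b * br A c e * cnj (br A a c * br A b e))"
      unfolding d(3) by (simp add: mult_ac)
    also have "\<dots> = of_real ((norm d)\<^sup>2) * of_real ((norm d)\<^sup>2) * (br A a b * br A c e * cnj (br A a c * br A b e))"
      unfolding t1 dd by simp
    finally show ?thesis using n by (simp add: tot power_mult_distrib power2_eq_square)
  qed
  then have 1: "inv1 A = inv1 B" by (auto simp: inv1_def vec_eq_iff)
  have "(norm (br B a b * br B c e))\<^sup>2 / (tot B)\<^sup>2 = (norm (br A a b * br A c e))\<^sup>2 / (tot A)\<^sup>2" for a b c e
    using n d(2) by (simp add: d(3) tot norm_mult power_mult_distrib power2_eq_square)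
  then have 2: "inv2 A = inv2 B" by (auto simp: inv2_def vec_eq_iff)
  show ?thesis
    using 1 2 moment_orb[OF A B eq] by (simp add: orbit_invariants_def moment_colspan A B)
qed

text \<open>The invariants give the values of \<open>P * cnj Q\<close> and \<open>Q * cnj Q\<close>,
  and cross-multiplying these yields \<open>P A * Q B = Q A * P B\<close>, which is compatibility.
  The moment being an invariant too, the result on compatible frames applies.\<close>

lemma orbit_invariants_inj:
  assumes A: "A \<in> frames" and B: "B \<in> frames" and eq: "orbit_invariants A = orbit_invariants B"
  shows "orb A = orb B"
  unfolding orb_def
proof (rule compat_moment_eq_imp_same_T_orbit[OF A B])
  show "moment (colspan A) = moment (colspan B)"
    using eq by (simp add: orbit_invariants_def moment_colspan A B)
  show "compat A B"
    unfolding compat_def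
  proof (intro allI)
    fix a b c d
    define P where "P M = br M a b * br M c d / of_real (tot M)" for M
    define Q where "Q M = br M a c * br M b d / of_real (tot M)" for M
    have i1: "inv1 M $ (a, b, c, d) = P M * cnj (Q M)" for M
      by (simp add: inv1_def P_def Q_def power2_eq_square)
    have i2: "inv2 M $ (a, c, b, d) = (norm (Q M))\<^sup>2" for M
      by (simp add: inv2_def Q_def norm_divide power_divide)
    have PQ: "P A * cnj (Q A) = P B * cnj (Q B)"
      using i1[of A] i1[of B] eq by (simp add: orbit_invariants_def)
    have Q: "Q A * cnj (Q A) = Q B * cnj (Q B)"
      using i2[of A] i2[of B] eq by (simp add: orbit_invariants_def flip: complex_norm_square)
    have "P A * Q B = Q A * P B"
    proof (cases "Q A = 0")
      case True
      then show ?thesis using Q by simp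
    next
      case False
      then have "cnj (Q A) \<noteq> 0" by simp
      moreover have "cnj (Q A) * (P A * Q B) = cnj (Q A) * (Q A * P B)"
        using PQ Q by (metis mult.assoc mult.commute)
      ultimately show ?thesis by (metis mult_cancel_left)
    qed
    then show "br A a b * br A c d * (br B a c * br B b d) = br A a c * br A b d * (br B a b * br B c d)"
      using tot_pos[OF A] tot_pos[OF B] by (simp add: P_def Q_def field_simps)
  qed
qed

lemma Hausdorff_space_via_injection:
  fixes f :: "'a \<Rightarrow> 'b::metric_space"
  assumes "continuous_map X euclidean f" "inj_on f (topspace X)"
  shows "Hausdorff_space X"
  by (rule Hausdorff_space_injective_preimage[OF _ assms]) (rule Hausdorff_space_euclidean)

lemma Hausdorff_space_GT: "Hausdorff_space GT_top"
proof -
  define g where "g X = orbit_invariants (SOME A. A \<in> frames \<and> orb A = X)" for X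
  have g: "g (orb A) = orbit_invariants A" if "A \<in> frames" for A
  proof -
    have "\<exists>B. B \<in> frames \<and> orb B = orb A" using that by blast
    from someI_ex[OF this] show ?thesis
      unfolding g_def using that by (intro orbit_invariants_orb) auto
  qed
  have "continuous_map (top_of_set frames) euclidean (g \<circ> orb)"
    using continuous_on_orbit_invariants
    by (auto simp: g cong: continuous_on_cong)
  then have "continuous_map GT_top euclidean g" by (rule continuous_map_from_GT)
  moreover have "inj_on g GT"
    by (intro inj_onI) (metis GT_obtain_frame g orbit_invariants_inj)
  ultimately show ?thesis by (intro Hausdorff_space_via_injection[of _ g]) auto
qed

lemma continuous_map_moment_hat: "continuous_map GT_top euclidean moment_hat"
proof (rule continuous_map_from_GT)
  have "continuous_on frames (\<lambda>A. fst (orbit_invariants A))"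
    using continuous_on_orbit_invariants by (rule continuous_on_fst)
  then have "continuous_on frames (moment_hat \<circ> orb)"
    by (rule continuous_on_eq) (simp add: moment_hat_orb moment_colspan orbit_invariants_def)
  then show "continuous_map (top_of_set frames) euclidean (moment_hat \<circ> orb)" by simp
qed

text \<open>The complex torus commutes with the compact one, so it acts on the orbit space. This
  action later moves points of \<open>Gamma\<close> to a prescribed moment.\<close>

lemma continuous_map_act: 
  assumes t: "t \<in> CT5"
  shows "continuous_map GT_top GT_top (image (act t))"
    and "\<And>A. image (act t) (orb A) = orb (scale t A)"
proof -
  show 1: "image (act t) (orb A) = orb (scale t A)" for A
    by (simp add: orb_def T_orbit_def image_image act_act tmul_commute flip: act_colspan)
  have "continuous_on frames (scale t)"
    unfolding scale_def vector_scalar_mult_def by (intro continuous_intros)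
  then have "continuous_map (top_of_set frames) (top_of_set frames) (scale t)"
    using t by (auto intro: scale_frames)
  from continuous_map_compose[OF this continuous_map_orb]
  show "continuous_map GT_top GT_top (image (act t))"
    by (intro continuous_map_from_GT) (simp add: comp_def 1)
qed

section \<open>Strata of the orbit space\<close>

lemma orb_in_stratum_T_iff:
  assumes A: "A \<in> frames"
  shows "orb A \<in> stratum_T \<sigma> \<longleftrightarrow> \<sigma> \<inter> pairs = supp A"
proof
  assume "orb A \<in> stratum_T \<sigma>"
  then obtain L where "L \<in> stratum \<sigma>" "orb A = T_orbit L" by (auto simp: stratum_T_def)
  then obtain B where B: "B \<in> frames" "supp B = \<sigma> \<inter> pairs" "orb A = orb B"
    by (metis orb_def stratum_obtain_frame)
  obtain d t where d: "d \<noteq> 0" "t \<in> T5" "\<And>a b. br B a b = d * (t $ a * t $ b * br A a b)"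
    using orb_eq_br[OF A B(3)] by blast
  have "{a, b} \<in> supp B \<longleftrightarrow> {a, b} \<in> supp A" for a b
    using d T5_subset_CT5 by (auto simp: CT5_def)
  then have "supp B = supp A"
    using supp_subset by (metis pairs_cases subsetD subsetI subset_antisym)
  then show "\<sigma> \<inter> pairs = supp A" using B by simp
next
  assume "\<sigma> \<inter> pairs = supp A"
  then have "colspan A \<in> stratum \<sigma>" using stratum_iff[OF A] by simp
  then show "orb A \<in> stratum_T \<sigma>" by (simp add: stratum_T_def orb_def)
qed

lemma stratum_T_obtain_frame:
  assumes "X \<in> stratum_T \<sigma>"
  obtains A where "A \<in> frames" "X = orb A" "supp A = \<sigma> \<inter> pairs"
  using assms by (auto simp: stratum_T_def orb_def elim!: stratum_obtain_frame)

lemma admissible_iff: "\<sigma> \<in> admissible \<longleftrightarrow> (\<exists>A\<in>frames. supp A = \<sigma>)"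
proof
  assume "\<sigma> \<in> admissible"
  then obtain L where "\<sigma> \<subseteq> pairs" "L \<in> stratum \<sigma>" by (auto simp: admissible_def)
  then show "\<exists>A\<in>frames. supp A = \<sigma>" by (metis inf.orderE stratum_obtain_frame)
next
  assume "\<exists>A\<in>frames. supp A = \<sigma>"
  then obtain A where A: "A \<in> frames" "supp A = \<sigma>" by blast
  then have "colspan A \<in> stratum \<sigma>" using stratum_iff supp_subset by blast
  then show "\<sigma> \<in> admissible" using A supp_subset by (auto simp: admissible_def)
qed

lemma moment_tilde_orb:
  assumes A: "A \<in> frames"
  shows "moment_tilde (orb A) = (supp A, moment (colspan A))"
proof -
  have "(THE \<sigma>. \<sigma> \<in> admissible \<and> orb A \<in> stratum_T \<sigma>) = supp A"
    using A supp_subset by (intro the_equality) (auto simp: orb_in_stratum_T_iff admissible_iff)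
  then show ?thesis by (simp add: moment_tilde_def moment_hat_orb A)
qed

lemma h_map_orb: "A \<in> frames \<Longrightarrow> h_map (orb A) = (moment (colspan A), CT_orbit (colspan A))"
  by (simp add: h_map_def moment_hat_orb) (simp add: orb_def p_map_T_orbit)

lemma p_map_orb: "p_map (orb A) = CT_orbit (colspan A)"
  by (simp add: orb_def p_map_T_orbit)

lemma h_map_inj:
  assumes A: "A \<in> frames" and B: "B \<in> frames" and eq: "h_map (orb A) = h_map (orb B)"
  shows "orb A = orb B"
proof -
  obtain t where "t \<in> CT5" "colspan B = act t (colspan A)"
    using eq CT_orbit_eqD unfolding h_map_orb[OF A] h_map_orb[OF B] by blast
  then show ?thesis
    using eq moment_eq_imp_same_T_orbit[OF A, of t] unfolding h_map_orb[OF A] h_map_orb[OF B]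
    by (simp add: orb_def)
qed

lemma h_inv_eq:
  assumes "X \<in> stratum_T \<sigma>"
  shows "h_inv \<sigma> (moment_hat X, p_map X) = X"
proof -
  have "inj_on h_map (stratum_T \<sigma>)"
    by (intro inj_onI) (metis stratum_T_obtain_frame h_map_inj)
  from the_inv_into_f_f[OF this assms] show ?thesis
    by (simp add: h_inv_def h_map_def)
qed

section \<open>Projective spaces\<close>

lemma mem_line: "x \<in> line v \<longleftrightarrow> (\<exists>c. x = c *s v)"
  by (simp add: line_def vec.span_breakdown_eq)

lemma line_scale:
  assumes "c \<noteq> 0"
  shows "line (c *s v) = line v"
proof (rule set_eqI)
  fix x
  show "x \<in> line (c *s v) \<longleftrightarrow> x \<in> line v"
  proof
    assume "x \<in> line v"
    then obtain e where "x = e *s v" by (auto simp: mem_line)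
    then have "x = (e / c) *s (c *s v)" using assms by simp
    then show "x \<in> line (c *s v)" unfolding mem_line by blast
  qed (auto simp: mem_line)
qed

lemma line_eqD:
  assumes "line u = line v" "u \<noteq> 0"
  obtains c where "c \<noteq> 0" "u = c *s v"
proof -
  have "u \<in> line u" unfolding mem_line by (rule exI[of _ 1]) simp
  then obtain c where "u = c *s v" using assms(1) by (auto simp: mem_line)
  then show thesis using assms(2) that by (cases "c = 0") auto
qed

lemma topspace_proj_top [simp]: "topspace proj_top = line ` (- {0})"
  unfolding proj_top_def by (intro topspace_final_topology) auto

lemma continuous_map_line: "continuous_map (top_of_set (- {0})) proj_top line"
  unfolding proj_top_def by (intro continuous_map_into_final_topology) auto

text \<open>The matrix of the orthogonal projection onto the line of \<open>v\<close>: the standard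
  embedding of projective space into the Hermitian matrices.\<close>

definition proj_inv :: "complex^'n \<Rightarrow> complex^('n \<times> 'n)" where
  "proj_inv v = (\<chi> p. v $ fst p * cnj (v $ snd p) / (\<Sum>k\<in>UNIV. v $ k * cnj (v $ k)))"

lemma hermitian_square_nonzero:
  assumes "(v :: complex^'n) \<noteq> 0"
  shows "(\<Sum>k\<in>UNIV. v $ k * cnj (v $ k)) \<noteq> 0"
proof -
  obtain a where a: "v $ a \<noteq> 0" using assms by (auto simp: vec_eq_iff)
  have "(\<Sum>k\<in>UNIV. v $ k * cnj (v $ k)) = of_real (\<Sum>k\<in>UNIV. (norm (v $ k))\<^sup>2)"
    unfolding of_real_sum by (intro sum.cong refl) (rule complex_norm_square[symmetric])
  moreover have "(\<Sum>k\<in>UNIV. (norm (v $ k))\<^sup>2) > 0"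
    using a by (intro sum_pos2[of _ a]) auto
  ultimately show ?thesis by (metis of_real_eq_0_iff less_irrefl)
qed

lemma proj_inv_scale:
  assumes "c \<noteq> 0"
  shows "proj_inv (c *s v) = proj_inv v"
proof -
  have "(\<Sum>k\<in>UNIV. (c *s v) $ k * cnj ((c *s v) $ k)) = c * cnj c * (\<Sum>k\<in>UNIV. v $ k * cnj (v $ k))"
    by (simp add: sum_distrib_left mult_ac)
  then show ?thesis using assms by (simp add: proj_inv_def vec_eq_iff)
qed

lemma proj_inv_inj:
  assumes u: "u \<noteq> 0" and v: "v \<noteq> 0" and eq: "proj_inv u = proj_inv v"
  shows "line u = line v"
proof -
  define M where "M w = (\<Sum>k\<in>UNIV. w $ k * cnj (w $ k))" for w :: "complex^'a"
  have M: "M u \<noteq> 0" "M v \<noteq> 0" using u v hermitian_square_nonzero by (auto simp: M_def)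
  obtain b where b: "u $ b \<noteq> 0" using u by (auto simp: vec_eq_iff)
  have e: "u $ a * cnj (u $ b) / M u = v $ a * cnj (v $ b) / M v" for a
    using arg_cong[OF eq, of "\<lambda>x. x $ (a, b)"] by (simp add: proj_inv_def M_def)
  define c where "c = M u / M v * cnj (v $ b) / cnj (u $ b)"
  have "u $ a = c * v $ a" for a
    using e[of a] b M by (simp add: c_def field_simps)
  then have uv: "u = c *s v" by (simp add: vec_eq_iff)
  then have "c \<noteq> 0" using u by auto
  then show ?thesis by (subst uv) (rule line_scale)
qed

lemma Hausdorff_space_proj_top: "Hausdorff_space (proj_top :: (complex^'n) set topology)"
proof -
  define g :: "(complex^'n) set \<Rightarrow> complex^('n \<times> 'n)"
    where "g X = proj_inv (SOME v. v \<noteq> 0 \<and> line v = X)" for X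
  have g: "g (line v) = proj_inv v" if "v \<noteq> 0" for v
  proof -
    have "\<exists>u. u \<noteq> 0 \<and> line u = line v" using that by blast
    from someI_ex[OF this] have s: "(SOME u. u \<noteq> 0 \<and> line u = line v) \<noteq> 0"
      "line (SOME u. u \<noteq> 0 \<and> line u = line v) = line v" by auto
    obtain c where "c \<noteq> 0" "(SOME u. u \<noteq> 0 \<and> line u = line v) = c *s v"
      using line_eqD[OF s(2,1)] .
    then show ?thesis unfolding g_def by (simp add: proj_inv_scale)
  qed
  have "continuous_on (- {0}) proj_inv"
    unfolding proj_inv_def using hermitian_square_nonzero by (intro continuous_intros) auto
  then have "continuous_on (- {0}) (g \<circ> line)"
    by (rule continuous_on_eq) (auto simp: g)
  then have "continuous_map proj_top euclidean g"
    unfolding proj_top_def by (intro continuous_map_from_final_topology) auto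
  moreover have "inj_on g (topspace proj_top)"
  proof (rule inj_onI)
    fix X Y assume h: "X \<in> topspace proj_top" "Y \<in> topspace proj_top" "g X = g Y"
    then obtain u v where "u \<noteq> 0" "v \<noteq> 0" "X = line u" "Y = line v" by auto
    then show "X = Y" using h(3) g proj_inv_inj by metis
  qed
  ultimately show ?thesis by (intro Hausdorff_space_via_injection[of _ g]) auto
qed

lemma Hausdorff_space_p1_cubed: "Hausdorff_space p1_cubed_top"
  unfolding p1_cubed_top_def by (simp add: Hausdorff_space_prod_topology Hausdorff_space_proj_top)

text \<open>The Segre vector is trilinear and \<open>drop_one\<close> is linear, so other
  representatives of the three lines only rescale the result.\<close>

lemma proj_from_one_lines: "proj_from_one (line u, line v, line w) = line (drop_one (segre u v w))"
proof -
  have m: "drop_one (segre (a *s u) (b *s v) (c *s w)) = (a * b * c) *s drop_one (segre u v w)" for a b c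
    by (simp add: drop_one_def segre_def vec_eq_iff algebra_simps)
  let ?S = "{drop_one (segre u' v' w') | u' v' w'. u' \<in> line u \<and> v' \<in> line v \<and> w' \<in> line w}"
  have "?S \<subseteq> line (drop_one (segre u v w))"
    by (auto simp: mem_line) (metis m)
  moreover have "drop_one (segre u v w) \<in> ?S"
    unfolding mem_line by (metis (mono_tags, lifting) mem_Collect_eq vector_smult_lid)
  ultimately have "vec.span ?S = line (drop_one (segre u v w))"
    unfolding line_def by (metis (no_types, lifting) empty_subsetI insert_subset subset_antisym vec.span_minimal
        vec.span_mono vec.subspace_span)
  then show ?thesis by (simp add: proj_from_one_def)
qed

lemma vec2_eq_iff: "(v :: 'a^2) = w \<longleftrightarrow> v $ 1 = w $ 1 \<and> v $ 2 = w $ 2"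
  by (simp add: vec_eq_iff forall_2)

lemma line2_eqD: "line (u :: complex^2) = line v \<Longrightarrow> u \<noteq> 0 \<Longrightarrow> u $ 1 * v $ 2 = u $ 2 * v $ 1"
  by (erule line_eqD) auto

lemma line2_eqI:
  assumes "(u :: complex^2) $ 1 * v $ 2 = u $ 2 * v $ 1" "u \<noteq> 0" "v \<noteq> 0"
  shows "line u = line v"
proof -
  obtain c where "c \<noteq> 0" "u = c *s v"
  proof (cases "v $ 1 = 0")
    case True
    then have "v $ 2 \<noteq> 0" using assms by (auto simp: vec2_eq_iff)
    then show ?thesis using True assms by (intro that[of "u $ 2 / v $ 2"]) (auto simp: vec2_eq_iff)
  next
    case False
    then show ?thesis using assms by (intro that[of "u $ 1 / v $ 1"]) (auto simp: vec2_eq_iff field_simps)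
  qed
  then show ?thesis using line_scale by metis
qed

section \<open>Chart coordinates of the main stratum\<close>

lemma chart_matrix_colspan:
  assumes ab: "br A a b \<noteq> 0"
  shows "chart_matrix a b (colspan A) = chart_frame a b A"
  unfolding chart_matrix_def
proof (rule the_equality)
  show "colspan (chart_frame a b A) = colspan A \<and> chart_frame a b A $ a = vector [1, 0]
      \<and> chart_frame a b A $ b = vector [0, 1]"
    using ab by (simp add: colspan_chart_frame vec2_eq_iff)
  fix M assume M: "colspan M = colspan A \<and> M $ a = vector [1, 0] \<and> M $ b = vector [0, 1]"
  have "A \<in> frames" using ab by (auto simp: frames_iff)
  then obtain d where d: "\<And>c e. br M c e = d * br A c e"
    using br_colspan_eq[of A M] M by metis
  have Mk: "M $ k $ 1 = br M k b" "M $ k $ 2 = br M a k" for k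
    using M by (simp_all add: br_def)
  have "d * br A a b = 1" using d[of a b] M by (simp add: br_def)
  then have "d = 1 / br A a b" using ab by (simp add: field_simps)
  then show "M = chart_frame a b A"
    by (simp add: vec_eq_iff forall_2 Mk d)
qed

text \<open>The rows \<open>k\<close>, \<open>l\<close>, \<open>m\<close> are those that carry
  \<open>(z1, z4)\<close>, \<open>(z2, z5)\<close>, \<open>(z3, z6)\<close> in the chart.\<close>

locale chart_labels =
  fixes i j k l m :: 5
  assumes ij: "i < j" and klm: "sorted_list_of_set (UNIV - {i, j}) = [k, l, m]"
begin

lemma label_distinct: "i \<noteq> j" "i \<noteq> k" "i \<noteq> l" "i \<noteq> m" "j \<noteq> k" "j \<noteq> l" "j \<noteq> m" "k \<noteq> l" "k \<noteq> m" "l \<noteq> m"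
  and UNIV_labels: "UNIV = {i, j, k, l, m}"
proof -
  have "set [k, l, m] = UNIV - {i, j}" unfolding klm[symmetric] by simp
  moreover have "distinct [k, l, m]" unfolding klm[symmetric] by (rule distinct_sorted_list_of_set)
  ultimately show "i \<noteq> j" "i \<noteq> k" "i \<noteq> l" "i \<noteq> m" "j \<noteq> k" "j \<noteq> l" "j \<noteq> m" "k \<noteq> l" "k \<noteq> m" "l \<noteq> m"
    "UNIV = {i, j, k, l, m}" using ij by auto
qed

lemmas label_distinct' = label_distinct label_distinct[symmetric]

lemma label_cases: "(x :: 5) = i \<or> x = j \<or> x = k \<or> x = l \<or> x = m"
  using UNIV_labels by blast

text \<open>In the chart, \<open>z1 = br A k j / br A i j\<close> and
  \<open>z4 = br A i k / br A i j\<close>, and similarly for the rows \<open>l\<close> and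
  \<open>m\<close>. Clearing the common denominator and sign turns \<open>(z1 z5 : z2 z4)\<close>
  into this pair, which is polynomial in the frame.\<close>

definition c1v :: "complex^2^5 \<Rightarrow> complex^2" where
  "c1v A = vector [br A j k * br A i l, br A j l * br A i k]"
definition c2v :: "complex^2^5 \<Rightarrow> complex^2" where
  "c2v A = vector [br A j k * br A i m, br A j m * br A i k]"
definition c3v :: "complex^2^5 \<Rightarrow> complex^2" where
  "c3v A = vector [br A j l * br A i m, br A j m * br A i l]"

definition bl_vec :: "complex^2^5 \<Rightarrow> complex^(2 \<times> 2 \<times> 2)" where
  "bl_vec A = drop_one (segre (c1v A) (c2v A) (c3v A))"

definition coords :: "complex^2^5 \<Rightarrow> p1_cubed" where
  "coords A = (line (c1v A), line (c2v A), line (c3v A))"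

definition main :: "(complex^2^5) set" where
  "main = {A. \<forall>a b. a \<noteq> b \<longrightarrow> br A a b \<noteq> 0}"

lemma mainD: "A \<in> main \<Longrightarrow> a \<noteq> b \<Longrightarrow> br A a b \<noteq> 0"
  by (simp add: main_def)

lemma main_frames: "A \<in> main \<Longrightarrow> A \<in> frames"
  using label_distinct mainD frames_iff by blast

lemma main_iff_supp: "A \<in> main \<longleftrightarrow> supp A = pairs"
proof
  assume A: "A \<in> main"
  have "I \<in> supp A" if "I \<in> pairs" for I
    using that A by (elim pairs_cases) (simp add: mainD)
  then show "supp A = pairs" using supp_subset by blast
next
  assume "supp A = pairs"
  then show "A \<in> main" using pair_in_supp[of _ _ A] by (simp add: main_def)
qed

lemma main_scale: "A \<in> main \<Longrightarrow> t \<in> CT5 \<Longrightarrow> scale t A \<in> main"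
  by (simp add: main_def br_scale CT5_def)

lemma chart_coords_colspan:
  assumes "br A i j \<noteq> 0"
  shows "chart_coords i j (colspan A) = coords A"
proof -
  let ?b = "br A i j"
  have z: "hom2 (br A x j * br A i y / (?b * ?b)) (br A y j * br A i x / (?b * ?b)) =
      line (vector [br A j x * br A i y, br A j y * br A i x])" for x y
  proof -
    have v: "(vector [br A x j * br A i y / (?b * ?b), br A y j * br A i x / (?b * ?b)] :: complex^2) =
        (- 1 / ?b\<^sup>2) *s vector [br A j x * br A i y, br A j y * br A i x]"
      using assms by (simp add: vec2_eq_iff br_swap[of A x j] br_swap[of A y j] power2_eq_square)
    have "- 1 / ?b\<^sup>2 \<noteq> 0" using assms by simp
    then show ?thesis unfolding hom2_def v by (rule line_scale)
  qed
  show ?thesis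
    by (simp add: chart_coords_def chart_matrix_colspan[OF assms] klm z coords_def c1v_def c2v_def c3v_def)
qed

lemma coords_scale: 
  assumes "t \<in> CT5"
  shows "coords (scale t A) = coords A"
proof -
  have "c1v (scale t A) = (t $ i * t $ j * t $ k * t $ l) *s c1v A"
    "c2v (scale t A) = (t $ i * t $ j * t $ k * t $ m) *s c2v A"
    "c3v (scale t A) = (t $ i * t $ j * t $ l * t $ m) *s c3v A"
    by (simp_all add: vec2_eq_iff c1v_def c2v_def c3v_def br_scale)
  then show ?thesis using assms by (simp add: coords_def line_scale CT5_def)
qed

text \<open>Pluecker relations. They bring in the brackets of \<open>k\<close>, \<open>l\<close>,
  \<open>m\<close> among themselves, which the coordinates do not mention: where
  \<open>br A i j\<close> is nonzero, a coordinate equals \<open>(1:1)\<close> exactly when two of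
  these rows are parallel.\<close>

lemma cross_ratio_diff:
  "br A j k * br A i l - br A j l * br A i k = - (br A i j * br A k l)"
  "br A j k * br A i m - br A j m * br A i k = - (br A i j * br A k m)"
  "br A j l * br A i m - br A j m * br A i l = - (br A i j * br A l m)"
  unfolding br_def by (simp_all add: algebra_simps)

lemma main_c_nonzero:
  assumes "A \<in> main"
  shows "c1v A $ 1 \<noteq> 0" "c1v A $ 2 \<noteq> 0" "c2v A $ 1 \<noteq> 0" "c2v A $ 2 \<noteq> 0" "c3v A $ 1 \<noteq> 0" "c3v A $ 2 \<noteq> 0"
    "c1v A $ 1 \<noteq> c1v A $ 2" "c2v A $ 1 \<noteq> c2v A $ 2" "c3v A $ 1 \<noteq> c3v A $ 2"
    "c1v A \<noteq> 0" "c2v A \<noteq> 0" "c3v A \<noteq> 0" "bl_vec A \<noteq> 0"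
proof -
  show *: "c1v A $ 1 \<noteq> 0" "c1v A $ 2 \<noteq> 0" "c2v A $ 1 \<noteq> 0" "c2v A $ 2 \<noteq> 0" "c3v A $ 1 \<noteq> 0" "c3v A $ 2 \<noteq> 0"
    using mainD[OF assms] label_distinct by (simp_all add: c1v_def c2v_def c3v_def)
  show **: "c1v A $ 1 \<noteq> c1v A $ 2" "c2v A $ 1 \<noteq> c2v A $ 2" "c3v A $ 1 \<noteq> c3v A $ 2"
    using mainD[OF assms] label_distinct cross_ratio_diff[of A] by (auto simp: c1v_def c2v_def c3v_def)
  show "c1v A \<noteq> 0" "c2v A \<noteq> 0" "c3v A \<noteq> 0" using * by auto
  have "bl_vec A $ (1, 2, 2) = (c1v A $ 1 - c1v A $ 2) * c2v A $ 2 * c3v A $ 2"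
    by (simp add: bl_vec_def drop_one_def segre_def algebra_simps)
  then have "bl_vec A $ (1, 2, 2) \<noteq> 0" using * ** by simp
  then show "bl_vec A \<noteq> 0" by auto
qed

lemma c_relation: "c1v A $ 1 * c2v A $ 2 * c3v A $ 1 = c1v A $ 2 * c2v A $ 1 * c3v A $ 2"
  by (simp add: c1v_def c2v_def c3v_def)

lemma coords_in_F_coord:
  assumes "A \<in> main"
  shows "coords A \<in> F_coord"
proof -
  have "hom2 (v $ 1) (v $ 2) = line v" for v
    unfolding hom2_def by (rule arg_cong[of _ _ line]) (simp add: vec2_eq_iff)
  then have "coords A = (hom2 (c1v A $ 1) (c1v A $ 2), hom2 (c2v A $ 1) (c2v A $ 2), hom2 (c3v A $ 1) (c3v A $ 2))"
    by (simp add: coords_def)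
  then show ?thesis
    unfolding F_coord_def using main_c_nonzero(1-9)[OF assms] c_relation[of A]
    by (intro CollectI exI conjI)
qed

lemma F_coord_obtain_main:
  assumes "q \<in> F_coord"
  obtains A where "A \<in> main" "coords A = q"
proof -
  obtain c1 c1' c2 c2' c3 c3' where q: "q = (hom2 c1 c1', hom2 c2 c2', hom2 c3 c3')"
    and nz: "c1 \<noteq> 0" "c1' \<noteq> 0" "c2 \<noteq> 0" "c2' \<noteq> 0" "c3 \<noteq> 0" "c3' \<noteq> 0" "c1 \<noteq> c1'" "c2 \<noteq> c2'" "c3 \<noteq> c3'"
    and rel: "c1 * c2' * c3 = c1' * c2 * c3'"
    using assms unfolding F_coord_def by blast
  \<comment> \<open>The torus can normalize row \<open>k\<close> to \<open>(1, 1)\<close>. The rows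
    \<open>l\<close> and \<open>m\<close> then encode the first two coordinates, and the relation
    determines the third.\<close>
  define A :: "complex^2^5" where "A = (\<chi> x. if x = i then vector [1, 0] else if x = j then vector [0, 1]
    else if x = k then vector [1, 1] else if x = l then vector [c1', c1] else vector [c2', c2])"
  have Ax: "A $ i $ 1 = 1" "A $ i $ 2 = 0" "A $ j $ 1 = 0" "A $ j $ 2 = 1" "A $ k $ 1 = 1" "A $ k $ 2 = 1"
    "A $ l $ 1 = c1'" "A $ l $ 2 = c1" "A $ m $ 1 = c2'" "A $ m $ 2 = c2"
    using label_distinct' by (simp_all add: A_def)
  \<comment> \<open>It is \<open>c3 \<noteq> c3'\<close> that keeps the rows \<open>l\<close> and
    \<open>m\<close> independent.\<close>
  have lm: "c1' * c2 \<noteq> c1 * c2'"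
  proof
    assume "c1' * c2 = c1 * c2'"
    with rel have "(c1 * c2') * c3 = (c1 * c2') * c3'" by simp
    then show False using nz by simp
  qed
  have up: "br A i j \<noteq> 0" "br A i k \<noteq> 0" "br A i l \<noteq> 0" "br A i m \<noteq> 0" "br A j k \<noteq> 0" "br A j l \<noteq> 0"
    "br A j m \<noteq> 0" "br A k l \<noteq> 0" "br A k m \<noteq> 0" "br A l m \<noteq> 0"
    using nz lm by (auto simp: br_def Ax mult.commute)
  have A: "A \<in> main"
    unfolding main_def
  proof (intro CollectI allI impI)
    fix a b :: 5 assume "a \<noteq> b"
    then show "br A a b \<noteq> 0"
      using label_cases[of a] label_cases[of b] up by (elim disjE) (simp_all add: br_swap[of A j i] br_swap[of A k i]
        br_swap[of A l i] br_swap[of A m i] br_swap[of A k j] br_swap[of A l j] br_swap[of A m j]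
        br_swap[of A l k] br_swap[of A m k] br_swap[of A m l])
  qed
  have "line (c1v A) = hom2 c1 c1'" "line (c2v A) = hom2 c2 c2'" "line (c3v A) = hom2 c3 c3'"
    unfolding hom2_def using nz rel main_c_nonzero(10-12)[OF A]
    by (intro line2_eqI; simp add: c1v_def c2v_def c3v_def br_def Ax vec2_eq_iff mult_ac)+
  then show thesis using that A q by (simp add: coords_def)
qed

text \<open>The three coordinates are the cross ratios of \<open>i\<close>, \<open>j\<close> with
  two of the other rows, which is exactly the data that \<open>same_CT_orbit\<close> compares for
  the base pair \<open>i\<close>, \<open>j\<close>.\<close>

lemma coords_eq_imp_same_CT_orbit:
  assumes A: "A \<in> main" and B: "B \<in> main" and eq: "coords A = coords B"
  shows "CT_orbit (colspan A) = CT_orbit (colspan B)"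
proof -
  note nA = mainD[OF A] and nB = mainD[OF B]
  have e: "c1v A $ 1 * c1v B $ 2 = c1v A $ 2 * c1v B $ 1" "c2v A $ 1 * c2v B $ 2 = c2v A $ 2 * c2v B $ 1"
    "c3v A $ 1 * c3v B $ 2 = c3v A $ 2 * c3v B $ 1"
    using eq main_c_nonzero[OF A] by (auto simp: coords_def intro!: line2_eqD)
  define P where "P c d \<longleftrightarrow> br A c j * br A i d * (br B d j * br B i c) = br A d j * br A i c * (br B c j * br B i d)"
    for c d
  have sym: "P d c" if "P c d" for c d using that by (simp add: P_def mult_ac)
  have kl: "P k l" "P k m" "P l m"
    using e by (simp_all add: P_def c1v_def c2v_def c3v_def br_swap[of _ k j] br_swap[of _ l j] br_swap[of _ m j] mult_ac)
  have triv: "P c c" "P i c" "P j c" for c by (simp_all add: P_def)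
  have "P c d" for c d
    using label_cases[of c] label_cases[of d] kl triv sym by metis
  moreover have "br A x y = 0 \<longleftrightarrow> br B x y = 0" for x y
    using nA[of x y] nB[of x y] by (cases "x = y") auto
  ultimately obtain t where "t \<in> CT5" "colspan B = act t (colspan A)"
    using same_CT_orbit[of A i j B] nA nB label_distinct(1) unfolding P_def by blast
  then show ?thesis by (simp add: CT_orbit_act)
qed

lemma f_chart_coords:
  assumes A: "A \<in> main"
  shows "f_chart i j (coords A) = CT_orbit (colspan A)"
proof -
  let ?f = "\<lambda>Y. the_elem (chart_coords i j ` Y)"
  have f: "?f (CT_orbit (colspan B)) = coords B" if B: "B \<in> main" for B
  proof -
    have "chart_coords i j L = coords B" if "L \<in> CT_orbit (colspan B)" for L
    proof -
      obtain t where t: "t \<in> CT5" "L = colspan (scale t B)"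
        using \<open>L \<in> _\<close> by (auto simp: CT_orbit_def act_colspan)
      then show ?thesis
        using chart_coords_colspan[of "scale t B"] coords_scale main_scale[OF B] mainD label_distinct(1) by metis
    qed
    then have "chart_coords i j ` CT_orbit (colspan B) = (\<lambda>L. coords B) ` CT_orbit (colspan B)"
      by (rule image_cong[OF refl])
    also have "\<dots> = {coords B}" using CT_orbit_self[of "colspan B"] by (simp add: image_constant)
    finally show ?thesis by simp
  qed
  have Y: "\<exists>B\<in>main. Y = CT_orbit (colspan B)" if "Y \<in> F_space pairs" for Y
    using that by (auto simp: F_space_def main_iff_supp elim!: stratum_obtain_frame)
  have "inj_on ?f (F_space pairs)"
  proof (rule inj_onI)
    fix Y Y' assume h: "Y \<in> F_space pairs" "Y' \<in> F_space pairs" "?f Y = ?f Y'"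
    obtain B B' where "B \<in> main" "Y = CT_orbit (colspan B)" "B' \<in> main" "Y' = CT_orbit (colspan B')"
      using Y h by blast
    then show "Y = Y'" using h(3) f coords_eq_imp_same_CT_orbit by metis
  qed
  moreover have "CT_orbit (colspan A) \<in> F_space pairs"
    using A main_frames[OF A] stratum_iff[of A pairs] by (auto simp: F_space_def main_iff_supp)
  ultimately show ?thesis
    unfolding f_chart_def using the_inv_into_f_f[of ?f "F_space pairs"] f[OF A] by metis
qed

lemma bl_incl_coords: "bl_incl (coords A) = (coords A, line (bl_vec A))"
  by (simp add: bl_incl_def coords_def proj_from_one_lines bl_vec_def)

lemma coords_ne_pt_one: "A \<in> main \<Longrightarrow> coords A \<noteq> pt_one"
  using line2_eqD[of "c1v A" "vector [1, 1]"] main_c_nonzero[of A]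
  by (auto simp: coords_def pt_one_def hom2_def)

lemma F_coord_subset_calF: "F_coord \<subseteq> calF"
  unfolding F_coord_def calF_def by blast

end

lemma chart_labels_exist:
  assumes "i < j"
  obtains k l m where "chart_labels i j k l m"
proof -
  have "card (UNIV - {i, j}) = 3" using assms by (simp add: card_Diff_subset)
  then have "length (sorted_list_of_set (UNIV - {i, j})) = Suc (Suc (Suc 0))"
    by (simp only: length_sorted_list_of_set numeral_3_eq_3)
  then obtain k l m where "sorted_list_of_set (UNIV - {i, j}) = [k, l, m]"
    unfolding length_Suc_conv length_0_conv by blast
  then show thesis using that assms by (auto simp: chart_labels_def)
qed

section \<open>The graph closure\<close>

lemma exists_unit_scale:
  assumes "(v :: complex^'n) \<noteq> 0"
  obtains c where "c \<noteq> 0" "norm (c *s v) = 1"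
proof -
  have "complex_of_real (inverse (norm v)) *s v = inverse (norm v) *\<^sub>R v"
    unfolding vec_eq_iff vector_smult_component vector_scaleR_component
    by (simp only: scaleR_conv_of_real simp_thms)
  then show thesis using assms by (intro that[of "complex_of_real (inverse (norm v))"]) auto
qed

definition ambient :: "(bl_point \<times> (complex^5) set set) topology" where
  "ambient = prod_topology (prod_topology p1_cubed_top proj_top) GT_top"

type_synonym parameter = "(complex^2) \<times> (complex^2) \<times> (complex^2) \<times> (complex^(2 \<times> 2 \<times> 2)) \<times> (complex^2^5)"

fun realize :: "parameter \<Rightarrow> bl_point \<times> (complex^5) set set" where
  "realize (u, v, w, t, A) = (((line u, line v, line w), line t), orb A)"

text \<open>A compact set in a Euclidean space that \<open>realize\<close> maps continuously to
  \<open>ambient\<close>; in it, closure points are limits of sequences.\<close>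

definition unit_parameters :: "parameter set" where
  "unit_parameters = sphere 0 1 \<times> sphere 0 1 \<times> sphere 0 1 \<times> sphere 0 1 \<times> normal_frames"

lemma compact_unit_parameters: "compact unit_parameters"
  unfolding unit_parameters_def by (intro compact_Times compact_sphere compact_normal_frames)

lemma Hausdorff_space_ambient: "Hausdorff_space ambient"
  unfolding ambient_def
  by (simp add: Hausdorff_space_prod_topology Hausdorff_space_p1_cubed Hausdorff_space_proj_top Hausdorff_space_GT)

lemma topspace_ambient: "topspace ambient =
    ((line ` (- {0}) \<times> line ` (- {0}) \<times> line ` (- {0})) \<times> line ` (- {0})) \<times> GT"
  by (simp add: ambient_def p1_cubed_top_def)

lemma continuous_map_line_comp:
  assumes "continuous_on S f" "\<And>x. x \<in> S \<Longrightarrow> f x \<noteq> 0"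
  shows "continuous_map (top_of_set S) proj_top (\<lambda>x. line (f x))"
proof -
  have "continuous_map (top_of_set S) (top_of_set (- {0})) f"
    using assms by auto
  from continuous_map_compose[OF this continuous_map_line] show ?thesis by (simp add: comp_def)
qed

lemma continuous_map_realize: "continuous_map (top_of_set unit_parameters) ambient realize"
proof -
  let ?T = "top_of_set unit_parameters"
  have sub: "x \<in> unit_parameters \<Longrightarrow> snd (snd (snd (snd x))) \<in> frames" for x
    using normal_frames_subset by (auto simp: unit_parameters_def)
  have nz: "fst x \<noteq> 0" "fst (snd x) \<noteq> 0" "fst (snd (snd x)) \<noteq> 0" "fst (snd (snd (snd x))) \<noteq> 0"
    if "x \<in> unit_parameters" for x
    using that by (auto simp: unit_parameters_def)
  have "continuous_map ?T (top_of_set frames) (\<lambda>x. snd (snd (snd (snd x))))"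
    using sub by (auto intro!: continuous_intros)
  from continuous_map_compose[OF this continuous_map_orb]
  have "continuous_map ?T GT_top (\<lambda>x. orb (snd (snd (snd (snd x)))))" by (simp add: comp_def)
  then have "continuous_map ?T ambient (\<lambda>x. (((line (fst x), line (fst (snd x)), line (fst (snd (snd x)))),
      line (fst (snd (snd (snd x))))), orb (snd (snd (snd (snd x))))))"
    unfolding ambient_def p1_cubed_top_def
    by (intro continuous_map_pairedI continuous_map_line_comp continuous_intros) (auto simp: nz)
  moreover have "realize = (\<lambda>x. (((line (fst x), line (fst (snd x)), line (fst (snd (snd x)))),
      line (fst (snd (snd (snd x))))), orb (snd (snd (snd (snd x))))))"
    by (rule ext) auto
  ultimately show ?thesis by simp
qed

context chart_labels
begin

definition main_parameters :: "parameter set" where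
  "main_parameters = {(u, v, w, t, A). (u, v, w, t, A) \<in> unit_parameters \<and> A \<in> main \<and>
     (\<exists>a b c d. a \<noteq> 0 \<and> b \<noteq> 0 \<and> c \<noteq> 0 \<and> d \<noteq> 0 \<and>
        u = a *s c1v A \<and> v = b *s c2v A \<and> w = c *s c3v A \<and> t = d *s bl_vec A)}"

text \<open>By \<open>closedin_Gamma\<close>, \<open>Gamma_main\<close> and
  \<open>Gamma_minimal\<close> this is the closure in \<open>ambient\<close> of the pairs from the
  main stratum; the present form adds compactness and access by sequences.\<close>

definition Gamma :: "(bl_point \<times> (complex^5) set set) set" where
  "Gamma = realize ` closure main_parameters"

lemma main_parameters_subset: "main_parameters \<subseteq> unit_parameters"
  by (auto simp: main_parameters_def)

lemma closure_main_parameters_subset: "closure main_parameters \<subseteq> unit_parameters"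
  by (intro closure_minimal main_parameters_subset compact_imp_closed compact_unit_parameters)

lemma realize_main_parameters: "realize ` main_parameters = (\<lambda>A. (bl_incl (coords A), orb A)) ` main"
proof (intro subset_antisym subsetI)
  fix p assume "p \<in> realize ` main_parameters"
  then obtain a b c d A where h: "a \<noteq> 0" "b \<noteq> 0" "c \<noteq> 0" "d \<noteq> 0" "A \<in> main"
    "p = realize (a *s c1v A, b *s c2v A, c *s c3v A, d *s bl_vec A, A)"
    unfolding main_parameters_def by blast
  then show "p \<in> (\<lambda>A. (bl_incl (coords A), orb A)) ` main"
    by (intro image_eqI[of _ _ A]) (simp_all add: line_scale bl_incl_coords, simp add: coords_def)
next
  fix p assume "p \<in> (\<lambda>A. (bl_incl (coords A), orb A)) ` main"
  then obtain B where B: "B \<in> main" "p = (bl_incl (coords B), orb B)" by blast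
  obtain A where A: "A \<in> normal_frames" "colspan A = colspan B"
    using normal_frame_exists[OF main_frames[OF B(1)]] .
  obtain e where e: "e \<noteq> 0" "\<And>a b. br A a b = e * br B a b"
    using br_colspan_eq[OF A(2)[symmetric] main_frames[OF B(1)]] by blast
  have Am: "A \<in> main" using B(1) e by (simp add: main_def)
  have "coords A = coords B"
    using chart_coords_colspan mainD[OF Am label_distinct(1)] mainD[OF B(1) label_distinct(1)] A(2) by metis
  then have p: "p = (bl_incl (coords A), orb A)" using A(2) B(2) by (simp add: orb_def)
  obtain a where a: "a \<noteq> 0" "norm (a *s c1v A) = 1" using exists_unit_scale main_c_nonzero(10)[OF Am] .
  obtain b where b: "b \<noteq> 0" "norm (b *s c2v A) = 1" using exists_unit_scale main_c_nonzero(11)[OF Am] .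
  obtain c where c: "c \<noteq> 0" "norm (c *s c3v A) = 1" using exists_unit_scale main_c_nonzero(12)[OF Am] .
  obtain d where d: "d \<noteq> 0" "norm (d *s bl_vec A) = 1" using exists_unit_scale main_c_nonzero(13)[OF Am] .
  have "(a *s c1v A, b *s c2v A, c *s c3v A, d *s bl_vec A, A) \<in> main_parameters"
    unfolding main_parameters_def unit_parameters_def using a b c d A(1) Am by auto
  moreover have "p = realize (a *s c1v A, b *s c2v A, c *s c3v A, d *s bl_vec A, A)"
    using a b c d by (simp add: p line_scale bl_incl_coords) (simp add: coords_def)
  ultimately show "p \<in> realize ` main_parameters" by blast
qed

lemma compactin_Gamma: "compactin ambient Gamma"
proof -
  have "compact (unit_parameters \<inter> closure main_parameters)"
    using compact_unit_parameters closed_closure by (rule compact_Int_closed)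
  then have "compact (closure main_parameters)"
    using closure_main_parameters_subset by (simp only: Int_absorb1)
  then have "compactin (top_of_set unit_parameters) (closure main_parameters)"
    using closure_main_parameters_subset by (simp add: compactin_subtopology)
  then show ?thesis unfolding Gamma_def using continuous_map_realize by (rule image_compactin)
qed

lemma closedin_Gamma: "closedin ambient Gamma"
  using compactin_imp_closedin Hausdorff_space_ambient compactin_Gamma .

lemma Gamma_main: "A \<in> main \<Longrightarrow> (bl_incl (coords A), orb A) \<in> Gamma"
  using realize_main_parameters closure_subset unfolding Gamma_def by blast

text \<open>The universal property of a closure, by which closed conditions on \<open>Gamma\<close>
  are checked on main-stratum frames only.\<close>

lemma Gamma_minimal:
  assumes D: "closedin ambient D" and main: "\<And>A. A \<in> main \<Longrightarrow> (bl_incl (coords A), orb A) \<in> D"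
  shows "Gamma \<subseteq> D"
proof -
  have "closedin (top_of_set unit_parameters) {z \<in> unit_parameters. realize z \<in> D}"
    using closedin_continuous_map_preimage[OF continuous_map_realize D] by simp
  then have "closed {z \<in> unit_parameters. realize z \<in> D}"
    by (rule closedin_closed_trans) (intro compact_imp_closed compact_unit_parameters)
  moreover have "realize ` main_parameters \<subseteq> D"
    unfolding realize_main_parameters using main by (rule image_subsetI)
  then have "main_parameters \<subseteq> {z \<in> unit_parameters. realize z \<in> D}"
    using main_parameters_subset by auto
  ultimately have "closure main_parameters \<subseteq> {z \<in> unit_parameters. realize z \<in> D}"
    by (rule closure_minimal[rotated])
  then show ?thesis by (auto simp: Gamma_def)
qed

lemma Gamma_subset: "Gamma \<subseteq> topspace ambient"
  using compactin_Gamma compactin_subset_topspace by blast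

lemma bl_incl_coords_in_Ftilde:
  assumes "A \<in> main"
  shows "bl_incl (coords A) \<in> Ftilde"
proof -
  have "bl_incl (coords A) \<in> topspace (prod_topology p1_cubed_top proj_top)"
    using Gamma_main[OF assms] Gamma_subset by (auto simp: ambient_def)
  moreover have "coords A \<in> calF - {pt_one}"
    using coords_in_F_coord[OF assms] coords_ne_pt_one[OF assms] F_coord_subset_calF by blast
  ultimately show ?thesis
    unfolding Ftilde_def by (intro subsetD[OF closure_of_subset_Int] IntI imageI)
qed

lemma Gamma_Ftilde: "(c, y) \<in> Gamma \<Longrightarrow> c \<in> Ftilde"
proof -
  assume cy: "(c, y) \<in> Gamma"
  have "closedin (prod_topology p1_cubed_top proj_top) Ftilde"
    unfolding Ftilde_def by (rule closedin_closure_of)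
  then have "closedin ambient (Ftilde \<times> GT)"
    unfolding ambient_def by (metis closedin_prod_Times_iff closedin_topspace topspace_GT_top)
  then have "Gamma \<subseteq> Ftilde \<times> GT"
    by (rule Gamma_minimal) (simp add: bl_incl_coords_in_Ftilde main_frames)
  with cy show ?thesis by blast
qed

lemma Gamma_GT: "(c, y) \<in> Gamma \<Longrightarrow> y \<in> GT"
  using Gamma_subset by (auto simp: topspace_ambient)

lemma approximating_sequence_main:
  assumes x: "x \<in> rel_interior Delta52" and q: "q \<in> F_coord"
  obtains A where "A \<in> main" "coords A = q" "h_inv pairs (x, f_chart i j q) = orb A"
proof -
  obtain B where B: "B \<in> main" "coords B = q" using q by (rule F_coord_obtain_main)
  have "x \<in> rel_interior (poly_of (supp B))" using x B(1) by (simp add: main_iff_supp Delta52_eq)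
  then obtain t where t: "t \<in> CT5" "moment (act t (colspan B)) = x"
    using moment_onto_rel_interior[OF main_frames[OF B(1)]] by blast
  have A: "scale t B \<in> main" using main_scale B t by blast
  have "orb (scale t B) \<in> stratum_T pairs"
    using A main_iff_supp by (simp add: orb_in_stratum_T_iff main_frames)
  then have "h_inv pairs (moment_hat (orb (scale t B)), p_map (orb (scale t B))) = orb (scale t B)"
    by (rule h_inv_eq)
  moreover have "moment_hat (orb (scale t B)) = x"
    using t by (simp add: moment_hat_orb main_frames A act_colspan)
  moreover have "p_map (orb (scale t B)) = f_chart i j q"
    using t B f_chart_coords[OF B(1)] by (simp add: p_map_orb CT_orbit_act flip: act_colspan)
  ultimately show thesis using that[OF A] B t coords_scale by simp
qed

text \<open>Forward, the closed set \<open>Gamma\<close> contains the limit of the pairs. Backward,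
  a point in the closure of \<open>main_parameters\<close> is the limit of a sequence from it, whose
  image under \<open>realize\<close> yields the moments and coordinates of an approximating
  sequence.\<close>

lemma approximates_iff: "approximates \<sigma> i j c y \<longleftrightarrow> y \<in> stratum_T \<sigma> \<and> (c, y) \<in> Gamma"
proof
  assume ap: "approximates \<sigma> i j c y"
  then obtain x q where xq: "\<And>n. x n \<in> rel_interior Delta52" "\<And>n. q n \<in> F_coord"
    "limitin Ftilde_top (\<lambda>n. bl_incl (q n)) c sequentially"
    "limitin GT_top (\<lambda>n. h_inv pairs (x n, f_chart i j (q n))) y sequentially"
    unfolding approximates_def by blast
  have "\<forall>n. \<exists>A. A \<in> main \<and> coords A = q n \<and> h_inv pairs (x n, f_chart i j (q n)) = orb A"
    using approximating_sequence_main xq(1,2) by metis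
  then obtain A where A: "\<And>n. A n \<in> main" "\<And>n. coords (A n) = q n"
    "\<And>n. h_inv pairs (x n, f_chart i j (q n)) = orb (A n)" by metis
  have "limitin (prod_topology p1_cubed_top proj_top) (\<lambda>n. bl_incl (coords (A n))) c sequentially"
    using xq(3) by (simp add: Ftilde_top_def limitin_subtopology A)
  moreover have "limitin GT_top (\<lambda>n. orb (A n)) y sequentially" using xq(4) by (simp add: A)
  ultimately have "limitin ambient (\<lambda>n. (bl_incl (coords (A n)), orb (A n))) (c, y) sequentially"
    by (simp add: ambient_def limitin_pairwise comp_def)
  then have "(c, y) \<in> Gamma"
    by (rule limitin_closedin) (use closedin_Gamma Gamma_main A(1) in auto)
  then show "y \<in> stratum_T \<sigma> \<and> (c, y) \<in> Gamma" using ap by (simp add: approximates_def)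
next
  assume h: "y \<in> stratum_T \<sigma> \<and> (c, y) \<in> Gamma"
  then obtain z where z: "z \<in> closure main_parameters" "(c, y) = realize z" by (auto simp: Gamma_def)
  then obtain f where f: "\<And>n. f n \<in> main_parameters" "f \<longlonglongrightarrow> z"
    unfolding closure_sequential by blast
  have "limitin (top_of_set unit_parameters) f z sequentially"
    using f z main_parameters_subset closure_main_parameters_subset
    by (auto simp: limitin_subtopology intro!: always_eventually)
  from continuous_map_limit[OF continuous_map_realize this]
  have lim: "limitin ambient (realize \<circ> f) (c, y) sequentially" using z(2) by simp
  have "\<forall>n. \<exists>A. A \<in> main \<and> realize (f n) = (bl_incl (coords A), orb A)"
    using realize_main_parameters f(1) by blast
  then obtain A where A: "\<And>n. A n \<in> main" "\<And>n. realize (f n) = (bl_incl (coords (A n)), orb (A n))" by metis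
  have lim2: "limitin (prod_topology p1_cubed_top proj_top) (\<lambda>n. bl_incl (coords (A n))) c sequentially"
    "limitin GT_top (\<lambda>n. orb (A n)) y sequentially"
    using lim by (simp_all add: ambient_def limitin_pairwise comp_def A)
  have "limitin Ftilde_top (\<lambda>n. bl_incl (coords (A n))) c sequentially"
    using lim2(1) Gamma_Ftilde[of c y] h bl_incl_coords_in_Ftilde[OF A(1)]
    by (simp add: Ftilde_top_def limitin_subtopology)
  moreover have "h_inv pairs (moment_hat (orb (A n)), f_chart i j (coords (A n))) = orb (A n)" for n
    using h_inv_eq[of "orb (A n)" pairs] A(1)[of n] main_iff_supp[of "A n"]
    by (simp add: orb_in_stratum_T_iff main_frames f_chart_coords p_map_orb)
  moreover have "moment_hat (orb (A n)) \<in> rel_interior Delta52" for n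
    using moment_in_rel_interior[OF main_frames[OF A(1)[of n]]] A(1)[of n] main_iff_supp
    by (simp add: moment_hat_orb main_frames Delta52_eq)
  ultimately show "approximates \<sigma> i j c y"
    unfolding approximates_def using h lim2(2) coords_in_F_coord[OF A(1)]
    by (intro conjI exI[of _ "\<lambda>n. moment_hat (orb (A n))"] exI[of _ "\<lambda>n. coords (A n)"]) auto
qed

text \<open>Scaling preserves the main stratum and its coordinates, so the preimage of
  \<open>Gamma\<close> under the action is closed and contains all main-stratum pairs.\<close>

lemma Gamma_act:
  assumes t: "t \<in> CT5" and cy: "(c, y) \<in> Gamma"
  shows "(c, act t ` y) \<in> Gamma"
proof -
  have "continuous_map ambient ambient (\<lambda>p. (fst p, act t ` snd p))"
    unfolding ambient_def
    using continuous_map_compose[OF continuous_map_snd continuous_map_act(1)[OF t], unfolded comp_def]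
    by (intro continuous_map_pairedI continuous_map_fst) auto
  then have "closedin ambient {p \<in> topspace ambient. (fst p, act t ` snd p) \<in> Gamma}"
    using closedin_Gamma by (rule closedin_continuous_map_preimage)
  moreover have "(bl_incl (coords A), orb A) \<in> {p \<in> topspace ambient. (fst p, act t ` snd p) \<in> Gamma}"
    if "A \<in> main" for A
    using Gamma_main[OF main_scale[OF that t]] Gamma_main[OF that] Gamma_subset
    by (auto simp: coords_scale[OF t] continuous_map_act(2)[OF t])
  ultimately have "Gamma \<subseteq> {p \<in> topspace ambient. (fst p, act t ` snd p) \<in> Gamma}"
    by (rule Gamma_minimal)
  from subsetD[OF this cy] show ?thesis by simp
qed

lemma main_nonempty: "\<exists>M. M \<in> main"
proof -
  obtain f :: "5 \<Rightarrow> nat" where f: "inj f" using finite_imp_inj_to_nat_seg[of "UNIV :: 5 set"] by auto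
  define M :: "complex^2^5" where "M = (\<chi> k. vector [1, of_nat (f k)])"
  have "br M a b = of_nat (f b) - of_nat (f a)" for a b
    by (simp add: br_def M_def)
  then have "M \<in> main" using f by (auto simp: main_def inj_def)
  then show ?thesis by blast
qed

lemma frames_subset_closure_main: "A \<in> closure main"
proof -
  obtain M where M: "M \<in> main" using main_nonempty by blast
  \<comment> \<open>On this line through \<open>A\<close> in the direction of a main-stratum frame
    \<open>M\<close>, each bracket of distinct rows is a quadratic polynomial in \<open>e\<close>
    with leading coefficient \<open>br M a b \<noteq> 0\<close>; hence all but finitely many
    \<open>e\<close> give frames of the main stratum.\<close>
  define f :: "complex \<Rightarrow> complex^2^5" where "f e = (\<chi> k. A $ k + e *s M $ k)" for e
  define B where "B = (\<Union>p\<in>{p. fst p \<noteq> snd p}. {e. br (f e) (fst p) (snd p) = 0})"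
  have "finite {e. br (f e) a b = 0}" if ab: "a \<noteq> b" for a b
  proof -
    let ?p = "[:br A a b, A $ a $ 1 * M $ b $ 2 + M $ a $ 1 * A $ b $ 2 - A $ a $ 2 * M $ b $ 1 - M $ a $ 2 * A $ b $ 1, br M a b:]"
    have "br (f e) a b = poly ?p e" for e
      by (simp add: f_def br_def algebra_simps)
    moreover have "?p \<noteq> 0" using mainD[OF M ab] by simp
    ultimately show ?thesis using poly_roots_finite[of ?p] by simp
  qed
  then have "finite B" unfolding B_def by auto
  then have "closure (- B) = UNIV"
    by (simp add: closure_complement empty_interior_finite)
  have "continuous_on UNIV f"
    unfolding f_def vector_scalar_mult_def by (intro continuous_intros)
  then have "f ` closure (- B) \<subseteq> closure (f ` (- B))"
    by (intro image_closure_subset) (auto intro: continuous_on_subset closure_subset[THEN subsetD])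
  moreover have "f ` (- B) \<subseteq> main"
    by (auto simp: B_def main_def)
  then have "closure (f ` (- B)) \<subseteq> closure main" by (rule closure_mono)
  moreover have "f 0 = A" by (simp add: f_def vec_eq_iff)
  ultimately show ?thesis using \<open>closure (- B) = UNIV\<close> by blast
qed

text \<open>The image of the compact set \<open>Gamma\<close> in the Hausdorff orbit space is
  closed, and it contains the orbits of the main stratum, whose frames are dense.\<close>

lemma Gamma_surj:
  assumes "y \<in> GT"
  shows "\<exists>c. (c, y) \<in> Gamma"
proof -
  have "continuous_map ambient GT_top snd" unfolding ambient_def by (rule continuous_map_snd)
  then have "compactin GT_top (snd ` Gamma)" using compactin_Gamma image_compactin by blast
  then have "closedin GT_top (snd ` Gamma)"
    using compactin_imp_closedin Hausdorff_space_GT by blast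
  then have "closedin (top_of_set frames) {A \<in> frames. orb A \<in> snd ` Gamma}"
    using closedin_continuous_map_preimage[OF continuous_map_orb] by simp
  then obtain C where C: "closed C" "{A \<in> frames. orb A \<in> snd ` Gamma} = frames \<inter> C"
    by (auto simp: closedin_closed)
  have "orb A \<in> snd ` Gamma" if "A \<in> main" for A
    using Gamma_main[OF that] by (metis imageI snd_conv)
  then have "main \<subseteq> C" using C(2) main_frames by blast
  then have "closure main \<subseteq> C" using C(1) by (rule closure_minimal)
  then have "orb A \<in> snd ` Gamma" if "A \<in> frames" for A
    using C(2) that frames_subset_closure_main by blast
  then have "y \<in> snd ` Gamma" using GT_obtain_frame[OF assms] by metis
  then obtain p where "p \<in> Gamma" "y = snd p" by (rule imageE)
  then have "(fst p, y) \<in> Gamma" by simp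
  then show ?thesis by (rule exI)
qed

end

section \<open>Uniqueness over a point of the parameter space\<close>

text \<open>Since \<open>(e1, e2)\<close> is nonzero, \<open>(x1, x2)\<close> and
  \<open>(y1, y2)\<close> both lie on the line of \<open>(e2, e1)\<close>. The factor
  \<open>f\<close> accounts for two different homogeneous representatives of one parameter.\<close>

lemma compat_of_ratios:
  fixes x1 x2 y1 y2 e1 e2 f :: complex
  assumes "x1 * e1 = x2 * e2" "y1 * (f * e1) = y2 * (f * e2)" "f \<noteq> 0" "e1 \<noteq> 0 \<or> e2 \<noteq> 0"
  shows "x1 * y2 = x2 * y1"
proof -
  have y: "y1 * e1 = y2 * e2" using assms(2,3) by (simp add: mult.left_commute[of _ f])
  show ?thesis
  proof (cases "e1 = 0")
    case True
    then show ?thesis using assms(1,4) y by simp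
  next
    case False
    have "e1 * (x1 * y2) = (x1 * e1) * y2" by (simp add: mult_ac)
    also have "\<dots> = x2 * (y2 * e2)" unfolding assms(1) by (simp add: mult_ac)
    also have "\<dots> = e1 * (x2 * y1)" unfolding y[symmetric] by (simp add: mult_ac)
    finally show ?thesis using False by simp
  qed
qed

definition compat_at :: "complex^2^5 \<Rightarrow> complex^2^5 \<Rightarrow> 5 \<Rightarrow> 5 \<Rightarrow> 5 \<Rightarrow> 5 \<Rightarrow> bool" where
  "compat_at A B a b c d \<longleftrightarrow>
     br A a b * br A c d * (br B a c * br B b d) = br A a c * br A b d * (br B a b * br B c d)"

lemma compat_at_swap23: "compat_at A B a b c d \<Longrightarrow> compat_at A B a c b d"
  by (simp add: compat_at_def mult_ac br_swap[of _ c b])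

text \<open>The exchange brings in the third product of complementary brackets, which the Pluecker
  relation expresses linearly through the other two. So one condition per quadruple controls all its
  orderings.\<close>

lemma compat_at_swap12: "compat_at A B a b c d \<Longrightarrow> compat_at A B b a c d"
proof -
  assume h: "compat_at A B a b c d"
  have Z: "br M b c * br M a d = br M a c * br M b d - br M a b * br M c d" for M
    using br_pluecker[of M a b c d] by (simp add: algebra_simps)
  have "br A a b * br A c d * (br B b c * br B a d) = br A b c * br A a d * (br B a b * br B c d)"
    unfolding Z using h by (simp add: compat_at_def algebra_simps)
  then show ?thesis by (simp add: compat_at_def br_swap[of _ b a])
qed

lemma compat_at_swap34: "compat_at A B a b c d \<Longrightarrow> compat_at A B a b d c"
proof -
  assume h: "compat_at A B a b c d"
  have Z: "br M a d * br M b c = br M a c * br M b d - br M a b * br M c d" for M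
    using br_pluecker[of M a b c d] by (simp add: algebra_simps)
  have "br A a b * br A c d * (br B a d * br B b c) = br A a d * br A b c * (br B a b * br B c d)"
    unfolding Z using h by (simp add: compat_at_def algebra_simps)
  then show ?thesis by (simp add: compat_at_def br_swap[of _ d c])
qed

lemma compat_at_degenerate:
  "compat_at A B a a c d" "compat_at A B a b a d" "compat_at A B a b c a" 
  "compat_at A B a b b d" "compat_at A B a b c b" "compat_at A B a b c c"
  by (simp_all add: compat_at_def br_swap[of _ c a] br_swap[of _ b a] mult_ac)

lemma compat_at_perm:
  assumes "compat_at A B a b c d" "distinct [x, y, z, w]" "{x, y, z, w} \<subseteq> {a, b, c, d}"
  shows "compat_at A B x y z w"
proof -
  note s = compat_at_swap12 compat_at_swap23 compat_at_swap34
  have 1: "compat_at A B a b c d" "compat_at A B a b d c" "compat_at A B a c b d" "compat_at A B a c d b"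
      "compat_at A B a d b c" "compat_at A B a d c b"
    if "compat_at A B a b c d" for a b c d
    using that s by metis+
  have 2: "compat_at A B b a c d" "compat_at A B c a b d" "compat_at A B d a b c"
    using assms(1) 1 s(1) by metis+
  \<comment> \<open>Six orderings for each of the four choices of the first row: all 24.\<close>
  note all = 1[OF assms(1)] 1[OF 2(1)] 1[OF 2(2)] 1[OF 2(3)]
  show ?thesis using assms(2,3) all by auto
qed

context chart_labels
begin

lemma compat_from_quadruples:
  assumes "compat_at A B i j k l" "compat_at A B i j k m" "compat_at A B i j l m"
    "compat_at A B j k l m" "compat_at A B i k l m"
  shows "compat A B"
proof -
  have "compat_at A B x y z w" for x y z w
  proof (cases "distinct [x, y, z, w]")
    case True
    obtain e where e: "e \<notin> {x, y, z, w}"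
    proof -
      have "card {x, y, z, w} \<noteq> CARD(5)"
        using card_length[of "[x, y, z, w]"] by simp
      then show thesis using that by (metis UNIV_eq_I)
    qed
    have sub: "{x, y, z, w} \<subseteq> {i, j, k, l, m} - {e}" using e UNIV_labels by blast
    show ?thesis
      using label_cases[of e]
    proof (elim disjE)
      assume "e = i" then show ?thesis using sub by (intro compat_at_perm[OF assms(4) True]) blast
    next
      assume "e = j" then show ?thesis using sub by (intro compat_at_perm[OF assms(5) True]) blast
    next
      assume "e = k" then show ?thesis using sub by (intro compat_at_perm[OF assms(3) True]) blast
    next
      assume "e = l" then show ?thesis using sub by (intro compat_at_perm[OF assms(2) True]) blast
    next
      assume "e = m" then show ?thesis using sub by (intro compat_at_perm[OF assms(1) True]) blast
    qed
  qed (auto simp: compat_at_degenerate)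
  then show ?thesis by (simp add: compat_def compat_at_def)
qed

section \<open>Polynomial relations that persist on the closure\<close>

lemma main_parameters_closed_property:
  assumes "closed {z. P z}"
    and "\<And>a b c d A. A \<in> main \<Longrightarrow> P (a *s c1v A, b *s c2v A, c *s c3v A, d *s bl_vec A, A)"
    and "z \<in> closure main_parameters"
  shows "P z"
proof -
  have "main_parameters \<subseteq> {z. P z}"
    using assms(2) by (auto simp: main_parameters_def)
  then have "closure main_parameters \<subseteq> {z. P z}" using assms(1) by (rule closure_minimal)
  then show ?thesis using assms(3) by blast
qed

text \<open>Each equation ties two products of complementary brackets to a coefficient pair built
  from the parameter: three equations for the quadruples containing \<open>i\<close> and
  \<open>j\<close>, three for \<open>j, k, l, m\<close>, three for \<open>i, k, l, m\<close>. The
  last two quadruples get several pairs because a single pair may vanish. The ninth pair arises from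
  the sixth through the factor \<open>w1 / w2 = u2 v1 / (u1 v2)\<close>.\<close>

definition cross_relations :: "parameter \<Rightarrow> bool" where
  "cross_relations z \<longleftrightarrow> (case z of (u, v, w, t, A) \<Rightarrow>
    br A j l * br A i k * u $ 1 = br A j k * br A i l * u $ 2 \<and>
    br A j m * br A i k * v $ 1 = br A j k * br A i m * v $ 2 \<and>
    br A j m * br A i l * w $ 1 = br A j l * br A i m * w $ 2 \<and>
    br A k l * br A j m * (u $ 2 * (v $ 1 - v $ 2)) = br A j l * br A k m * (v $ 2 * (u $ 1 - u $ 2)) \<and>
    br A k l * br A j m * (u $ 1 * w $ 1 - u $ 2 * w $ 2) = br A j l * br A k m * (w $ 2 * (u $ 1 - u $ 2)) \<and>
    br A k l * br A j m * t $ (2, 1, 2) = br A j l * br A k m * t $ (1, 2, 2) \<and>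
    br A k l * br A i m * (u $ 1 * (v $ 1 - v $ 2)) = br A i l * br A k m * (v $ 1 * (u $ 1 - u $ 2)) \<and>
    br A k l * br A i m * (u $ 1 * w $ 1 - u $ 2 * w $ 2) = br A i l * br A k m * (w $ 1 * (u $ 1 - u $ 2)) \<and>
    br A k l * br A i m * (u $ 1 * v $ 2 * t $ (2, 1, 2)) = br A i l * br A k m * (v $ 1 * u $ 2 * t $ (1, 2, 2)))"

text \<open>Normalized by \<open>c' = 1\<close>, the entries \<open>(1, 2, 2)\<close>,
  \<open>(2, 1, 2)\<close>, \<open>(2, 2, 1)\<close> of \<open>t\<close> are proportional to
  \<open>c1 - 1\<close>, \<open>c2 - 1\<close>, \<open>c3 - 1\<close>. The last relation is the
  surface equation \<open>c2 = c1 * c3\<close> written linearly in them, and over the centre of the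
  blowup it becomes the tangent plane. The other relations express the remaining entries through
  these three.\<close>

definition blowup_relations :: "parameter \<Rightarrow> bool" where
  "blowup_relations z \<longleftrightarrow> (case z of (u, v, w, t, A) \<Rightarrow>
    v $ 2 * t $ (1, 1, 2) = v $ 1 * t $ (1, 2, 2) + v $ 2 * t $ (2, 1, 2) \<and>
    w $ 2 * t $ (1, 2, 1) = w $ 1 * t $ (1, 2, 2) + w $ 2 * t $ (2, 2, 1) \<and>
    w $ 2 * t $ (2, 1, 1) = w $ 1 * t $ (2, 1, 2) + w $ 2 * t $ (2, 2, 1) \<and>
    v $ 2 * w $ 2 * t $ (1, 1, 1) = v $ 1 * w $ 1 * t $ (1, 2, 2) + v $ 2 * w $ 2 * t $ (2, 1, 1) \<and>
    t $ (2, 2, 2) = 0 \<and>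
    w $ 2 * t $ (2, 1, 2) = w $ 1 * t $ (1, 2, 2) + w $ 2 * t $ (2, 2, 1))"

lemma closure_cross_relations:
  assumes "z \<in> closure main_parameters"
  shows "cross_relations z"
proof (rule main_parameters_closed_property[OF _ _ assms])
  show "closed {z. cross_relations z}"
    unfolding cross_relations_def split_def br_def
    by (intro closed_Collect_conj closed_Collect_eq continuous_intros)
next
  fix a b c d :: complex and A
  note D = cross_ratio_diff[of A]
  define ik il im jk jl jm where br: "ik = br A i k" "il = br A i l" "im = br A i m" "jk = br A j k" "jl = br A j l" "jm = br A j m"
  define ij kl km lm where br': "ij = br A i j" "kl = br A k l" "km = br A k m" "lm = br A l m"
  have u: "(a *s c1v A) $ 1 = a * (jk * il)" "(a *s c1v A) $ 2 = a * (jl * ik)"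
    "(a *s c1v A) $ 1 - (a *s c1v A) $ 2 = - (a * (ij * kl))"
    using D(1) by (simp_all add: c1v_def br br' flip: right_diff_distrib)
  have v: "(b *s c2v A) $ 1 = b * (jk * im)" "(b *s c2v A) $ 2 = b * (jm * ik)"
    "(b *s c2v A) $ 1 - (b *s c2v A) $ 2 = - (b * (ij * km))"
    using D(2) by (simp_all add: c2v_def br br' flip: right_diff_distrib)
  have w: "(c *s c3v A) $ 1 = c * (jl * im)" "(c *s c3v A) $ 2 = c * (jm * il)"
    by (simp_all add: c3v_def br br')
  have "(a *s c1v A) $ 1 * (c *s c3v A) $ 1 - (a *s c1v A) $ 2 * (c *s c3v A) $ 2
      = a * c * jl * il * (jk * im - jm * ik)"
    unfolding u w by (simp add: algebra_simps)
  then have uw: "(a *s c1v A) $ 1 * (c *s c3v A) $ 1 - (a *s c1v A) $ 2 * (c *s c3v A) $ 2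
      = - (a * c * jl * il * (ij * km))"
    using D(2) by (simp add: br br')
  have "(d *s bl_vec A) $ (1, 2, 2) = d * ((jk * il - jl * ik) * (jm * ik) * (jm * il))"
    "(d *s bl_vec A) $ (2, 1, 2) = d * ((jl * ik) * (jk * im - jm * ik) * (jm * il))"
    by (simp_all add: bl_vec_def drop_one_def segre_def c1v_def c2v_def c3v_def br left_diff_distrib right_diff_distrib mult_ac)
  then have t: "(d *s bl_vec A) $ (1, 2, 2) = - (d * ((ij * kl) * (jm * ik) * (jm * il)))"
    "(d *s bl_vec A) $ (2, 1, 2) = - (d * ((jl * ik) * (ij * km) * (jm * il)))"
    using D by (simp_all add: br br')
  show "cross_relations (a *s c1v A, b *s c2v A, c *s c3v A, d *s bl_vec A, A)"
    unfolding cross_relations_def prod.case br[symmetric] br'[symmetric]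
    unfolding uw u(3) v(3) t unfolding u(1,2) v(1,2) w
    by (intro conjI) (simp_all add: mult_ac)
qed

lemma closure_blowup_relations:
  assumes "z \<in> closure main_parameters"
  shows "blowup_relations z"
proof (rule main_parameters_closed_property[OF _ _ assms])
  show "closed {z. blowup_relations z}"
    unfolding blowup_relations_def split_def
    by (intro closed_Collect_conj closed_Collect_eq continuous_intros)
next
  fix a b c d :: complex and A
  define p p' q q' r r' where c: "p = c1v A $ 1" "p' = c1v A $ 2" "q = c2v A $ 1" "q' = c2v A $ 2" "r = c3v A $ 1" "r' = c3v A $ 2"
  have rel: "p * q' * r = p' * q * r'" using c_relation[of A] by (simp add: c)
  \<comment> \<open>This prepares the last relation, the one that rests on the surface equation; the
    others are telescoping identities.\<close>
  have "r' * (p' * q * r' - p' * q' * r') = r * (p * q' * r' - p' * q' * r') + r' * (p' * q' * r - p' * q' * r')"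
    using rel by (simp add: algebra_simps)
  then have l: "c * r' * (d * (p' * q * r' - p' * q' * r')) = c * r * (d * (p * q' * r' - p' * q' * r')) + c * r' * (d * (p' * q' * r - p' * q' * r'))"
    by algebra
  have t: "bl_vec A $ (e, f, g) = c1v A $ e * c2v A $ f * c3v A $ g - p' * q' * r'" for e f g
    by (simp add: bl_vec_def drop_one_def segre_def c)
  show "blowup_relations (a *s c1v A, b *s c2v A, c *s c3v A, d *s bl_vec A, A)"
    unfolding blowup_relations_def prod.case vector_smult_component t c[symmetric]
    using l by (intro conjI) (simp_all add: algebra_simps)
qed

text \<open>The coefficient pairs without \<open>t\<close> in the relations for one quadruple of rows all vanish only
  over the point where the three cross ratios are 1; there the pair with \<open>t\<close> does not vanish.\<close>

lemma blowup_coords_nonzero: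
  assumes "blowup_relations (u, v, w, t, A)" and t: "t \<noteq> 0"
    and one: "u $ 1 = u $ 2" "v $ 1 = v $ 2" "w $ 1 = w $ 2" and nz: "v $ 2 \<noteq> 0" "w $ 2 \<noteq> 0"
  shows "t $ (1, 2, 2) \<noteq> 0 \<or> t $ (2, 1, 2) \<noteq> 0"
proof (rule ccontr)
  assume "\<not> ?thesis"
  then have 0: "t $ (1, 2, 2) = 0" "t $ (2, 1, 2) = 0" by auto
  then have "t $ (2, 2, 1) = 0" "t $ (2, 2, 2) = 0" "t $ (1, 1, 2) = 0"
    using assms(1) nz unfolding blowup_relations_def by auto
  moreover from this have "t $ (1, 2, 1) = 0" "t $ (2, 1, 1) = 0"
    using assms(1) nz 0 unfolding blowup_relations_def by auto
  moreover from this have "t $ (1, 1, 1) = 0"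
    using assms(1) nz 0 unfolding blowup_relations_def by auto
  ultimately have "t $ (e, f, g) = 0" for e f g
    using 0 exhaust_2[of e] exhaust_2[of f] exhaust_2[of g] by auto
  then have "t = 0" by (simp add: vec_eq_iff split_paired_all)
  with t show False by simp
qed

lemma closure_compat:
  assumes z: "(u, v, w, t, A) \<in> closure main_parameters" and z': "(u', v', w', t', B) \<in> closure main_parameters"
    and eq: "line u = line u'" "line v = line v'" "line w = line w'" "line t = line t'"
  shows "compat A B"
proof -
  have nz: "u \<noteq> 0" "v \<noteq> 0" "w \<noteq> 0" "t \<noteq> 0" "u' \<noteq> 0" "v' \<noteq> 0" "w' \<noteq> 0" "t' \<noteq> 0"
    using subsetD[OF closure_main_parameters_subset z] subsetD[OF closure_main_parameters_subset z']
    by (auto simp: unit_parameters_def)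
  \<comment> \<open>The two lifts lie over the same lines, so they differ by nonzero factors, and
    the relations for \<open>B\<close> can be read in the coordinates \<open>u, v, w, t\<close> of
    the lift belonging to \<open>A\<close>.\<close>
  obtain a where a: "a \<noteq> 0" "u' = a *s u" using line_eqD[OF eq(1)[symmetric] nz(5)] .
  obtain b where b: "b \<noteq> 0" "v' = b *s v" using line_eqD[OF eq(2)[symmetric] nz(6)] .
  obtain c where c: "c \<noteq> 0" "w' = c *s w" using line_eqD[OF eq(3)[symmetric] nz(7)] .
  obtain d where d: "d \<noteq> 0" "t' = d *s t" using line_eqD[OF eq(4)[symmetric] nz(8)] .
  have R: "cross_relations (u, v, w, t, A)" "cross_relations (a *s u, b *s v, c *s w, d *s t, B)"
    "blowup_relations (u, v, w, t, A)"
    using closure_cross_relations[OF z] closure_cross_relations[OF z'] closure_blowup_relations[OF z]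
    by (simp_all add: a b c d)
  note RA = R(1)[unfolded cross_relations_def prod.case vector_smult_component]
  note RB = R(2)[unfolded cross_relations_def prod.case vector_smult_component]
  note rA = RA[THEN conjunct1]
    RA[THEN conjunct2, THEN conjunct1]
    RA[THEN conjunct2, THEN conjunct2, THEN conjunct1]
    RA[THEN conjunct2, THEN conjunct2, THEN conjunct2, THEN conjunct1]
    RA[THEN conjunct2, THEN conjunct2, THEN conjunct2, THEN conjunct2, THEN conjunct1]
    RA[THEN conjunct2, THEN conjunct2, THEN conjunct2, THEN conjunct2, THEN conjunct2, THEN conjunct1]
    RA[THEN conjunct2, THEN conjunct2, THEN conjunct2, THEN conjunct2, THEN conjunct2, THEN conjunct2, THEN conjunct1]
    RA[THEN conjunct2, THEN conjunct2, THEN conjunct2, THEN conjunct2, THEN conjunct2, THEN conjunct2, THEN conjunct2, THEN conjunct1]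
    RA[THEN conjunct2, THEN conjunct2, THEN conjunct2, THEN conjunct2, THEN conjunct2, THEN conjunct2, THEN conjunct2, THEN conjunct2]
  note rB = RB[THEN conjunct1]
    RB[THEN conjunct2, THEN conjunct1]
    RB[THEN conjunct2, THEN conjunct2, THEN conjunct1]
    RB[THEN conjunct2, THEN conjunct2, THEN conjunct2, THEN conjunct1]
    RB[THEN conjunct2, THEN conjunct2, THEN conjunct2, THEN conjunct2, THEN conjunct1]
    RB[THEN conjunct2, THEN conjunct2, THEN conjunct2, THEN conjunct2, THEN conjunct2, THEN conjunct1]
    RB[THEN conjunct2, THEN conjunct2, THEN conjunct2, THEN conjunct2, THEN conjunct2, THEN conjunct2, THEN conjunct1]
    RB[THEN conjunct2, THEN conjunct2, THEN conjunct2, THEN conjunct2, THEN conjunct2, THEN conjunct2, THEN conjunct2, THEN conjunct1]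
    RB[THEN conjunct2, THEN conjunct2, THEN conjunct2, THEN conjunct2, THEN conjunct2, THEN conjunct2, THEN conjunct2, THEN conjunct2]
  have n2: "u $ 1 \<noteq> 0 \<or> u $ 2 \<noteq> 0" "v $ 1 \<noteq> 0 \<or> v $ 2 \<noteq> 0" "w $ 1 \<noteq> 0 \<or> w $ 2 \<noteq> 0"
    using nz by (auto simp: vec2_eq_iff)
  have ijkl: "br A j l * br A i k * (br B j k * br B i l) = br A j k * br A i l * (br B j l * br B i k)"
    by (rule compat_of_ratios[OF rA(1) _ a(1) n2(1)]) (rule rB(1))
  have ijkm: "br A j m * br A i k * (br B j k * br B i m) = br A j k * br A i m * (br B j m * br B i k)"
    by (rule compat_of_ratios[OF rA(2) _ b(1) n2(2)]) (rule rB(2))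
  have ijlm: "br A j m * br A i l * (br B j l * br B i m) = br A j l * br A i m * (br B j m * br B i l)"
    by (rule compat_of_ratios[OF rA(3) _ c(1) n2(3)]) (rule rB(3))
  have ab: "a * b \<noteq> 0" and ac: "a * c \<noteq> 0" and abd: "a * b * d \<noteq> 0"
    using a b c d by auto
  have jklm: "br A k l * br A j m * (br B j l * br B k m) = br A j l * br A k m * (br B k l * br B j m)"
  proof -
    consider "u $ 2 * (v $ 1 - v $ 2) \<noteq> 0 \<or> v $ 2 * (u $ 1 - u $ 2) \<noteq> 0"
      | "u $ 1 * w $ 1 - u $ 2 * w $ 2 \<noteq> 0 \<or> w $ 2 * (u $ 1 - u $ 2) \<noteq> 0"
      | "u $ 1 = u $ 2" "v $ 1 = v $ 2" "w $ 1 = w $ 2"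
      using n2 by force
    then show ?thesis
    proof cases
      case 1
      show ?thesis
        by (rule compat_of_ratios[OF rA(4) _ ab 1])
          (use rB(4) in \<open>simp only: right_diff_distrib left_diff_distrib mult_ac\<close>)
    next
      case 2
      show ?thesis
        by (rule compat_of_ratios[OF rA(5) _ ac 2])
          (use rB(5) in \<open>simp only: right_diff_distrib left_diff_distrib mult_ac\<close>)
    next
      case 3
      then have t12: "t $ (2, 1, 2) \<noteq> 0 \<or> t $ (1, 2, 2) \<noteq> 0"
        using n2 nz blowup_coords_nonzero[OF R(3)] by auto
      show ?thesis
        by (rule compat_of_ratios[OF rA(6) _ d(1) t12]) (rule rB(6))
    qed
  qed
  have iklm: "br A k l * br A i m * (br B i l * br B k m) = br A i l * br A k m * (br B k l * br B i m)"
  proof -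
    consider "u $ 1 * (v $ 1 - v $ 2) \<noteq> 0 \<or> v $ 1 * (u $ 1 - u $ 2) \<noteq> 0"
      | "u $ 1 * w $ 1 - u $ 2 * w $ 2 \<noteq> 0 \<or> w $ 1 * (u $ 1 - u $ 2) \<noteq> 0"
      | "u $ 1 = u $ 2" "v $ 1 = v $ 2" "w $ 1 = w $ 2"
      using n2 by force
    then show ?thesis
    proof cases
      case 1
      show ?thesis
        by (rule compat_of_ratios[OF rA(7) _ ab 1])
          (use rB(7) in \<open>simp only: right_diff_distrib left_diff_distrib mult_ac\<close>)
    next
      case 2
      show ?thesis
        by (rule compat_of_ratios[OF rA(8) _ ac 2])
          (use rB(8) in \<open>simp only: right_diff_distrib left_diff_distrib mult_ac\<close>)
    next
      case 3
      then have t12: "t $ (2, 1, 2) \<noteq> 0 \<or> t $ (1, 2, 2) \<noteq> 0"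
        using n2 nz blowup_coords_nonzero[OF R(3)] by auto
      then have ne: "u $ 1 * v $ 2 * t $ (2, 1, 2) \<noteq> 0 \<or> v $ 1 * u $ 2 * t $ (1, 2, 2) \<noteq> 0"
        using n2 3 by auto
      show ?thesis
        by (rule compat_of_ratios[OF rA(9) _ abd ne]) (use rB(9) in \<open>simp only: mult_ac\<close>)
    qed
  qed
  show ?thesis
  proof (rule compat_from_quadruples)
    have "compat_at A B j k l i"
      using ijkl by (simp add: compat_at_def br_swap[of _ l i] br_swap[of _ k i] mult_ac)
    then show "compat_at A B i j k l"
      by (rule compat_at_perm) (use label_distinct in auto)
    have "compat_at A B j k m i"
      using ijkm by (simp add: compat_at_def br_swap[of _ m i] br_swap[of _ k i] mult_ac)
    then show "compat_at A B i j k m"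
      by (rule compat_at_perm) (use label_distinct in auto)
    have "compat_at A B j l m i"
      using ijlm by (simp add: compat_at_def br_swap[of _ m i] br_swap[of _ l i] mult_ac)
    then show "compat_at A B i j l m"
      by (rule compat_at_perm) (use label_distinct in auto)
    have "compat_at A B k l m j" if "br A k l * br A j m * (br B k m * br B l j) = br A k m * br A l j * (br B k l * br B j m)"
      using that by (simp add: compat_at_def br_swap[of _ m j] mult_ac)
    then have "compat_at A B k l m j"
      using jklm by (simp add: br_swap[of _ l j] mult_ac)
    then show "compat_at A B j k l m"
      by (rule compat_at_perm) (use label_distinct in auto)
    have "compat_at A B k l m i" if "br A k l * br A i m * (br B k m * br B l i) = br A k m * br A l i * (br B k l * br B i m)"
      using that by (simp add: compat_at_def br_swap[of _ m i] mult_ac)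
    then have "compat_at A B k l m i"
      using iklm by (simp add: br_swap[of _ l i] mult_ac)
    then show "compat_at A B i k l m"
      by (rule compat_at_perm) (use label_distinct in auto)
  qed
qed

theorem Gamma_unique:
  assumes y: "(c, y) \<in> Gamma" and y': "(c, y') \<in> Gamma" and m: "moment_hat y = moment_hat y'"
  shows "y = y'"
proof -
  obtain u v w t A where z: "(u, v, w, t, A) \<in> closure main_parameters"
    "(c, y) = (((line u, line v, line w), line t), orb A)"
    using y unfolding Gamma_def by auto
  obtain u' v' w' t' B where z': "(u', v', w', t', B) \<in> closure main_parameters"
    "(c, y') = (((line u', line v', line w'), line t'), orb B)"
    using y' unfolding Gamma_def by auto
  have "compat A B" using closure_compat[OF z(1) z'(1)] z(2) z'(2) by auto
  moreover have "A \<in> frames" "B \<in> frames"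
    using z(1) z'(1) closure_main_parameters_subset normal_frames_subset by (auto simp: unit_parameters_def)
  ultimately show ?thesis
    using m z(2) z'(2) compat_moment_eq_imp_same_T_orbit[of A B] by (simp add: moment_hat_orb orb_def[symmetric])
qed

end

section \<open>The quotient map\<close>

lemma homeomorphic_map_quotient_by_fibres:
  assumes q: "quotient_map X Y f"
    and R: "R = {(x, x'). x \<in> topspace X \<and> x' \<in> topspace X \<and> f x = f x'}"
  shows "homeomorphic_map (final_topology X (topspace X // R) (\<lambda>x. R `` {x})) Y (\<lambda>C. the_elem (f ` C))"
    (is "homeomorphic_map ?Q Y ?g")
proof -
  have cl: "R `` {x} = {x' \<in> topspace X. f x' = f x}" if "x \<in> topspace X" for x
    using that by (auto simp: R)
  have g: "?g (R `` {x}) = f x" if "x \<in> topspace X" for x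
  proof -
    have "f ` (R `` {x}) = {f x}" unfolding cl[OF that] using that by auto
    then show ?thesis by simp
  qed
  have maps: "(\<lambda>x. R `` {x}) \<in> topspace X \<rightarrow> topspace X // R" by (auto intro: quotientI)
  then have top: "topspace ?Q = topspace X // R" by (rule topspace_final_topology)
  have img: "?g ` (topspace X // R) = f ` topspace X"
    unfolding quotient_def by (force simp: g image_iff)
  have "inj_on ?g (topspace X // R)"
  proof (rule inj_onI)
    fix C D assume h: "C \<in> topspace X // R" "D \<in> topspace X // R" "?g C = ?g D"
    then obtain x y where xy: "x \<in> topspace X" "y \<in> topspace X" "C = R `` {x}" "D = R `` {y}"
      by (auto elim!: quotientE)
    then have "f x = f y" using h(3) g by simp
    then show "C = D" using xy cl by simp
  qed
  moreover have "quotient_map ?Q Y ?g"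
    unfolding quotient_map_def top
  proof (intro conjI allI impI)
    show "?g ` (topspace X // R) = topspace Y"
      unfolding img by (rule quotient_imp_surjective_map[OF q])
    fix U assume U: "U \<subseteq> topspace Y"
    have "{x \<in> topspace X. R `` {x} \<in> {C \<in> topspace X // R. ?g C \<in> U}} = {x \<in> topspace X. f x \<in> U}"
      using g by (auto intro: quotientI)
    then show "openin ?Q {C \<in> topspace X // R. ?g C \<in> U} = openin Y U"
      using q U by (simp add: openin_final_topology quotient_map_def)
  qed
  ultimately show ?thesis by (simp add: homeomorphic_map_def top)
qed

lemma moment_tilde_in_calP: "moment_tilde \<in> GT \<rightarrow> calP"
proof
  fix X assume "X \<in> GT"
  then obtain A where A: "A \<in> frames" "X = orb A" by (rule GT_obtain_frame)
  then show "moment_tilde X \<in> calP"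
    using moment_in_rel_interior[OF A(1)] rel_interior_subset
    by (auto simp: moment_tilde_orb calP_def admissible_iff)
qed

lemma mem_calE:
  "((\<sigma>, x), c) \<in> calE i j \<longleftrightarrow> \<sigma> \<in> admissible \<and> x \<in> rel_interior (poly_of \<sigma>) \<and> c \<in> Ftilde_virt \<sigma> i j"
  by (simp only: calE_def mem_Collect_eq prod.inject) blast

text \<open>The position in \<open>real^5\<close> remains continuous on the formal union, because
  its composite with \<open>moment_tilde\<close> is \<open>moment_hat\<close>.\<close>

lemma continuous_map_calP_snd: "continuous_map calP_top euclidean snd"
proof -
  have "snd \<circ> moment_tilde = moment_hat" by (auto simp: moment_tilde_def)
  then show ?thesis
    unfolding calP_top_def using moment_tilde_in_calP continuous_map_moment_hat
    by (intro continuous_map_from_final_topology) auto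
qed

context chart_labels
begin

text \<open>Another candidate \<open>y'\<close> is moved within its complex torus orbit to the
  moment of \<open>y\<close>. There \<open>Gamma\<close> has only one point over \<open>c\<close>,
  so the two orbits of the complex torus coincide.\<close>

lemma g_proj_eq:
  assumes cy: "(c, y) \<in> Gamma" and y: "y \<in> stratum_T \<sigma>"
  shows "g_proj \<sigma> i j c = p_map y"
  unfolding g_proj_def
proof (rule the_equality)
  show "\<exists>y'. approximates \<sigma> i j c y' \<and> p_map y = p_map y'"
    using assms by (auto simp: approximates_iff)
  fix f assume "\<exists>y'. approximates \<sigma> i j c y' \<and> f = p_map y'"
  then obtain y' where y': "y' \<in> stratum_T \<sigma>" "(c, y') \<in> Gamma" "f = p_map y'"
    by (auto simp: approximates_iff)
  obtain A where A: "A \<in> frames" "y = orb A" "supp A = \<sigma> \<inter> pairs" using y by (rule stratum_T_obtain_frame)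
  obtain B where B: "B \<in> frames" "y' = orb B" "supp B = \<sigma> \<inter> pairs" using y'(1) by (rule stratum_T_obtain_frame)
  have "moment (colspan A) \<in> rel_interior (poly_of (supp B))"
    using moment_in_rel_interior[OF A(1)] A(3) B(3) by simp
  then obtain t where t: "t \<in> CT5" "moment (act t (colspan B)) = moment (colspan A)"
    by (rule moment_onto_rel_interior[OF B(1)])
  have s: "scale t B \<in> frames" using scale_frames[OF B(1) t(1)] .
  have "(c, orb (scale t B)) \<in> Gamma"
    using Gamma_act[OF t(1) y'(2)] by (simp add: B(2) continuous_map_act(2)[OF t(1)])
  then have "orb (scale t B) = y"
    by (rule Gamma_unique[OF _ cy]) (simp add: A moment_hat_orb s t(2) flip: act_colspan)
  then have "p_map y = CT_orbit (act t (colspan B))"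
    by (simp add: p_map_orb act_colspan flip: \<open>orb (scale t B) = y\<close>)
  then show "f = p_map y" using t(1) by (simp add: y'(3) B(2) p_map_orb CT_orbit_act)
qed

text \<open>Injective on \<open>Gamma\<close> by \<open>Gamma_unique\<close>: the parameter and the
  moment together recover the orbit.\<close>

definition to_calE :: "bl_point \<times> (complex^5) set set \<Rightarrow> calP_point \<times> bl_point" where
  "to_calE p = (moment_tilde (snd p), fst p)"

lemma H_map_to_calE:
  assumes "p \<in> Gamma"
  shows "H_map i j (to_calE p) = snd p"
proof -
  obtain c y where p: "p = (c, y)" "(c, y) \<in> Gamma" using assms by (cases p) auto
  obtain A where A: "A \<in> frames" "y = orb A" using Gamma_GT[OF p(2)] by (rule GT_obtain_frame)
  have y: "y \<in> stratum_T (supp A)"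
    using A supp_subset by (auto simp: orb_in_stratum_T_iff)
  have "H_map i j (to_calE p) = h_inv (supp A) (moment_hat y, p_map y)"
    using A g_proj_eq[OF p(2) y] by (simp add: p(1) to_calE_def H_map_def moment_tilde_orb moment_hat_orb)
  then show ?thesis using h_inv_eq[OF y] by (simp add: p(1))
qed

lemma to_calE_image: "to_calE ` Gamma = calE i j"
proof (intro subset_antisym subsetI)
  fix e assume "e \<in> to_calE ` Gamma"
  then obtain c y where p: "e = to_calE (c, y)" "(c, y) \<in> Gamma" by auto
  obtain A where A: "A \<in> frames" "y = orb A" using Gamma_GT[OF p(2)] by (rule GT_obtain_frame)
  have "approximates (supp A) i j c y"
    using A p(2) supp_subset by (auto simp: approximates_iff orb_in_stratum_T_iff)
  then have "c \<in> Ftilde_virt (supp A) i j"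
    using Gamma_Ftilde[OF p(2)] by (auto simp: Ftilde_virt_def)
  then show "e \<in> calE i j"
    using A(1) moment_in_rel_interior[OF A(1)]
    by (simp add: p(1) to_calE_def A(2) moment_tilde_orb mem_calE) (auto simp: admissible_iff)
next
  fix e assume "e \<in> calE i j"
  then obtain \<sigma> x c y where e: "e = ((\<sigma>, x), c)" "\<sigma> \<in> admissible" "x \<in> rel_interior (poly_of \<sigma>)"
    "y \<in> stratum_T \<sigma>" "(c, y) \<in> Gamma"
    unfolding calE_def Ftilde_virt_def approximates_iff by blast
  have "\<sigma> \<inter> pairs = \<sigma>" using e(2) by (auto simp: admissible_def)
  with e(4) obtain A where A: "A \<in> frames" "y = orb A" "supp A = \<sigma>" by (metis stratum_T_obtain_frame)
  \<comment> \<open>The definition of the virtual space yields some orbit over \<open>c\<close> in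
    the stratum of \<open>\<sigma>\<close>; the complex torus moves it to the prescribed moment
    \<open>x\<close> without leaving the stratum or the fibre over \<open>c\<close>.\<close>
  obtain t where t: "t \<in> CT5" "moment (act t (colspan A)) = x"
    using moment_onto_rel_interior[OF A(1)] e(3) A(3) by blast
  have s: "scale t A \<in> frames" using scale_frames[OF A(1) t(1)] .
  have "(c, orb (scale t A)) \<in> Gamma"
    using Gamma_act[OF t(1) e(5)] by (simp add: A(2) continuous_map_act(2)[OF t(1)])
  moreover have "to_calE (c, orb (scale t A)) = e"
    using t by (simp add: to_calE_def moment_tilde_orb[OF s] supp_scale A(3) e(1) flip: act_colspan)
  ultimately show "e \<in> to_calE ` Gamma" by (metis imageI)
qed

lemma continuous_map_to_calE: "continuous_map (subtopology ambient Gamma) (calE_top i j) to_calE"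
proof -
  have fst: "continuous_map (subtopology ambient Gamma) (prod_topology p1_cubed_top proj_top) fst"
    unfolding ambient_def by (intro continuous_map_from_subtopology continuous_map_fst)
  have "fst ` Gamma \<subseteq> Ftilde" using Gamma_Ftilde by auto
  then have 1: "continuous_map (subtopology ambient Gamma) Ftilde_top fst"
    using fst by (auto simp: Ftilde_top_def continuous_map_in_subtopology)
  have "continuous_map GT_top calP_top moment_tilde"
    unfolding calP_top_def using moment_tilde_in_calP by (intro continuous_map_into_final_topology) simp
  moreover have "continuous_map (subtopology ambient Gamma) GT_top snd"
    unfolding ambient_def by (intro continuous_map_from_subtopology continuous_map_snd)
  ultimately have 2: "continuous_map (subtopology ambient Gamma) calP_top (\<lambda>p. moment_tilde (snd p))"
    using continuous_map_compose by (metis (no_types, lifting) comp_apply continuous_map_eq)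
  have "continuous_map (subtopology ambient Gamma) (prod_topology calP_top Ftilde_top) to_calE"
    unfolding to_calE_def[abs_def] using 2 1 by (rule continuous_map_pairedI)
  moreover have "to_calE ` topspace (subtopology ambient Gamma) \<subseteq> calE i j"
    using to_calE_image by auto
  ultimately show ?thesis
    unfolding calE_top_def continuous_map_in_subtopology by auto
qed

lemma topspace_calE_top [simp]: "topspace (calE_top i j) = calE i j"
proof
  show "topspace (calE_top i j) \<subseteq> calE i j" by (simp add: calE_top_def)
  have "to_calE ` topspace (subtopology ambient Gamma) \<subseteq> topspace (calE_top i j)"
    using continuous_map_to_calE by (rule continuous_map_image_subset_topspace)
  moreover have "topspace (subtopology ambient Gamma) = Gamma"
    using Gamma_subset by auto
  ultimately show "calE i j \<subseteq> topspace (calE_top i j)" by (simp add: to_calE_image)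
qed

text \<open>The topology of the formal union of polytopes is not Hausdorff; separation comes from the
  fact that a point of the hypersimplex and a parameter determine the stratum.\<close>

lemma Hausdorff_space_calE: "Hausdorff_space (calE_top i j)"
proof (rule Hausdorff_space_injective_preimage)
  let ?f = "\<lambda>e :: calP_point \<times> bl_point. (snd (fst e), snd e)"
  show "Hausdorff_space (prod_topology (euclidean :: (real^5) topology) Ftilde_top)"
    by (simp add: Hausdorff_space_prod_topology Ftilde_top_def Hausdorff_space_subtopology
        Hausdorff_space_p1_cubed Hausdorff_space_proj_top)
  show "continuous_map (calE_top i j) (prod_topology euclidean Ftilde_top) ?f"
    unfolding calE_top_def
    using continuous_map_compose[OF continuous_map_fst continuous_map_calP_snd, unfolded comp_def]
    by (intro continuous_map_from_subtopology continuous_map_pairedI continuous_map_snd) auto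
  show "inj_on ?f (topspace (calE_top i j))"
    unfolding topspace_calE_top to_calE_image[symmetric]
  proof (rule inj_onI, elim imageE)
    fix e e' p p' assume h: "?f e = ?f e'" "e = to_calE p" "e' = to_calE p'" "p \<in> Gamma" "p' \<in> Gamma"
    then have m: "moment_hat (snd p) = moment_hat (snd p')" and c: "fst p = fst p'"
      by (simp_all add: to_calE_def moment_tilde_def)
    have "(fst p, snd p) \<in> Gamma" "(fst p, snd p') \<in> Gamma"
      using h(4,5) by (simp, simp add: c)
    then have "p = p'" using Gamma_unique[OF _ _ m] c prod_eqI by metis
    then show "e = e'" using h by simp
  qed
qed

text \<open>Composing with the quotient map \<open>to_calE\<close> turns \<open>H_map\<close> into
  \<open>snd\<close>, which is a quotient map on \<open>Gamma\<close>; a map whose composite with a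
  preceding quotient map is a quotient map is one itself.\<close>

lemma quotient_map_H_map: "quotient_map (calE_top i j) GT_top (H_map i j)"
proof -
  let ?G = "subtopology ambient Gamma"
  have G: "topspace ?G = Gamma" using Gamma_subset by auto
  have comp: "compact_space ?G" using compactin_Gamma by (simp add: compact_space_subtopology)
  have "quotient_map ?G (calE_top i j) to_calE"
    by (rule continuous_imp_quotient_map[OF continuous_map_to_calE comp Hausdorff_space_calE])
      (unfold G topspace_calE_top, rule to_calE_image)
  moreover have "quotient_map ?G GT_top (H_map i j \<circ> to_calE)"
  proof (rule quotient_map_eq)
    have "continuous_map ?G GT_top snd"
      unfolding ambient_def by (intro continuous_map_from_subtopology continuous_map_snd)
    moreover have "snd ` Gamma = GT"
      using Gamma_surj Gamma_GT by force
    ultimately show "quotient_map ?G GT_top snd"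
      by (intro continuous_imp_quotient_map[OF _ comp Hausdorff_space_GT]) (simp_all only: G topspace_GT_top)
    show "snd p = (H_map i j \<circ> to_calE) p" if "p \<in> topspace ?G" for p
      using that H_map_to_calE unfolding G by simp
  qed
  ultimately show ?thesis using quotient_map_compose_eq by blast
qed

end

theorem theorem11p1:
  fixes i j :: 5
  assumes "i < j"
  shows "homeomorphic_map (calE_quot_top i j) GT_top (H_induced i j)"
proof -
  obtain k l m where "chart_labels i j k l m" using chart_labels_exist[OF assms] .
  then interpret chart_labels i j k l m .
  have "H_rel i j = {(e, e'). e \<in> topspace (calE_top i j) \<and> e' \<in> topspace (calE_top i j)
      \<and> H_map i j e = H_map i j e'}"
    by (simp add: H_rel_def)
  from homeomorphic_map_quotient_by_fibres[OF quotient_map_H_map this] show ?thesis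
    by (simp add: calE_quot_top_def H_induced_def[abs_def])
qed

end
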